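(* There exist a function $f(p,\epsilon)$ and a constant $C$ such that for any real $n\times d$ matrix $\mathbf{A}$ of full column rank, any $p\ge2$ and any $\epsilon>0$, one can compute $(1+\epsilon)$-approximate $\ell_p$ Lewis weights of $\mathbf{A}$ (weights $w$ with $w_i\approx_{1+\epsilon}\bar w_i$ for all $i$), or the corresponding quadratic form $\mathbf{Q}$, in time $O(f(p,\epsilon)\,n\log(n)\log\log(n)\,d^C)$.
   Context: Rows of $\mathbf{A}$ are $a_1,\dots,a_n\in\mathbb{R}^d$. The $\ell_p$ Lewis weights $\bar w$ are the unique nonnegative weights with $a_i^T(\mathbf{A}^T\bar{\mathbf{W}}^{1-2/p}\mathbf{A})^{-1}a_i=\bar w_i^{2/p}$ for all $i$, $\bar{\mathbf{W}}=\mathrm{diag}(\bar w)$. The quadratic form $\mathbf{Q}$ is a maximizer of $\det\mathbf{M}$ over symmetric $\mathbf{M}\succeq0$ with $\sum_i(a_i^T\mathbf{M}a_i)^{p/2}\le d$, for which $\bar w_i=(a_i^T\mathbf{Q}a_i)^{p/2}$. For $\alpha\ge1$, $x\approx_\alpha y$ means $\frac1\alpha x\le y\le\alpha x$. *)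

theory Defs
  imports Complex_Main "Jordan_Normal_Form.DL_Rank"
begin

section \<open>Lewis weights and the Lewis quadratic form\<close>

definition quad_form :: "real mat \<Rightarrow> real vec \<Rightarrow> real" where
  "quad_form M x = x \<bullet> (M *\<^sub>v x)"

definition psd :: "nat \<Rightarrow> real mat \<Rightarrow> bool" where
  "psd d M \<longleftrightarrow> M \<in> carrier_mat d d \<and> transpose_mat M = M \<and>
     (\<forall>x \<in> carrier_vec d. 0 \<le> quad_form M x)"

text \<open>For \<open>p = 2\<close> the exponent \<open>1 - 2/p\<close> is \<open>0\<close>, and \<open>0 powr 0 = 0\<close> in HOL.  Reading
  \<open>0\<^sup>0\<close> as \<open>1\<close> instead would not change the notion below: the defining equation
  forces \<open>w\<^sub>i = 0\<close> only for zero rows \<open>a\<^sub>i\<close>, which contribute nothing to the matrix.\<close>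

definition is_lewis_weights :: "real mat \<Rightarrow> real \<Rightarrow> real vec \<Rightarrow> bool" where
  "is_lewis_weights A p w \<longleftrightarrow>
     w \<in> carrier_vec (dim_row A) \<and> (\<forall>i < dim_row A. 0 \<le> w $ i) \<and>
     (\<exists>N \<in> carrier_mat (dim_col A) (dim_col A).
        let M = transpose_mat A * mat_diag (dim_row A) (\<lambda>i. (w $ i) powr (1 - 2 / p)) * A
        in inverts_mat M N \<and> inverts_mat N M \<and>
           (\<forall>i < dim_row A. quad_form N (row A i) = (w $ i) powr (2 / p)))"

definition lewis_weights :: "real mat \<Rightarrow> real \<Rightarrow> real vec" where
  "lewis_weights A p = (THE w. is_lewis_weights A p w)"

definition lewis_feasible :: "real mat \<Rightarrow> real \<Rightarrow> real mat set" where
  "lewis_feasible A p =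
     {M. psd (dim_col A) M \<and>
         (\<Sum>i<dim_row A. quad_form M (row A i) powr (p / 2)) \<le> real (dim_col A)}"

definition is_lewis_form :: "real mat \<Rightarrow> real \<Rightarrow> real mat \<Rightarrow> bool" where
  "is_lewis_form A p Q \<longleftrightarrow>
     Q \<in> lewis_feasible A p \<and> (\<forall>M \<in> lewis_feasible A p. det M \<le> det Q) \<and>
     (\<forall>i < dim_row A. lewis_weights A p $ i = quad_form Q (row A i) powr (p / 2))"

definition approx_factor :: "real \<Rightarrow> real \<Rightarrow> real \<Rightarrow> bool" where
  "approx_factor \<alpha> x y \<longleftrightarrow> (1 / \<alpha>) * x \<le> y \<and> y \<le> \<alpha> * x"

text \<open>The same relation for quadratic forms, with respect to the Loewner order.\<close>

definition loewner_le :: "nat \<Rightarrow> real mat \<Rightarrow> real mat \<Rightarrow> bool" where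
  "loewner_le d M N \<longleftrightarrow> M \<in> carrier_mat d d \<and> N \<in> carrier_mat d d \<and> psd d (N - M)"

definition approx_form :: "nat \<Rightarrow> real \<Rightarrow> real mat \<Rightarrow> real mat \<Rightarrow> bool" where
  "approx_form d \<alpha> X Y \<longleftrightarrow>
     loewner_le d ((1 / \<alpha>) \<cdot>\<^sub>m X) Y \<and> loewner_le d Y (\<alpha> \<cdot>\<^sub>m X)"


section \<open>Cost model: a real RAM\<close>

text \<open>Running times are measured on a real RAM, given as a structured imperative language with
  arrays of natural numbers (addresses and counters) and arrays of real numbers.  All cells are
  unbounded registers, and each memory access, operation and test has unit cost.  On reals
  there are exact field operations, comparison, and the power function \<open>x powr y\<close>, which
  the definition of Lewis weights needs.  On natural numbers there are only addition and
  truncated subtraction.  There is no conversion from reals to natural numbers (no floor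
  function), and only integer real constants are allowed, so programs can neither pack
  several data items into one real nor carry infinite information in a constant.\<close>

type_synonym name = string

record ram_state =
  nmem :: "name \<Rightarrow> nat \<Rightarrow> nat"
  rmem :: "name \<Rightarrow> nat \<Rightarrow> real"

datatype nexp =
    NConst nat
  | NCell name nexp
  | NAdd nexp nexp
  | NSub nexp nexp

datatype rexp =
    RConst int
  | RCell name nexp
  | ROfNat nexp
  | RAdd rexp rexp
  | RSub rexp rexp
  | RMul rexp rexp
  | RDiv rexp rexp
  | RPow rexp rexp

datatype bexp =
    NLess nexp nexp
  | RLess rexp rexp
  | BNot bexp
  | BAnd bexp bexp

datatype com =
    Skip
  | NStore name nexp nexp
  | RStore name nexp rexp
  | Seq com com
  | Cond bexp com com
  | While bexp com

fun nval :: "nexp \<Rightarrow> ram_state \<Rightarrow> nat" where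
  "nval (NConst k) s = k"
| "nval (NCell a e) s = nmem s a (nval e s)"
| "nval (NAdd e1 e2) s = nval e1 s + nval e2 s"
| "nval (NSub e1 e2) s = nval e1 s - nval e2 s"

text \<open>Division by zero yields \<open>0\<close> as usual in HOL; powers of nonpositive bases are
  fixed to \<open>0\<close>.\<close>

fun rval :: "rexp \<Rightarrow> ram_state \<Rightarrow> real" where
  "rval (RConst k) s = of_int k"
| "rval (RCell a e) s = rmem s a (nval e s)"
| "rval (ROfNat e) s = real (nval e s)"
| "rval (RAdd e1 e2) s = rval e1 s + rval e2 s"
| "rval (RSub e1 e2) s = rval e1 s - rval e2 s"
| "rval (RMul e1 e2) s = rval e1 s * rval e2 s"
| "rval (RDiv e1 e2) s = rval e1 s / rval e2 s"
| "rval (RPow e1 e2) s = (if 0 < rval e1 s then rval e1 s powr rval e2 s else 0)"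

fun bval :: "bexp \<Rightarrow> ram_state \<Rightarrow> bool" where
  "bval (NLess e1 e2) s \<longleftrightarrow> nval e1 s < nval e2 s"
| "bval (RLess e1 e2) s \<longleftrightarrow> rval e1 s < rval e2 s"
| "bval (BNot b) s \<longleftrightarrow> \<not> bval b s"
| "bval (BAnd b1 b2) s \<longleftrightarrow> bval b1 s \<and> bval b2 s"

fun ncost :: "nexp \<Rightarrow> nat" where
  "ncost (NConst k) = 1"
| "ncost (NCell a e) = 1 + ncost e"
| "ncost (NAdd e1 e2) = 1 + ncost e1 + ncost e2"
| "ncost (NSub e1 e2) = 1 + ncost e1 + ncost e2"

fun rcost :: "rexp \<Rightarrow> nat" where
  "rcost (RConst k) = 1"
| "rcost (RCell a e) = 1 + ncost e"
| "rcost (ROfNat e) = 1 + ncost e"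
| "rcost (RAdd e1 e2) = 1 + rcost e1 + rcost e2"
| "rcost (RSub e1 e2) = 1 + rcost e1 + rcost e2"
| "rcost (RMul e1 e2) = 1 + rcost e1 + rcost e2"
| "rcost (RDiv e1 e2) = 1 + rcost e1 + rcost e2"
| "rcost (RPow e1 e2) = 1 + rcost e1 + rcost e2"

fun bcost :: "bexp \<Rightarrow> nat" where
  "bcost (NLess e1 e2) = 1 + ncost e1 + ncost e2"
| "bcost (RLess e1 e2) = 1 + rcost e1 + rcost e2"
| "bcost (BNot b) = 1 + bcost b"
| "bcost (BAnd b1 b2) = 1 + bcost b1 + bcost b2"

definition nstore :: "name \<Rightarrow> nat \<Rightarrow> nat \<Rightarrow> ram_state \<Rightarrow> ram_state" where
  "nstore a k v s = s\<lparr>nmem := (nmem s)(a := (nmem s a)(k := v))\<rparr>"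

definition rstore :: "name \<Rightarrow> nat \<Rightarrow> real \<Rightarrow> ram_state \<Rightarrow> ram_state" where
  "rstore a k v s = s\<lparr>rmem := (rmem s)(a := (rmem s a)(k := v))\<rparr>"

text \<open>\<open>exec c s t s'\<close>: started in \<open>s\<close>, the program \<open>c\<close> halts in state \<open>s'\<close> after \<open>t\<close> steps.\<close>

inductive exec :: "com \<Rightarrow> ram_state \<Rightarrow> nat \<Rightarrow> ram_state \<Rightarrow> bool" where
  Skip: "exec Skip s 1 s"
| NStore: "exec (NStore a k e) s (1 + ncost k + ncost e) (nstore a (nval k s) (nval e s) s)"
| RStore: "exec (RStore a k e) s (1 + ncost k + rcost e) (rstore a (nval k s) (rval e s) s)"
| Seq: "exec c1 s t1 s1 \<Longrightarrow> exec c2 s1 t2 s2 \<Longrightarrow> exec (Seq c1 c2) s (t1 + t2) s2"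
| CondTrue: "bval b s \<Longrightarrow> exec c1 s t s1 \<Longrightarrow> exec (Cond b c1 c2) s (1 + bcost b + t) s1"
| CondFalse: "\<not> bval b s \<Longrightarrow> exec c2 s t s1 \<Longrightarrow> exec (Cond b c1 c2) s (1 + bcost b + t) s1"
| WhileFalse: "\<not> bval b s \<Longrightarrow> exec (While b c) s (1 + bcost b) s"
| WhileTrue: "bval b s \<Longrightarrow> exec c s t1 s1 \<Longrightarrow> exec (While b c) s1 t2 s2 \<Longrightarrow>
    exec (While b c) s (1 + bcost b + t1 + t2) s2"

inductive_cases exec_elims:
  "exec Skip s t s'"
  "exec (NStore a k e) s t s'"
  "exec (RStore a k e) s t s'"
  "exec (Seq c1 c2) s t s'"
  "exec (Cond b c1 c2) s t s'"

inductive_cases exec_While_elim: "exec (While b c) s t s'"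

lemma exec_deterministic:
  "exec c s t s1 \<Longrightarrow> exec c s t' s2' \<Longrightarrow> t = t' \<and> s1 = s2'"
proof (induction arbitrary: t' s2' rule: exec.induct)
  case (Skip s)
  then show ?case by (elim exec_elims) simp
next
  case (NStore a k e s)
  then show ?case by (elim exec_elims) simp
next
  case (RStore a k e s)
  then show ?case by (elim exec_elims) simp
next
  case (Seq c1 s t1 s1 c2 t2 s2)
  from Seq.prems obtain u1 r u2 where u: "t' = u1 + u2" "exec c1 s u1 r" "exec c2 r u2 s2'"
    by (rule exec_elims(4))
  from Seq.IH(1)[OF u(2)] have "t1 = u1" "s1 = r" by simp_all
  with Seq.IH(2) u show ?case by simp
next
  case (CondTrue b s c1 t s1 c2)
  from CondTrue.prems show ?case
  proof (rule exec_elims(5))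
    fix u assume "t' = Suc (bcost b + u)" "exec c1 s u s2'"
    with CondTrue.IH[of u s2'] show ?thesis by simp
  qed (simp add: CondTrue.hyps)
next
  case (CondFalse b s c2 t s1 c1)
  from CondFalse.prems show ?case
  proof (rule exec_elims(5))
    fix u assume "t' = Suc (bcost b + u)" "exec c2 s u s2'"
    with CondFalse.IH[of u s2'] show ?thesis by simp
  qed (simp add: CondFalse.hyps)
next
  case (WhileFalse b s c)
  from WhileFalse.prems show ?case
    by (rule exec_While_elim) (simp_all add: WhileFalse.hyps)
next
  case (WhileTrue b s c t1 s1 t2 s2)
  from WhileTrue.prems show ?case
  proof (rule exec_While_elim)
    fix u1 r u2
    assume u: "t' = Suc (bcost b + u1 + u2)" "exec c s u1 r" "exec (While b c) r u2 s2'"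
    from WhileTrue.IH(1)[OF u(2)] have "t1 = u1" "s1 = r" by simp_all
    with WhileTrue.IH(2) u show ?thesis by simp
  qed (simp add: WhileTrue.hyps)
qed

text \<open>The input occupies the cells \<open>n\<close>, \<open>d\<close>, \<open>p\<close>, \<open>eps\<close> and, in row-major order, the array \<open>A\<close>;
  all other cells are initially \<open>0\<close>.  Weights are returned in the array \<open>w\<close>, a
  \<open>d \<times> d\<close> quadratic form in the array \<open>Q\<close>, again in row-major order.\<close>

definition input_state :: "real mat \<Rightarrow> real \<Rightarrow> real \<Rightarrow> ram_state" where
  "input_state A p \<epsilon> =
     \<lparr>nmem = (\<lambda>a k. if a = ''n'' \<and> k = 0 then dim_row A
                    else if a = ''d'' \<and> k = 0 then dim_col A
                    else 0),
      rmem = (\<lambda>a k. if a = ''A'' \<and> k < dim_row A * dim_col A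
                      then A $$ (k div dim_col A, k mod dim_col A)
                    else if a = ''p'' \<and> k = 0 then p
                    else if a = ''eps'' \<and> k = 0 then \<epsilon>
                    else 0)\<rparr>"

definition output_weights :: "nat \<Rightarrow> ram_state \<Rightarrow> real vec" where
  "output_weights n s = vec n (\<lambda>i. rmem s ''w'' i)"

definition output_form :: "nat \<Rightarrow> ram_state \<Rightarrow> real mat" where
  "output_form d s = mat d d (\<lambda>(i, j). rmem s ''Q'' (i * d + j))"

end

theory Submission
  imports Defs "Jordan_Normal_Form.Schur_Decomposition"
begin

text \<open>Write \<open>P(w) = A\<^sup>T W\<^sup>1\<^sup>-\<^sup>2\<^sup>/\<^sup>p A\<close> and \<open>x\<^sub>i(w) = a\<^sub>i\<^sup>T P(w)\<^sup>-\<^sup>1 a\<^sub>i\<close>.  The weights \<open>w\<^sub>0 = d/n\<close>,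
  \<open>w\<^sub>k\<^sub>+\<^sub>1 = w\<^sub>k\<^sup>1\<^sup>-\<^sup>2\<^sup>/\<^sup>p x(w\<^sub>k)\<close> always sum to \<open>d\<close>.  Since \<open>1 / x\<^sub>i\<close> is concave in the coefficients
  \<open>w\<^sup>1\<^sup>-\<^sup>2\<^sup>/\<^sup>p\<close> and \<open>ln x\<^sub>i(w\<^sub>k)\<close> telescopes, the average \<open>w\<close> of the first \<open>T\<close> iterates satisfies
  \<open>x\<^sub>i(w) \<le> (1 + \<delta>) w\<^sub>i\<^sup>2\<^sup>/\<^sup>p\<close> as soon as \<open>n \<le> (1 + \<delta>)\<^sup>T\<close>, independently of the conditioning of \<open>A\<close>.

  Such one-sided bounds already determine the quadratic form up to a small factor.  For two such
  weights, Young's inequality bounds \<open>tr (P(w) P(w')\<^sup>-\<^sup>1)\<close> and \<open>tr (P(w') P(w)\<^sup>-\<^sup>1)\<close> by \<open>(1 + \<delta>) d\<close>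
  each; as every eigenvalue \<open>\<lambda>\<close> of \<open>P(w) P(w')\<^sup>-\<^sup>1\<close> contributes \<open>\<lambda> + 1/\<lambda> \<ge> 2\<close> to the sum of the two traces,
  all of them satisfy \<open>(\<lambda> - 1)\<^sup>2 \<le> 2 \<delta> d \<lambda>\<close>.  With \<open>\<delta> = 0\<close> this is the uniqueness of Lewis weights,
  and letting \<open>\<delta> \<rightarrow> 0\<close> it gives their existence.  Hence \<open>\<delta>\<close> proportional to \<open>1/d\<close>, and so \<open>O(d log n)\<close>
  iterations of \<open>O(n d\<^sup>2)\<close> operations, suffice.\<close>

section \<open>Linear algebra\<close>

text \<open>The concavity rests on a variational formula: if \<open>N\<close> is inverse to
  \<open>P\<close>, then \<open>1 / quad_form N a\<close> is the minimum of
  \<open>quad_form P y\<close> over \<open>y \<bullet> a = 1\<close>, an infimum of functions linear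
  in \<open>P\<close>. The obstacle is that the averaged weights are controlled from one side only,
  so the program does not return them. It returns \<open>quad_form N (row A i) powr (p / 2)\<close>,
  which inherits the two-sided comparison of the forms. This power also fixes the precision: the
  forms must agree up to \<open>(1 + \<epsilon>) powr (2 / p)\<close>. The same Hoelder bound that
  compares two solutions gives \<open>tr (P M) \<le> d\<close> for every feasible \<open>M\<close>,
  and hence the maximality of the determinant. The machine has neither logarithms nor products of
  natural numbers. The number of rounds is never computed: a cell holding
  \<open>(1 + \<delta>) ^ k\<close> is compared with \<open>n\<close>. Row offsets are tabulated by
  addition, and matrices are inverted by rank-one updates, which need no pivot search. The cost is
  of order \<open>n * ln n * d ^ 3\<close> for fixed \<open>p\<close> and \<open>\<epsilon>\<close>;
  the factor \<open>ln (ln n)\<close> of the bound enters only because it exceeds a positive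
  constant from \<open>n = 3\<close> on.\<close>

lemma (in vec_space) full_rank_cols:
  assumes A: "A \<in> carrier_mat n nc" and rank: "rank A = nc"
  shows "distinct (cols A)" "lin_indpt (set (cols A))"
proof -
  show "distinct (cols A)"
  proof (rule ccontr)
    assume nd: "\<not> distinct (cols A)"
    obtain S where S: "maximal S (\<lambda>T. T \<subseteq> set (cols A) \<and> lin_indpt T)"
      using maximal_exists[of "(\<lambda>T. T \<subseteq> set (cols A) \<and> lin_indpt T)" "card (set (cols A))" "{}"]
      by (meson List.finite_set card_mono empty_iff empty_subsetI finite_lin_indpt2 rev_finite_subset)
    then have "card S \<le> card (set (cols A))" by (simp add: card_mono maximal_def)
    \<comment> \<open>Repeated columns collapse in \<open>set (cols A)\<close>, which then has fewer
      than \<open>nc\<close> elements, while the rank is the size of the independent subset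
      \<open>S\<close>.\<close>
    also have "\<dots> < nc"
      using A nd card_length[of "cols A"] card_distinct[of "cols A"] by fastforce
    finally show False using rank_card_indpt[OF A S] rank by simp
  qed
  then show "lin_indpt (set (cols A))" using full_rank_lin_indpt[OF A rank] by blast
qed

lemma (in vec_space) full_rank_inj:
  assumes A: "A \<in> carrier_mat n nc" and rank: "rank A = nc"
    and v: "v \<in> carrier_vec nc" and 0: "A *\<^sub>v v = 0\<^sub>v n"
  shows "v = 0\<^sub>v nc"
  using lin_depI[OF A v _ 0] full_rank_cols[OF A rank] by blast

lemma (in vec_space) full_rank_le:
  assumes A: "A \<in> carrier_mat n nc" and rank: "rank A = nc"
  shows "nc \<le> n"
proof -
  have "set (cols A) \<subseteq> carrier_vec n" using A cols_dim by blast
  then have "card (set (cols A)) \<le> n"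
    using li_le_dim(2)[OF fin_dim] full_rank_cols(2)[OF A rank] dim_is_n by simp
  then show ?thesis
    using distinct_card[OF full_rank_cols(1)[OF A rank]] A by simp
qed

text \<open>Lagrange's identity: the double sum of
  \<open>u i * u j * (f i * g j - f j * g i)\<^sup>2\<close> is twice the difference of the two
  sides.\<close>

lemma weighted_Cauchy_Schwarz:
  fixes f g u :: "'b \<Rightarrow> real"
  assumes u: "\<And>i. i \<in> I \<Longrightarrow> 0 \<le> u i"
  shows "(\<Sum>i\<in>I. u i * (f i * g i))\<^sup>2 \<le> (\<Sum>i\<in>I. u i * (f i)\<^sup>2) * (\<Sum>i\<in>I. u i * (g i)\<^sup>2)"
proof -
  have "0 \<le> (\<Sum>i\<in>I. \<Sum>j\<in>I. u i * u j * (f i * g j - f j * g i)\<^sup>2)"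
    by (intro sum_nonneg mult_nonneg_nonneg) (auto simp: u)
  also have "\<dots> = (\<Sum>i\<in>I. \<Sum>j\<in>I. u i * (f i)\<^sup>2 * (u j * (g j)\<^sup>2) + u i * (g i)\<^sup>2 * (u j * (f j)\<^sup>2)
       - 2 * (u i * (f i * g i) * (u j * (f j * g j))))"
    by (intro sum.cong refl) (simp add: power2_eq_square algebra_simps)
  also have "\<dots> = 2 * ((\<Sum>i\<in>I. u i * (f i)\<^sup>2) * (\<Sum>i\<in>I. u i * (g i)\<^sup>2))
      - 2 * (\<Sum>i\<in>I. u i * (f i * g i))\<^sup>2"
    by (simp add: sum.distrib sum_subtractf sum_distrib_left[symmetric] sum_distrib_right[symmetric]
        power2_eq_square mult.commute)
  finally show ?thesis by simp
qed

text \<open>Weighted AM-GM, from the tangent of \<open>ln\<close> at the mean \<open>m\<close>. If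
  \<open>a\<close> or \<open>b\<close> is zero the left side vanishes for every \<open>s\<close>,
  because \<open>0 powr x = 0\<close> also at \<open>x = 0\<close>.\<close>

lemma Young_powr:
  fixes a b s :: real
  assumes "0 \<le> a" "0 \<le> b" "0 \<le> s" "s \<le> 1"
  shows "a powr s * b powr (1 - s) \<le> s * a + (1 - s) * b"
proof (cases "a = 0 \<or> b = 0")
  case True
  then show ?thesis using assms by auto
next
  case False
  then have pos: "0 < a" "0 < b" using assms by auto
  define m where "m = s * a + (1 - s) * b"
  have m: "0 < m"
  proof (cases "s = 0")
    case False
    then have "0 < s * a" "0 \<le> (1 - s) * b" using assms pos by auto
    then show ?thesis unfolding m_def by linarith
  qed (use pos in \<open>simp add: m_def\<close>)
  have l: "ln x - ln m \<le> x / m - 1" if "0 < x" for x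
    using ln_le_minus_one[of "x / m"] that m by (simp add: ln_div)
  have "s * (ln a - ln m) + (1 - s) * (ln b - ln m) \<le> s * (a / m - 1) + (1 - s) * (b / m - 1)"
    using assms pos by (intro add_mono mult_left_mono l) auto
  also have "\<dots> = 0" using m by (simp add: m_def field_simps)
  finally have "s * ln a + (1 - s) * ln b \<le> ln m" by (simp add: algebra_simps)
  then have "exp (s * ln a + (1 - s) * ln b) \<le> m" using m by (simp add: ln_ge_iff)
  then show ?thesis using pos by (simp add: powr_def exp_add m_def)
qed

lemma smult_mult_scalar_prod:
  fixes M :: "real mat"
  assumes "M \<in> carrier_mat d d" "x \<in> carrier_vec d" "y \<in> carrier_vec d"
  shows "x \<bullet> (M *\<^sub>v y) = (\<Sum>j<d. \<Sum>k<d. M $$ (j, k) * x $ j * y $ k)"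
  using assms by (auto simp: scalar_prod_def sum_distrib_left atLeast0LessThan intro!: sum.cong)

lemma symmetric_scalar_prod:
  fixes M :: "real mat"
  assumes M: "M \<in> carrier_mat d d" and sym: "transpose_mat M = M"
    and "x \<in> carrier_vec d" "y \<in> carrier_vec d"
  shows "x \<bullet> (M *\<^sub>v y) = (M *\<^sub>v x) \<bullet> y"
  using transpose_vec_mult_scalar[OF M, of y x] assms by simp

section \<open>Inverses, positive definiteness and Gram matrices\<close>

definition inverse_mats :: "nat \<Rightarrow> real mat \<Rightarrow> real mat \<Rightarrow> bool" where
  "inverse_mats d P N \<longleftrightarrow> P \<in> carrier_mat d d \<and> N \<in> carrier_mat d d \<and> P * N = 1\<^sub>m d \<and> N * P = 1\<^sub>m d"

definition pos_def :: "nat \<Rightarrow> real mat \<Rightarrow> bool" where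
  "pos_def d M \<longleftrightarrow> M \<in> carrier_mat d d \<and> transpose_mat M = M \<and>
     (\<forall>x \<in> carrier_vec d. x \<noteq> 0\<^sub>v d \<longrightarrow> 0 < quad_form M x)"

definition gram :: "real mat \<Rightarrow> (nat \<Rightarrow> real) \<Rightarrow> real mat" where
  "gram A u = transpose_mat A * mat_diag (dim_row A) u * A"

lemma quad_form_zero [simp]: "M \<in> carrier_mat d d \<Longrightarrow> quad_form M (0\<^sub>v d) = 0"
  by (simp add: quad_form_def)

lemma inverse_mats_vec:
  assumes "inverse_mats d P N" "y \<in> carrier_vec d"
  shows "P *\<^sub>v (N *\<^sub>v y) = y" "N *\<^sub>v (P *\<^sub>v y) = y"
  using assms assoc_mult_mat_vec[of P d d N d y] assoc_mult_mat_vec[of N d d P d y]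
  by (auto simp: inverse_mats_def)

lemma inverse_mats_symmetric:
  assumes inv: "inverse_mats d P N" and P: "transpose_mat P = P"
  shows "transpose_mat N = N"
proof -
  have c: "P \<in> carrier_mat d d" "N \<in> carrier_mat d d" "P * N = 1\<^sub>m d" "N * P = 1\<^sub>m d"
    using inv by (auto simp: inverse_mats_def)
  have "transpose_mat N * P = 1\<^sub>m d"
    using transpose_mult[OF c(1,2)] c(3) P by simp
  then have "transpose_mat N * P * N = N" using c by simp
  then show ?thesis using assoc_mult_mat[of "transpose_mat N" d d P d N d] c by simp
qed

lemma inverse_mats_unique:
  assumes "inverse_mats d P N" "inverse_mats d P N'"
  shows "N = N'"
proof -
  have c: "P \<in> carrier_mat d d" "N \<in> carrier_mat d d" "N' \<in> carrier_mat d d" "P * N' = 1\<^sub>m d" "N * P = 1\<^sub>m d"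
    using assms by (auto simp: inverse_mats_def)
  then show ?thesis using assoc_mult_mat[of N d d P d N' d] by simp
qed

lemma pos_def_psd: "pos_def d M \<Longrightarrow> psd d M"
  unfolding pos_def_def psd_def
  by (metis less_eq_real_def quad_form_zero)

lemma pos_def_inverse_exists:
  assumes P: "pos_def d P"
  shows "\<exists>N. inverse_mats d P N"
proof -
  have c: "P \<in> carrier_mat d d" using P by (simp add: pos_def_def)
  have "det P \<noteq> 0"
  proof
    assume "det P = 0"
    then obtain v where v: "v \<in> carrier_vec d" "v \<noteq> 0\<^sub>v d" "P *\<^sub>v v = 0\<^sub>v d"
      using det_0_iff_vec_prod_zero[OF c] by blast
    then have "quad_form P v = 0" by (simp add: quad_form_def)
    with P v show False by (auto simp: pos_def_def)
  qed
  then obtain N where "N \<in> carrier_mat d d" "N * P = 1\<^sub>m d" "P * N = 1\<^sub>m d"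
    using det_non_zero_imp_unit[OF c] by (auto simp: Units_def ring_mat_simps)
  then show ?thesis using c by (auto simp: inverse_mats_def)
qed

text \<open>Moves a form from the inverse to the matrix itself. For a Gram matrix the right side is
  a weighted sum of squares, to which Cauchy-Schwarz applies.\<close>

lemma inverse_mats_quad_form:
  assumes inv: "inverse_mats d P N" and y: "y \<in> carrier_vec d"
  shows "quad_form N y = quad_form P (N *\<^sub>v y)"
proof -
  have N: "N *\<^sub>v y \<in> carrier_vec d" using inv y by (auto simp: inverse_mats_def)
  show ?thesis
    unfolding quad_form_def inverse_mats_vec(1)[OF inv y] by (rule comm_scalar_prod[OF y N])
qed

lemma pos_def_inverse:
  assumes P: "pos_def d P" and inv: "inverse_mats d P N"
  shows "pos_def d N"
  unfolding pos_def_def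
proof (intro conjI ballI impI)
  show N: "N \<in> carrier_mat d d" using inv by (simp add: inverse_mats_def)
  show "transpose_mat N = N" using inverse_mats_symmetric[OF inv] P by (simp add: pos_def_def)
  fix x :: "real vec" assume x: "x \<in> carrier_vec d" "x \<noteq> 0\<^sub>v d"
  have "N *\<^sub>v x \<noteq> 0\<^sub>v d"
  proof
    assume "N *\<^sub>v x = 0\<^sub>v d"
    then have "P *\<^sub>v (N *\<^sub>v x) = 0\<^sub>v d" using inv by (auto simp: inverse_mats_def)
    with inverse_mats_vec(1)[OF inv x(1)] x show False by simp
  qed
  then show "0 < quad_form N x"
    using inverse_mats_quad_form[OF inv x(1)] P N x(1) by (auto simp: pos_def_def)
qed

lemma gram_carrier [simp]: "A \<in> carrier_mat n d \<Longrightarrow> gram A u \<in> carrier_mat d d"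
  by (auto simp: gram_def)

lemma gram_dim [simp]: "dim_row (gram A u) = dim_col A" "dim_col (gram A u) = dim_col A"
  by (auto simp: gram_def)

lemma mult_mat_entry:
  fixes M N :: "real mat"
  assumes "M \<in> carrier_mat a b" "N \<in> carrier_mat b c" "i < a" "k < c"
  shows "(M * N) $$ (i, k) = (\<Sum>j<b. M $$ (i, j) * N $$ (j, k))"
  using assms by (auto simp: scalar_prod_def atLeast0LessThan intro!: sum.cong)

lemma gram_entry:
  assumes A: "A \<in> carrier_mat n d" and jk: "j < d" "k < d"
  shows "gram A u $$ (j, k) = (\<Sum>i<n. u i * A $$ (i, j) * A $$ (i, k))"
proof -
  have "gram A u $$ (j, k) = (\<Sum>i<n. (transpose_mat A * mat_diag n u) $$ (j, i) * A $$ (i, k))"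
    using mult_mat_entry[of "transpose_mat A * mat_diag n u" d n A d j k] A jk by (simp add: gram_def)
  also have "transpose_mat A * mat_diag n u = mat d n (\<lambda>(j, i). transpose_mat A $$ (j, i) * u i)"
    using A by (intro mat_diag_mult_right) auto
  finally show ?thesis using A jk by (auto simp: mult.commute intro!: sum.cong)
qed

lemma gram_symmetric:
  assumes A: "A \<in> carrier_mat n d"
  shows "transpose_mat (gram A u) = gram A u"
  using A by (intro eq_matI) (auto simp: gram_entry[OF A] intro!: sum.cong)

lemma row_scalar_prod:
  fixes A :: "real mat"
  assumes "A \<in> carrier_mat n d" "i < n" "x \<in> carrier_vec d"
  shows "row A i \<bullet> x = (\<Sum>j<d. A $$ (i, j) * x $ j)"
  using assms by (auto simp: scalar_prod_def atLeast0LessThan)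

lemma gram_scalar_prod:
  assumes A: "A \<in> carrier_mat n d" and x: "x \<in> carrier_vec d" and y: "y \<in> carrier_vec d"
  shows "x \<bullet> (gram A u *\<^sub>v y) = (\<Sum>i<n. u i * ((row A i \<bullet> x) * (row A i \<bullet> y)))"
proof -
  have "x \<bullet> (gram A u *\<^sub>v y) = (\<Sum>j<d. \<Sum>k<d. \<Sum>i<n. u i * A $$ (i, j) * A $$ (i, k) * x $ j * y $ k)"
    unfolding smult_mult_scalar_prod[OF gram_carrier[OF A] x y]
    by (intro sum.cong refl) (simp add: gram_entry[OF A] sum_distrib_right)
  also have "\<dots> = (\<Sum>j<d. \<Sum>i<n. \<Sum>k<d. u i * A $$ (i, j) * A $$ (i, k) * x $ j * y $ k)"
    by (intro sum.cong refl sum.swap)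
  also have "\<dots> = (\<Sum>i<n. \<Sum>j<d. \<Sum>k<d. u i * A $$ (i, j) * A $$ (i, k) * x $ j * y $ k)"
    by (rule sum.swap)
  also have "\<dots> = (\<Sum>i<n. u i * ((row A i \<bullet> x) * (row A i \<bullet> y)))"
  proof (intro sum.cong refl)
    fix i assume "i \<in> {..<n}"
    then have i: "i < n" by simp
    show "(\<Sum>j<d. \<Sum>k<d. u i * A $$ (i, j) * A $$ (i, k) * x $ j * y $ k)
        = u i * ((row A i \<bullet> x) * (row A i \<bullet> y))"
      unfolding row_scalar_prod[OF A i x] row_scalar_prod[OF A i y] sum_product
      unfolding sum_distrib_left by (intro sum.cong refl) (simp add: mult_ac)
  qed
  finally show ?thesis .
qed

lemma gram_quad_form:
  assumes A: "A \<in> carrier_mat n d" and x: "x \<in> carrier_vec d"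
  shows "quad_form (gram A u) x = (\<Sum>i<n. u i * (row A i \<bullet> x)\<^sup>2)"
  unfolding quad_form_def gram_scalar_prod[OF A x x] by (simp add: power2_eq_square)

lemma trace_gram_mult:
  assumes A: "A \<in> carrier_mat n d" and M: "M \<in> carrier_mat d d"
  shows "(\<Sum>j<d. (gram A u * M) $$ (j, j)) = (\<Sum>i<n. u i * quad_form M (row A i))"
proof -
  have "(\<Sum>j<d. (gram A u * M) $$ (j, j)) = (\<Sum>j<d. \<Sum>k<d. \<Sum>i<n. u i * A $$ (i, j) * A $$ (i, k) * M $$ (k, j))"
    by (intro sum.cong refl)
      (simp add: mult_mat_entry[OF gram_carrier[OF A] M] gram_entry[OF A] sum_distrib_right)
  also have "\<dots> = (\<Sum>j<d. \<Sum>i<n. \<Sum>k<d. u i * A $$ (i, j) * A $$ (i, k) * M $$ (k, j))"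
    by (intro sum.cong refl sum.swap)
  also have "\<dots> = (\<Sum>i<n. \<Sum>j<d. \<Sum>k<d. u i * A $$ (i, j) * A $$ (i, k) * M $$ (k, j))"
    by (rule sum.swap)
  also have "\<dots> = (\<Sum>i<n. \<Sum>k<d. \<Sum>j<d. u i * A $$ (i, j) * A $$ (i, k) * M $$ (k, j))"
    by (intro sum.cong refl sum.swap)
  also have "\<dots> = (\<Sum>i<n. u i * quad_form M (row A i))"
  proof (intro sum.cong refl)
    fix i assume "i \<in> {..<n}"
    then have r: "row A i \<in> carrier_vec d" and i: "i < n" using A by auto
    show "(\<Sum>k<d. \<Sum>j<d. u i * A $$ (i, j) * A $$ (i, k) * M $$ (k, j)) = u i * quad_form M (row A i)"
      unfolding quad_form_def smult_mult_scalar_prod[OF M r r] sum_distrib_left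
      using A i by (intro sum.cong refl) (simp add: mult_ac)
  qed
  finally show ?thesis .
qed

text \<open>The left side is the trace of \<open>gram A u * N\<close>, the identity. This keeps the
  total of every iterate at \<open>d\<close> and gives exact Lewis weights the same total.\<close>

lemma trace_gram_inverse:
  assumes A: "A \<in> carrier_mat n d" and inv: "inverse_mats d (gram A u) N"
  shows "(\<Sum>i<n. u i * quad_form N (row A i)) = d"
proof -
  have "(\<Sum>i<n. u i * quad_form N (row A i)) = (\<Sum>j<d. (1\<^sub>m d :: real mat) $$ (j, j))"
    using inv trace_gram_mult[OF A, of N u] by (simp add: inverse_mats_def)
  then show ?thesis by simp
qed

text \<open>Since \<open>y = P (N y)\<close> for \<open>P = gram A u\<close>, the product
  \<open>z \<bullet> y\<close> is the inner product of \<open>z\<close> and \<open>N y\<close> in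
  the form of \<open>P\<close>. For \<open>z \<bullet> y = 1\<close> the lemma bounds
  \<open>quad_form P z\<close> below by \<open>1 / quad_form N y\<close>.\<close>

lemma gram_inverse_Cauchy_Schwarz:
  assumes A: "A \<in> carrier_mat n d" and u: "\<And>i. i < n \<Longrightarrow> 0 \<le> u i"
    and inv: "inverse_mats d (gram A u) N" and y: "y \<in> carrier_vec d" and z: "z \<in> carrier_vec d"
  shows "(z \<bullet> y)\<^sup>2 \<le> (\<Sum>i<n. u i * (row A i \<bullet> z)\<^sup>2) * quad_form N y"
proof -
  have Ny: "N *\<^sub>v y \<in> carrier_vec d" using inv y by (auto simp: inverse_mats_def)
  have "z \<bullet> y = z \<bullet> (gram A u *\<^sub>v (N *\<^sub>v y))" by (simp add: inverse_mats_vec[OF inv y])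
  also have "\<dots> = (\<Sum>i<n. u i * ((row A i \<bullet> z) * (row A i \<bullet> (N *\<^sub>v y))))"
    by (rule gram_scalar_prod[OF A z Ny])
  finally have "(z \<bullet> y)\<^sup>2 \<le> (\<Sum>i<n. u i * (row A i \<bullet> z)\<^sup>2) * (\<Sum>i<n. u i * (row A i \<bullet> (N *\<^sub>v y))\<^sup>2)"
    using weighted_Cauchy_Schwarz[of "{..<n}" u] u by simp
  also have "(\<Sum>i<n. u i * (row A i \<bullet> (N *\<^sub>v y))\<^sup>2) = quad_form N y"
    using inverse_mats_quad_form[OF inv y] gram_quad_form[OF A Ny] by simp
  finally show ?thesis .
qed

section \<open>Weights with one-sided bounds\<close>

text \<open>The sum \<open>T\<close> in the proof is \<open>tr (X P X P')\<close> for \<open>X = N - N'\<close>: expanding it gives the trace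
  term on the right, and Cauchy--Schwarz in \<open>P\<close> and in \<open>P'\<close> bounds it from below.\<close>

lemma gram_inverse_compare:
  assumes A: "A \<in> carrier_mat n d"
    and u: "\<And>i. i < n \<Longrightarrow> 0 \<le> u i" and u': "\<And>i. i < n \<Longrightarrow> 0 \<le> u' i"
    and inv: "inverse_mats d (gram A u) N" and inv': "inverse_mats d (gram A u') N'"
    and y: "y \<in> carrier_vec d"
  shows "(quad_form N y - quad_form N' y)\<^sup>2
    \<le> ((\<Sum>i<n. u i * quad_form N' (row A i)) + (\<Sum>i<n. u' i * quad_form N (row A i)) - 2 * d)
       * quad_form N y * quad_form N' y"
proof -
  let ?a = "row A"
  have N: "N \<in> carrier_mat d d" "N' \<in> carrier_mat d d" using inv inv' by (auto simp: inverse_mats_def)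
  have Nx [simp]: "N *\<^sub>v x \<in> carrier_vec d" "N' *\<^sub>v x \<in> carrier_vec d" if "x \<in> carrier_vec d" for x
    using N that by auto
  have a [simp]: "?a i \<in> carrier_vec d" if "i < n" for i using A that by auto
  have sym: "transpose_mat N = N" "transpose_mat N' = N'"
    using inverse_mats_symmetric[OF inv] inverse_mats_symmetric[OF inv'] gram_symmetric[OF A] by auto
  note swap = symmetric_scalar_prod[OF N(1) sym(1)] symmetric_scalar_prod[OF N(2) sym(2)]
  have comm: "v \<bullet> w = w \<bullet> v" if "v \<in> carrier_vec d" "w \<in> carrier_vec d" for v w :: "real vec"
    using that by (rule comm_scalar_prod)
  define z where "z x = N *\<^sub>v x - N' *\<^sub>v x" for x
  have z [simp]: "z x \<in> carrier_vec d" if "x \<in> carrier_vec d" for x using that N by (auto simp: z_def)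
  have zprod: "x \<bullet> z v = x \<bullet> (N *\<^sub>v v) - x \<bullet> (N' *\<^sub>v v)" if "x \<in> carrier_vec d" "v \<in> carrier_vec d" for x v
    unfolding z_def using that by (intro scalar_prod_minus_distrib) auto
  have quadN: "quad_form N x = (\<Sum>i<n. u i * (?a i \<bullet> (N *\<^sub>v x))\<^sup>2)" if "x \<in> carrier_vec d" for x
    using inverse_mats_quad_form[OF inv that] gram_quad_form[OF A Nx(1)[OF that]] by simp
  have quadN': "quad_form N' x = (\<Sum>i<n. u' i * (?a i \<bullet> (N' *\<^sub>v x))\<^sup>2)" if "x \<in> carrier_vec d" for x
    using inverse_mats_quad_form[OF inv' that] gram_quad_form[OF A Nx(2)[OF that]] by simp
  define T where "T = (\<Sum>i<n. u i * (\<Sum>k<n. u' k * (?a k \<bullet> z (?a i))\<^sup>2))"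
  have "T = (\<Sum>i<n. u i * ((\<Sum>k<n. u' k * (?a k \<bullet> (N *\<^sub>v ?a i))\<^sup>2)
      + (\<Sum>k<n. u' k * (?a k \<bullet> (N' *\<^sub>v ?a i))\<^sup>2)
      - 2 * (\<Sum>k<n. u' k * ((?a k \<bullet> (N *\<^sub>v ?a i)) * (?a k \<bullet> (N' *\<^sub>v ?a i))))))"
    unfolding T_def sum_distrib_left[of 2] sum.distrib[symmetric] sum_subtractf[symmetric]
    by (intro sum.cong refl arg_cong2[where f = "(*)"])
      (simp add: zprod power2_eq_square algebra_simps)
  also have "\<dots> = (\<Sum>i<n. u i * (\<Sum>k<n. u' k * (?a k \<bullet> (N *\<^sub>v ?a i))\<^sup>2))
      + (\<Sum>i<n. u i * quad_form N' (?a i)) - 2 * (\<Sum>i<n. u i * quad_form N (?a i))"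
  proof -
    have "(\<Sum>k<n. u' k * ((?a k \<bullet> (N *\<^sub>v ?a i)) * (?a k \<bullet> (N' *\<^sub>v ?a i)))) = quad_form N (?a i)"
      if "i < n" for i
    proof -
      have "(\<Sum>k<n. u' k * ((?a k \<bullet> (N *\<^sub>v ?a i)) * (?a k \<bullet> (N' *\<^sub>v ?a i))))
          = (N *\<^sub>v ?a i) \<bullet> (gram A u' *\<^sub>v (N' *\<^sub>v ?a i))"
        using that by (intro gram_scalar_prod[OF A, symmetric]) auto
      also have "\<dots> = quad_form N (?a i)"
        using that inverse_mats_vec(1)[OF inv', of "?a i"] comm[of "N *\<^sub>v ?a i" "?a i"] by (simp add: quad_form_def)
      finally show ?thesis .
    qed
    then show ?thesis
      by (simp add: quadN'[symmetric] algebra_simps sum.distrib sum_subtractf sum_distrib_left)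
  qed
  \<comment> \<open>By symmetry of \<open>N\<close> the inner sum may run over the first weights,
    where \<open>N P N = N\<close> collapses it to \<open>quad_form N (?a k)\<close>.\<close>
  also have "(\<Sum>i<n. u i * (\<Sum>k<n. u' k * (?a k \<bullet> (N *\<^sub>v ?a i))\<^sup>2))
      = (\<Sum>k<n. u' k * (\<Sum>i<n. u i * (?a i \<bullet> (N *\<^sub>v ?a k))\<^sup>2))"
  proof -
    have "?a k \<bullet> (N *\<^sub>v ?a i) = ?a i \<bullet> (N *\<^sub>v ?a k)" if "i < n" "k < n" for i k
      using that swap(1)[of "?a k" "?a i"] comm[of "N *\<^sub>v ?a k" "?a i"] by simp
    then have "(\<Sum>i<n. u i * (\<Sum>k<n. u' k * (?a k \<bullet> (N *\<^sub>v ?a i))\<^sup>2))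
        = (\<Sum>i<n. \<Sum>k<n. u' k * (u i * (?a i \<bullet> (N *\<^sub>v ?a k))\<^sup>2))"
      by (auto simp: sum_distrib_left intro!: sum.cong)
    then show ?thesis by (subst (asm) sum.swap) (simp add: sum_distrib_left)
  qed
  also have "\<dots> = (\<Sum>i<n. u' i * quad_form N (?a i))"
    by (intro sum.cong refl) (simp add: quadN)
  finally have T: "T = (\<Sum>i<n. u i * quad_form N' (?a i)) + (\<Sum>i<n. u' i * quad_form N (?a i)) - 2 * d"
    using trace_gram_inverse[OF A inv] by simp
  have q0: "0 \<le> quad_form N y" "0 \<le> quad_form N' y"
    unfolding quadN[OF y] quadN'[OF y] by (auto intro!: sum_nonneg mult_nonneg_nonneg u u')
  have "(quad_form N y - quad_form N' y)\<^sup>2 = (z y \<bullet> y)\<^sup>2"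
    using y zprod[OF y y] comm[of "z y" y] by (simp add: quad_form_def)
  also have "\<dots> \<le> (\<Sum>i<n. u i * (?a i \<bullet> z y)\<^sup>2) * quad_form N y"
    by (rule gram_inverse_Cauchy_Schwarz[OF A u inv]) (use y in auto)
  also have "\<dots> \<le> (\<Sum>i<n. u i * ((\<Sum>k<n. u' k * (?a k \<bullet> z (?a i))\<^sup>2) * quad_form N' y)) * quad_form N y"
  proof (intro mult_right_mono sum_mono mult_left_mono)
    fix i assume "i \<in> {..<n}"
    then have i: "i < n" by simp
    \<comment> \<open>Symmetry of \<open>N - N'\<close> moves the difference from \<open>y\<close>
      to the row, which prepares the second Cauchy-Schwarz, now in \<open>gram A u'\<close>.\<close>
    have "?a i \<bullet> z y = z (?a i) \<bullet> y"
      using i y swap[of "?a i" y] zprod[of y "?a i"] comm[of "N *\<^sub>v ?a i" y] comm[of "N' *\<^sub>v ?a i" y] comm[of "z (?a i)" y]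
      by (simp add: zprod)
    moreover have "(z (?a i) \<bullet> y)\<^sup>2 \<le> (\<Sum>k<n. u' k * (?a k \<bullet> z (?a i))\<^sup>2) * quad_form N' y"
      using i y by (intro gram_inverse_Cauchy_Schwarz[OF A u' inv']) auto
    ultimately show "(?a i \<bullet> z y)\<^sup>2 \<le> (\<Sum>k<n. u' k * (?a k \<bullet> z (?a i))\<^sup>2) * quad_form N' y" by simp
    show "0 \<le> u i" using u i .
  qed (rule q0)
  also have "\<dots> = T * quad_form N y * quad_form N' y"
    by (simp add: T_def sum_distrib_left sum_distrib_right mult_ac)
  finally show ?thesis unfolding T .
qed

text \<open>Young's inequality, summed. It serves weight vectors of total at most \<open>d\<close>:
  once for the traces between two solutions, once for the trace against a feasible form in the
  determinant problem.\<close>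

lemma Hoelder_powr:
  fixes v w :: "'b \<Rightarrow> real"
  assumes "\<And>i. i \<in> I \<Longrightarrow> 0 \<le> v i" "\<And>i. i \<in> I \<Longrightarrow> 0 \<le> w i"
    and "sum v I \<le> c" "sum w I \<le> c" "0 \<le> s" "s \<le> 1"
  shows "(\<Sum>i\<in>I. v i powr s * w i powr (1 - s)) \<le> c"
proof -
  have "(\<Sum>i\<in>I. v i powr s * w i powr (1 - s)) \<le> (\<Sum>i\<in>I. s * v i + (1 - s) * w i)"
    using assms by (intro sum_mono Young_powr) auto
  also have "\<dots> = s * sum v I + (1 - s) * sum w I" by (simp add: sum.distrib sum_distrib_left)
  also have "\<dots> \<le> s * c + (1 - s) * c" using assms by (intro add_mono mult_left_mono) auto
  finally show ?thesis by (simp add: algebra_simps)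
qed

text \<open>The Lewis equation relaxed to an upper bound with slack \<open>\<delta>\<close>. The
  trace identity then yields only that the total is at least \<open>d / (1 + \<delta>)\<close>, so
  the total is fixed explicitly.\<close>

definition one_sided :: "real mat \<Rightarrow> real \<Rightarrow> real \<Rightarrow> (nat \<Rightarrow> real) \<Rightarrow> real mat \<Rightarrow> bool" where
  "one_sided A p \<delta> w N \<longleftrightarrow>
     inverse_mats (dim_col A) (gram A (\<lambda>i. w i powr (1 - 2 / p))) N \<and>
     (\<forall>i<dim_row A. 0 \<le> w i \<and> quad_form N (row A i) \<le> (1 + \<delta>) * w i powr (2 / p)) \<and>
     (\<Sum>i<dim_row A. w i) = dim_col A"

text \<open>The slack bound replaces each score by a power of \<open>w i\<close> whose exponent
  \<open>2 / p\<close> is complementary to the exponent \<open>1 - 2 / p\<close> of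
  \<open>v i\<close>; Hoelder's inequality does the rest.\<close>

lemma one_sided_trace:
  assumes A: "A \<in> carrier_mat n d" and p: "2 \<le> p" and \<delta>: "0 \<le> \<delta>"
    and w: "one_sided A p \<delta> w N" and v: "\<And>i. i < n \<Longrightarrow> 0 \<le> v i" "(\<Sum>i<n. v i) \<le> d"
  shows "(\<Sum>i<n. v i powr (1 - 2 / p) * quad_form N (row A i)) \<le> (1 + \<delta>) * d"
proof -
  have dims: "dim_row A = n" "dim_col A = d" using A by auto
  have "(\<Sum>i<n. v i powr (1 - 2 / p) * quad_form N (row A i))
      \<le> (\<Sum>i<n. v i powr (1 - 2 / p) * ((1 + \<delta>) * w i powr (1 - (1 - 2 / p))))"
    using w by (intro sum_mono mult_left_mono) (auto simp: one_sided_def dims)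
  also have "\<dots> = (1 + \<delta>) * (\<Sum>i<n. v i powr (1 - 2 / p) * w i powr (1 - (1 - 2 / p)))"
    by (simp add: sum_distrib_left mult_ac)
  also have "\<dots> \<le> (1 + \<delta>) * d"
    using w v p \<delta> by (intro mult_left_mono Hoelder_powr) (auto simp: one_sided_def dims)
  finally show ?thesis .
qed

text \<open>The two cross traces exceed \<open>d\<close> by at most \<open>\<delta>' * d\<close> and
  \<open>\<delta> * d\<close>, so the factor in \<open>gram_inverse_compare\<close> is at most the
  total slack times \<open>d\<close>.\<close>

lemma one_sided_compare:
  assumes A: "A \<in> carrier_mat n d" and p: "2 \<le> p" and \<delta>: "0 \<le> \<delta>" "0 \<le> \<delta>'"
    and w: "one_sided A p \<delta> w N" and w': "one_sided A p \<delta>' w' N'" and y: "y \<in> carrier_vec d"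
  shows "(quad_form N y - quad_form N' y)\<^sup>2 \<le> (\<delta> + \<delta>') * d * quad_form N y * quad_form N' y"
    and "0 \<le> quad_form N y"
proof -
  have dims: "dim_row A = n" "dim_col A = d" using A by auto
  define u where "u = (\<lambda>i. w i powr (1 - 2 / p))"
  define u' where "u' = (\<lambda>i. w' i powr (1 - 2 / p))"
  have inv: "inverse_mats d (gram A u) N" "inverse_mats d (gram A u') N'"
    using w w' by (auto simp: one_sided_def dims u_def u'_def)
  have u: "0 \<le> u i" "0 \<le> u' i" for i by (auto simp: u_def u'_def)
  have q: "0 \<le> quad_form M y" if "inverse_mats d (gram A v) M" "\<And>i. 0 \<le> v i" for M v
  proof -
    have "M *\<^sub>v y \<in> carrier_vec d" using that y by (auto simp: inverse_mats_def)
    then show ?thesis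
      using inverse_mats_quad_form[OF that(1) y] gram_quad_form[OF A, of "M *\<^sub>v y" v] that(2)
      by (auto intro!: sum_nonneg)
  qed
  show "0 \<le> quad_form N y" by (rule q[OF inv(1) u(1)])
  have "(quad_form N y - quad_form N' y)\<^sup>2
    \<le> ((\<Sum>i<n. u i * quad_form N' (row A i)) + (\<Sum>i<n. u' i * quad_form N (row A i)) - 2 * d)
       * quad_form N y * quad_form N' y"
    using u by (intro gram_inverse_compare[OF A _ _ inv y]) auto
  also have "\<dots> \<le> ((1 + \<delta>') * d + (1 + \<delta>) * d - 2 * d) * quad_form N y * quad_form N' y"
    unfolding u_def u'_def
    using w w' q[OF inv(1) u(1)] q[OF inv(2) u(2)]
    by (intro mult_right_mono diff_right_mono add_mono one_sided_trace[OF A p \<delta>(1) w] one_sided_trace[OF A p \<delta>(2) w'])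
      (auto simp: one_sided_def dims)
  also have "(1 + \<delta>') * d + (1 + \<delta>) * d - 2 * d = (\<delta> + \<delta>') * d" by (simp add: algebra_simps)
  finally show "(quad_form N y - quad_form N' y)\<^sup>2 \<le> (\<delta> + \<delta>') * d * quad_form N y * quad_form N' y" .
qed

section \<open>The fixed-point iteration\<close>

text \<open>Positivity is asked only at nonzero rows: a zero row gets weight zero from the first
  update on, and it contributes nothing to the Gram matrix.\<close>

lemma gram_pos_def:
  assumes A: "A \<in> carrier_mat n d"
    and inj: "\<And>v. v \<in> carrier_vec d \<Longrightarrow> A *\<^sub>v v = 0\<^sub>v n \<Longrightarrow> v = 0\<^sub>v d"
    and u: "\<And>i. i < n \<Longrightarrow> 0 \<le> u i" "\<And>i. i < n \<Longrightarrow> row A i \<noteq> 0\<^sub>v d \<Longrightarrow> 0 < u i"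
  shows "pos_def d (gram A u)"
  unfolding pos_def_def
proof (intro conjI ballI impI)
  show "gram A u \<in> carrier_mat d d" "transpose_mat (gram A u) = gram A u"
    using gram_carrier[OF A] gram_symmetric[OF A] by auto
  fix x :: "real vec" assume x: "x \<in> carrier_vec d" "x \<noteq> 0\<^sub>v d"
  have "A *\<^sub>v x \<noteq> 0\<^sub>v n" using inj[OF x(1)] x(2) by blast
  then obtain i where i: "i < n" "row A i \<bullet> x \<noteq> 0"
    using A by (auto simp: vec_eq_iff)
  then have "row A i \<noteq> 0\<^sub>v d" using x(1) by auto
  with u i have "0 < u i * (row A i \<bullet> x)\<^sup>2" by simp
  also have "\<dots> \<le> (\<Sum>i<n. u i * (row A i \<bullet> x)\<^sup>2)"
    using i u(1) by (intro member_le_sum) auto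
  finally show "0 < quad_form (gram A u) x" by (simp add: gram_quad_form[OF A x(1)])
qed

text \<open>A total function, so that \<open>lewis_iter\<close> can be defined by primitive
  recursion before invertibility is known.\<close>

definition gram_inv :: "real mat \<Rightarrow> real \<Rightarrow> (nat \<Rightarrow> real) \<Rightarrow> real mat" where
  "gram_inv A p w = (SOME N. inverse_mats (dim_col A) (gram A (\<lambda>i. w i powr (1 - 2 / p))) N)"

primrec lewis_iter :: "real mat \<Rightarrow> real \<Rightarrow> nat \<Rightarrow> nat \<Rightarrow> real" where
  "lewis_iter A p 0 i = real (dim_col A) / real (dim_row A)"
| "lewis_iter A p (Suc k) i =
     lewis_iter A p k i powr (1 - 2 / p) * quad_form (gram_inv A p (lewis_iter A p k)) (row A i)"

definition lewis_avg :: "real mat \<Rightarrow> real \<Rightarrow> nat \<Rightarrow> nat \<Rightarrow> real" where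
  "lewis_avg A p T i = (\<Sum>k<T. lewis_iter A p k i) / real T"

definition row_weights :: "real mat \<Rightarrow> (nat \<Rightarrow> real) \<Rightarrow> bool" where
  "row_weights A w \<longleftrightarrow> (\<forall>i<dim_row A. 0 \<le> w i \<and> (row A i \<noteq> 0\<^sub>v (dim_col A) \<longrightarrow> 0 < w i)) \<and>
     (\<Sum>i<dim_row A. w i) = dim_col A"

locale full_rank_matrix =
  fixes A :: "real mat" and n d :: nat and p :: real
  assumes A: "A \<in> carrier_mat n d" and d: "0 < d" and p: "2 \<le> p"
    and rank: "vec_space.rank n A = d"
begin

abbreviation "s \<equiv> 1 - 2 / p"

lemma s: "0 \<le> s" "s < 1" using p by auto

lemma dims [simp]: "dim_row A = n" "dim_col A = d" using A by auto

lemma row_carrier [simp]: "i < n \<Longrightarrow> row A i \<in> carrier_vec d" using A by auto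

lemma d_le_n: "d \<le> n" using vec_space.full_rank_le[OF A rank] .

lemma n: "0 < n" using d d_le_n by simp

lemma inj: "v \<in> carrier_vec d \<Longrightarrow> A *\<^sub>v v = 0\<^sub>v n \<Longrightarrow> v = 0\<^sub>v d"
  using vec_space.full_rank_inj[OF A rank] .

lemma gram_inv:
  assumes "row_weights A w"
  shows "pos_def d (gram A (\<lambda>i. w i powr s))"
    and "inverse_mats d (gram A (\<lambda>i. w i powr s)) (gram_inv A p w)"
    and "pos_def d (gram_inv A p w)"
proof -
  show pd: "pos_def d (gram A (\<lambda>i. w i powr s))"
    using assms by (intro gram_pos_def[OF A inj]) (auto simp: row_weights_def)
  show inv: "inverse_mats d (gram A (\<lambda>i. w i powr s)) (gram_inv A p w)"
    unfolding gram_inv_def dims using pos_def_inverse_exists[OF pd] by (rule someI_ex)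
  show "pos_def d (gram_inv A p w)" by (rule pos_def_inverse[OF pd inv])
qed

lemma lewis_iter_row_weights: "row_weights A (lewis_iter A p k)"
proof (induction k)
  case 0
  then show ?case using d n by (simp add: row_weights_def)
next
  case (Suc k)
  note inv = gram_inv[OF Suc]
  have "0 \<le> quad_form (gram_inv A p (lewis_iter A p k)) (row A i)" if "i < n" for i
    using pos_def_psd[OF inv(3)] that by (simp add: psd_def)
  moreover have "0 < quad_form (gram_inv A p (lewis_iter A p k)) (row A i)"
    if "i < n" "row A i \<noteq> 0\<^sub>v d" for i
    using inv(3) that by (simp add: pos_def_def)
  moreover have "0 < lewis_iter A p k i powr s" if "i < n" "row A i \<noteq> 0\<^sub>v d" for i
  proof -
    have "0 < lewis_iter A p k i" using Suc that by (simp add: row_weights_def)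
    then show ?thesis by simp
  qed
  ultimately show ?case
    using trace_gram_inverse[OF A inv(2)] by (auto simp: row_weights_def)
qed

lemma lewis_avg_row_weights:
  assumes "0 < T"
  shows "row_weights A (lewis_avg A p T)"
proof -
  have "(\<Sum>i<n. lewis_avg A p T i) = (\<Sum>k<T. \<Sum>i<n. lewis_iter A p k i) / real T"
    unfolding lewis_avg_def sum_divide_distrib[symmetric] by (subst sum.swap) simp
  moreover have "0 < lewis_avg A p T i" if "i < n" "row A i \<noteq> 0\<^sub>v d" for i
    unfolding lewis_avg_def using assms that lewis_iter_row_weights
    by (intro divide_pos_pos sum_pos) (auto simp: row_weights_def)
  ultimately show ?thesis using lewis_iter_row_weights assms
    by (auto simp: row_weights_def lewis_avg_def intro!: sum_nonneg divide_nonneg_nonneg)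
qed

text \<open>Each row's \<open>1 / quad_form\<close> is concave in the weights by Cauchy--Schwarz, and the iterates
  telescope: \<open>ln (quad_form) = ln w\<^sub>k\<^sub>+\<^sub>1 - s ln w\<^sub>k\<close>.\<close>

lemma lewis_avg_one_sided:
  assumes T: "0 < T" and \<delta>: "0 < \<delta>" and nT: "real n \<le> (1 + \<delta>) ^ T"
  shows "one_sided A p \<delta> (lewis_avg A p T) (gram_inv A p (lewis_avg A p T))"
proof -
  define W where "W = lewis_iter A p"
  define v where "v = lewis_avg A p T"
  define N where "N = gram_inv A p v"
  have W: "row_weights A (W k)" for k unfolding W_def by (rule lewis_iter_row_weights)
  have v: "row_weights A v" unfolding v_def by (rule lewis_avg_row_weights[OF T])
  have inv: "pos_def d (gram A (\<lambda>i. v i powr s))" "inverse_mats d (gram A (\<lambda>i. v i powr s)) N" "pos_def d N"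
    unfolding N_def using gram_inv[OF v] by auto
  have vW: "v i = (\<Sum>k<T. W k i) / real T" for i by (simp add: v_def W_def lewis_avg_def)
  \<comment> \<open>Jensen's inequality for the power \<open>s\<close>: Young's inequality pairs
    each iterate with the average, and \<open>v j powr (1 - s)\<close> is cancelled. If
    \<open>v j = 0\<close>, all iterates vanish there and both sides are zero.\<close>
  have concave: "(\<Sum>k<T. W k j powr s) \<le> T * v j powr s" if j: "j < n" for j
  proof (cases "row A j = 0\<^sub>v d \<and> v j = 0")
    case True
    then have "W k j = 0" if "k < T" for k
      using W j T sum_nonneg_eq_0_iff[of "{..<T}" "\<lambda>k. W k j"] that by (auto simp: row_weights_def vW)
    then show ?thesis by simp
  next
    case False
    then have vj: "0 < v j" using v j by (auto simp: row_weights_def order_le_less)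
    have "(\<Sum>k<T. W k j powr s) * v j powr (1 - s) = (\<Sum>k<T. W k j powr s * v j powr (1 - s))"
      by (simp add: sum_distrib_right)
    also have "\<dots> \<le> (\<Sum>k<T. s * W k j + (1 - s) * v j)"
      using W j vj s by (intro sum_mono Young_powr) (auto simp: row_weights_def)
    also have "\<dots> = s * (T * v j) + (1 - s) * (T * v j)"
      using T by (simp add: sum.distrib sum_distrib_left[symmetric] vW)
    also have "\<dots> = T * (v j powr s * v j powr (1 - s))"
      using vj by (simp add: powr_add[symmetric] algebra_simps)
    finally have "(\<Sum>k<T. W k j powr s) * v j powr (1 - s) \<le> (T * v j powr s) * v j powr (1 - s)"
      by (simp add: mult_ac)
    then show ?thesis using vj by (simp add: mult_le_cancel_right)
  qed
  have "quad_form N (row A i) \<le> (1 + \<delta>) * v i powr (2 / p)" if i: "i < n" for i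
  proof (cases "row A i = 0\<^sub>v d")
    case True
    then show ?thesis using inv \<delta> by (simp add: pos_def_def)
  next
    case False
    let ?a = "row A i"
    have Wi: "0 < W k i" for k using W i False by (simp add: row_weights_def)
    have vi: "0 < v i" using v i False by (simp add: row_weights_def)
    define x where "x = quad_form N ?a"
    have x: "0 < x" using inv(3) i False by (simp add: pos_def_def x_def)
    \<comment> \<open>The minimiser of the averaged Gram form on the hyperplane
      \<open>y \<bullet> ?a = 1\<close>, with minimum \<open>1 / x\<close>. It is also a competitor
      on that hyperplane for the Gram matrix of every single iterate.\<close>
    define y where "y = (1 / x) \<cdot>\<^sub>v (N *\<^sub>v ?a)"
    have Na: "N *\<^sub>v ?a \<in> carrier_vec d" using inv i by (auto simp: pos_def_def)
    have y: "y \<in> carrier_vec d" using Na by (simp add: y_def)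
    have ya: "y \<bullet> ?a = 1"
      using x i Na comm_scalar_prod[of "N *\<^sub>v ?a" d ?a] by (simp add: y_def x_def quad_form_def)
    \<comment> \<open>The claim reads \<open>R \<le> 1 / x\<close>; \<open>R\<close> is also the
      point at which the tangent inequality below is taken.\<close>
    define R where "R = 1 / ((1 + \<delta>) * v i powr (2 / p))"
    have R: "0 < R" using \<delta> vi by (simp add: R_def)
    have lnR: "ln R = - ln (1 + \<delta>) - (1 - s) * ln (v i)"
      using \<delta> vi by (simp add: R_def ln_div ln_mult ln_powr)
    \<comment> \<open>The inequality \<open>ln t \<le> t - 1\<close> at
      \<open>t = 1 / (?xk * R)\<close> bounds \<open>1 / ?xk\<close> below by an expression linear
      in \<open>ln ?xk\<close>, which can be summed over the rounds and telescoped.\<close>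
    have step: "R * (1 + s * ln (W k i) - ln (W (Suc k) i) - ln R) \<le> (\<Sum>j<n. W k j powr s * (row A j \<bullet> y)\<^sup>2)" for k
    proof -
      let ?xk = "quad_form (gram_inv A p (W k)) ?a"
      have xk: "0 < ?xk" using gram_inv(3)[OF W] i False by (simp add: pos_def_def)
      have Suc: "W (Suc k) i = W k i powr s * ?xk" by (simp add: W_def)
      have "ln (1 / ?xk / R) \<le> 1 / ?xk / R - 1" using xk R by (intro ln_le_minus_one) simp
      moreover have "ln (1 / ?xk / R) = - ln ?xk - ln R" using xk R by (simp add: ln_div ln_mult)
      ultimately have "1 - ln ?xk - ln R \<le> 1 / ?xk / R" by simp
      from this[unfolded pos_le_divide_eq[OF R]] have "R * (1 - ln ?xk - ln R) \<le> 1 / ?xk"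
        by (simp only: mult.commute)
      moreover have "ln ?xk = ln (W (Suc k) i) - s * ln (W k i)"
        using xk Wi[of k] by (simp add: Suc ln_mult ln_powr)
      ultimately have "R * (1 + s * ln (W k i) - ln (W (Suc k) i) - ln R) \<le> 1 / ?xk" by (simp add: algebra_simps)
      moreover
      have "1 \<le> (\<Sum>j<n. W k j powr s * (row A j \<bullet> y)\<^sup>2) * ?xk"
        using gram_inverse_Cauchy_Schwarz[OF A _ gram_inv(2)[OF W] row_carrier[OF i] y] ya by simp
      then have "1 / ?xk \<le> (\<Sum>j<n. W k j powr s * (row A j \<bullet> y)\<^sup>2)"
        by (simp only: pos_divide_le_eq[OF xk])
      ultimately show ?thesis by (blast intro: order_trans)
    qed
    have sumW: "(\<Sum>k<T. W k i) = T * v i" using T by (simp add: vW)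
    have lnv: "(\<Sum>k<T. ln (W k i)) \<le> T * ln (v i)"
    proof -
      have "(\<Sum>k<T. ln (W k i) - ln (v i)) \<le> (\<Sum>k<T. W k i / v i - 1)"
      proof (intro sum_mono)
        show "ln (W k i) - ln (v i) \<le> W k i / v i - 1" for k
          using ln_le_minus_one[of "W k i / v i"] Wi[of k] vi by (simp add: ln_div)
      qed
      also have "\<dots> = 0"
        using vi sumW by (simp add: sum_subtractf sum_divide_distrib[symmetric])
      finally show ?thesis by (simp add: sum_subtractf)
    qed
    have tele: "(\<Sum>k<T. ln (W (Suc k) i)) = (\<Sum>k<T. ln (W k i)) + ln (W T i) - ln (W 0 i)"
      using sum_lessThan_telescope[of "\<lambda>k. ln (W k i)" T] by (simp add: sum_subtractf)
    \<comment> \<open>The only place where \<open>n\<close> enters: an iterate is at most its total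
      \<open>d\<close> and starts at \<open>d / n\<close>, so it grows by a factor of at most
      \<open>n\<close> in all.\<close>
    have growth: "ln (W T i) - ln (W 0 i) \<le> T * ln (1 + \<delta>)"
    proof -
      have "W T i \<le> (\<Sum>j<n. W T j)" using W i by (intro member_le_sum) (auto simp: row_weights_def)
      also have "\<dots> = d" using W by (simp add: row_weights_def)
      finally have "W T i / W 0 i \<le> n" using d n by (simp add: W_def field_simps)
      also have "\<dots> \<le> (1 + \<delta>) ^ T" by (rule nT)
      finally have "ln (W T i / W 0 i) \<le> ln ((1 + \<delta>) ^ T)" using Wi \<delta> by simp
      then show ?thesis using Wi[of T] Wi[of 0] \<delta> by (simp add: ln_div ln_realpow)
    qed
    \<comment> \<open>The term \<open>- ln (1 + \<delta>)\<close> in \<open>ln R\<close> pays for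
      the telescoped growth, the term in \<open>ln (v i)\<close> for the rest, by Jensen's
      inequality \<open>lnv\<close>.\<close>
    have "s * (\<Sum>k<T. ln (W k i)) - (\<Sum>k<T. ln (W (Suc k) i)) - T * ln R
        = T * (ln (1 + \<delta>) + (1 - s) * ln (v i)) - (ln (W T i) - ln (W 0 i)) - (1 - s) * (\<Sum>k<T. ln (W k i))"
      unfolding tele lnR by (simp add: algebra_simps)
    also have "\<dots> \<ge> 0"
      using growth mult_left_mono[OF lnv, of "1 - s"] s by (simp add: algebra_simps)
    finally have "R * T \<le> R * (T + s * (\<Sum>k<T. ln (W k i)) - (\<Sum>k<T. ln (W (Suc k) i)) - T * ln R)"
      using R by simp
    also have "\<dots> = (\<Sum>k<T. R * (1 + s * ln (W k i) - ln (W (Suc k) i) - ln R))"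
      by (simp add: sum_distrib_left[symmetric] sum.distrib sum_subtractf)
    also have "\<dots> \<le> (\<Sum>k<T. \<Sum>j<n. W k j powr s * (row A j \<bullet> y)\<^sup>2)" by (intro sum_mono step)
    also have "\<dots> = (\<Sum>j<n. (\<Sum>k<T. W k j powr s) * (row A j \<bullet> y)\<^sup>2)"
      by (subst sum.swap) (simp add: sum_distrib_right)
    also have "\<dots> \<le> (\<Sum>j<n. (T * v j powr s) * (row A j \<bullet> y)\<^sup>2)"
      by (intro sum_mono mult_right_mono concave) auto
    also have "\<dots> = T * quad_form (gram A (\<lambda>i. v i powr s)) y"
      by (simp add: gram_quad_form[OF A y] sum_distrib_left mult_ac)
    also have "quad_form (gram A (\<lambda>i. v i powr s)) y = 1 / x"
    proof -
      have "gram A (\<lambda>i. v i powr s) *\<^sub>v y = (1 / x) \<cdot>\<^sub>v ?a"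
        using Na gram_carrier[OF A] inverse_mats_vec(1)[OF inv(2), of ?a] i
        by (simp add: y_def mult_mat_vec[of _ d d])
      then show ?thesis using ya y i by (simp add: quad_form_def)
    qed
    finally have "T * R \<le> T * (1 / x)" by (simp only: mult.commute)
    then have "R \<le> 1 / x" using T by (simp only: mult_le_cancel_left_pos of_nat_0_less_iff)
    then have "x \<le> (1 + \<delta>) * v i powr (2 / p)"
      using inverse_le_imp_le[of "(1 + \<delta>) * v i powr (2 / p)" x] \<delta> vi by (simp add: R_def inverse_eq_divide)
    then show ?thesis by (simp add: x_def)
  qed
  then show ?thesis
    using v inv(2) unfolding one_sided_def v_def N_def by (simp add: row_weights_def)
qed

end

section \<open>Determinant and trace\<close>

lemma trace_similar:
  fixes X :: "complex mat"
  assumes X: "X \<in> carrier_mat d d" and Y: "Y \<in> carrier_mat d d"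
  shows "(\<Sum>j<d. (X * Y) $$ (j, j)) = (\<Sum>j<d. (Y * X) $$ (j, j))"
proof -
  have "(\<Sum>j<d. (X * Y) $$ (j, j)) = (\<Sum>j<d. \<Sum>k<d. X $$ (j, k) * Y $$ (k, j))"
    using X Y by (auto simp: scalar_prod_def atLeast0LessThan intro!: sum.cong)
  also have "\<dots> = (\<Sum>k<d. \<Sum>j<d. Y $$ (k, j) * X $$ (j, k))"
    by (subst sum.swap) (simp add: mult.commute)
  also have "\<dots> = (\<Sum>j<d. (Y * X) $$ (j, j))"
    using X Y by (auto simp: scalar_prod_def atLeast0LessThan intro!: sum.cong)
  finally show ?thesis .
qed

text \<open>The mixed products of real and imaginary parts cancel by symmetry. Positivity of a real
  form thus extends to complex eigenvectors.\<close>

lemma hermitian_form_real_symmetric: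
  fixes S :: "real mat" and v :: "nat \<Rightarrow> complex"
  assumes S: "S \<in> carrier_mat d d" and sym: "transpose_mat S = S"
  shows "(\<Sum>j<d. \<Sum>k<d. complex_of_real (S $$ (j, k)) * cnj (v j) * v k)
    = complex_of_real (quad_form S (vec d (\<lambda>j. Re (v j))) + quad_form S (vec d (\<lambda>j. Im (v j))))" (is "?l = ?r")
proof (rule complex_eqI)
  have "Re ?l = (\<Sum>j<d. \<Sum>k<d. S $$ (j, k) * Re (v j) * Re (v k) + S $$ (j, k) * Im (v j) * Im (v k))"
    by (simp add: algebra_simps)
  also have "\<dots> = Re ?r"
    by (simp add: quad_form_def smult_mult_scalar_prod[OF S] sum.distrib)
  finally show "Re ?l = Re ?r" .
  have "Im ?l = (\<Sum>j<d. \<Sum>k<d. S $$ (j, k) * Re (v j) * Im (v k)) - (\<Sum>j<d. \<Sum>k<d. S $$ (j, k) * Im (v j) * Re (v k))"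
    by (simp add: algebra_simps sum_subtractf)
  also have "(\<Sum>j<d. \<Sum>k<d. S $$ (j, k) * Im (v j) * Re (v k)) = (\<Sum>j<d. \<Sum>k<d. S $$ (j, k) * Re (v j) * Im (v k))"
  proof (subst sum.swap, intro sum.cong refl)
    fix j k assume "j \<in> {..<d}" "k \<in> {..<d}"
    then have "S $$ (k, j) = S $$ (j, k)" using S sym by (metis index_transpose_mat(1) carrier_matD lessThan_iff)
    then show "S $$ (k, j) * Im (v k) * Re (v j) = S $$ (j, k) * Re (v j) * Im (v k)" by simp
  qed
  finally show "Im ?l = Im ?r" by simp
qed

text \<open>The product \<open>P * M\<close> need not be symmetric, so its eigenvectors are treated
  as solutions of \<open>M v = a N v\<close> with \<open>N\<close> inverse to \<open>P\<close>.
  Pairing with the conjugate of \<open>v\<close> gives \<open>m = a * l\<close> with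
  \<open>m\<close> nonnegative and \<open>l\<close> positive.\<close>

lemma eigenvalue_pos_def_mult_psd:
  assumes P: "pos_def d P" and M: "psd d M"
    and ev: "eigenvalue (map_mat complex_of_real (P * M)) a"
  shows "a \<in> \<real>" "0 \<le> Re a"
proof -
  have c: "P \<in> carrier_mat d d" "M \<in> carrier_mat d d" "transpose_mat M = M"
    using P M by (auto simp: pos_def_def psd_def)
  obtain N where inv: "inverse_mats d P N" using pos_def_inverse_exists[OF P] by blast
  have pN: "pos_def d N" by (rule pos_def_inverse[OF P inv])
  have N: "N \<in> carrier_mat d d" "transpose_mat N = N" "N * P = 1\<^sub>m d" using inv pN by (auto simp: inverse_mats_def pos_def_def)
  let ?c = "map_mat complex_of_real"
  obtain v where v: "v \<in> carrier_vec d" "v \<noteq> 0\<^sub>v d" "?c (P * M) *\<^sub>v v = a \<cdot>\<^sub>v v"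
    using ev c by (auto simp: eigenvalue_def eigenvector_def)
  have "?c (N * (P * M)) = ?c N * ?c (P * M)"
    by (rule of_real_hom.mat_hom_mult[of N d d "P * M" d]) (use c N in auto)
  then have "?c N * ?c (P * M) = ?c M" using c N assoc_mult_mat[of N d d P d M d] by simp
  then have Mv: "?c M *\<^sub>v v = a \<cdot>\<^sub>v (?c N *\<^sub>v v)"
    using assoc_mult_mat_vec[of "?c N" d d "?c (P * M)" d v] c N v by (simp add: mult_mat_vec)
  have "(\<Sum>k<d. complex_of_real (M $$ (j, k)) * v $ k) = a * (\<Sum>k<d. complex_of_real (N $$ (j, k)) * v $ k)" if "j < d" for j
  proof -
    have "(?c M *\<^sub>v v) $ j = (a \<cdot>\<^sub>v (?c N *\<^sub>v v)) $ j" by (simp add: Mv)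
    then show ?thesis using that c N v by (simp add: scalar_prod_def atLeast0LessThan)
  qed
  then have "(\<Sum>j<d. cnj (v $ j) * (\<Sum>k<d. complex_of_real (M $$ (j, k)) * v $ k))
      = a * (\<Sum>j<d. cnj (v $ j) * (\<Sum>k<d. complex_of_real (N $$ (j, k)) * v $ k))"
    by (auto simp: sum_distrib_left[of a] mult_ac intro!: sum.cong)
  then have eq: "(\<Sum>j<d. \<Sum>k<d. complex_of_real (M $$ (j, k)) * cnj (v $ j) * v $ k)
      = a * (\<Sum>j<d. \<Sum>k<d. complex_of_real (N $$ (j, k)) * cnj (v $ j) * v $ k)"
    by (simp add: sum_distrib_left mult_ac)
  let ?x = "vec d (\<lambda>j. Re (v $ j))" and ?y = "vec d (\<lambda>j. Im (v $ j))"
  define m where "m = quad_form M ?x + quad_form M ?y"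
  define l where "l = quad_form N ?x + quad_form N ?y"
  have eq: "complex_of_real m = a * complex_of_real l"
    using eq unfolding hermitian_form_real_symmetric[OF c(2,3)] hermitian_form_real_symmetric[OF N(1,2)] m_def l_def .
  have m: "0 \<le> m" using M by (simp add: m_def psd_def)
  have "?x \<noteq> 0\<^sub>v d \<or> ?y \<noteq> 0\<^sub>v d"
    using v(1,2) by (auto simp: vec_eq_iff complex_eq_iff)
  moreover have "0 \<le> quad_form N ?x" "0 \<le> quad_form N ?y" using pos_def_psd[OF pN] by (auto simp: psd_def)
  ultimately have "0 < l" using pN unfolding l_def pos_def_def
    by (metis add_nonneg_pos add_pos_nonneg vec_carrier)
  then have "a = complex_of_real (m / l)" using eq by (simp add: field_simps)
  then show "a \<in> \<real>" "0 \<le> Re a" using m \<open>0 < l\<close> by auto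
qed

text \<open>The bound \<open>e \<le> exp (e - 1)\<close> for each factor multiplies up. It replaces
  AM-GM: a list whose sum is at most its length has product at most 1.\<close>

lemma prod_list_le_exp:
  fixes es :: "real list"
  assumes "\<And>e. e \<in> set es \<Longrightarrow> 0 \<le> e"
  shows "0 \<le> prod_list es \<and> prod_list es \<le> exp (sum_list es - length es)"
  using assms
proof (induction es)
  case (Cons e es)
  then have "0 \<le> prod_list es" "prod_list es \<le> exp (sum_list es - length es)" "0 \<le> e" by auto
  moreover have "e \<le> exp (e - 1)" using exp_ge_add_one_self[of "e - 1"] by simp
  ultimately have "e * prod_list es \<le> exp (e - 1) * exp (sum_list es - length es)" by (intro mult_mono) auto
  then show ?case using \<open>0 \<le> e\<close> \<open>0 \<le> prod_list es\<close> by (simp add: exp_add[symmetric] algebra_simps)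
qed simp

text \<open>A complex Schur decomposition turns determinant and trace into product and sum of the
  eigenvalues, which are real and nonnegative.\<close>

lemma det_pos_def_mult_psd:
  assumes P: "pos_def d P" and M: "psd d M"
  shows "0 \<le> det (P * M)" "det (P * M) \<le> exp ((\<Sum>j<d. (P * M) $$ (j, j)) - d)"
proof -
  have c: "P \<in> carrier_mat d d" "M \<in> carrier_mat d d" using P M by (auto simp: pos_def_def psd_def)
  define B where "B = map_mat complex_of_real (P * M)"
  have B: "B \<in> carrier_mat d d" using c by (simp add: B_def)
  obtain as where as: "char_poly B = (\<Prod>a\<leftarrow>as. [:- a, 1:])" "length as = d"
    using char_poly_factorized[OF B] by blast
  obtain T X Y where TXY: "schur_decomposition B as = (T, X, Y)" by (cases "schur_decomposition B as")
  have T: "similar_mat_wit B T X Y" "upper_triangular T" "diag_mat T = as"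
    using schur_decomposition[OF B as(1) TXY] by auto
  have car: "T \<in> carrier_mat d d" "X \<in> carrier_mat d d" "Y \<in> carrier_mat d d" "Y * X = 1\<^sub>m d" "B = X * T * Y"
    using T(1) B by (auto simp: similar_mat_wit_def Let_def)
  define es where "es = map Re as"
  have real: "a \<in> \<real>" "0 \<le> Re a" if "a \<in> set as" for a
  proof -
    have "poly (char_poly B) a = 0" using that by (auto simp: as(1) poly_prod_list_zero_iff)
    then have "eigenvalue B a" using eigenvalue_root_char_poly[OF B] by simp
    then show "a \<in> \<real>" "0 \<le> Re a" using eigenvalue_pos_def_mult_psd[OF P M] by (auto simp: B_def)
  qed
  then have as_es: "as = map complex_of_real es" unfolding es_def by (auto simp: map_idI)
  have "complex_of_real (det (P * M)) = det B" unfolding B_def by simp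
  also have "\<dots> = det T" using T(1) by (intro det_similar) (auto simp: similar_mat_def)
  also have "\<dots> = prod_list as" using det_upper_triangular[OF T(2) car(1)] T(3) by simp
  also have "\<dots> = complex_of_real (prod_list es)" unfolding as_es by (induction es) auto
  finally have det: "det (P * M) = prod_list es" by (simp only: of_real_eq_iff)
  have "complex_of_real (\<Sum>j<d. (P * M) $$ (j, j)) = (\<Sum>j<d. B $$ (j, j))" using c by (simp add: B_def)
  also have "\<dots> = (\<Sum>j<d. (X * (T * Y)) $$ (j, j))" using car assoc_mult_mat[of X d d T d Y d] by simp
  also have "\<dots> = (\<Sum>j<d. (T * Y * X) $$ (j, j))" using car by (intro trace_similar) auto
  also have "T * Y * X = T" using car assoc_mult_mat[of T d d Y d X d] by simp
  also have "(\<Sum>j<d. T $$ (j, j)) = sum_list as"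
    using car(1) T(3) by (auto simp: diag_mat_def sum_list_sum_nth atLeast0LessThan)
  also have "\<dots> = complex_of_real (sum_list es)" unfolding as_es by (induction es) auto
  finally have tr: "(\<Sum>j<d. (P * M) $$ (j, j)) = sum_list es" by (simp only: of_real_eq_iff)
  have "length es = d" using as by (simp add: es_def)
  then show "0 \<le> det (P * M)" "det (P * M) \<le> exp ((\<Sum>j<d. (P * M) $$ (j, j)) - d)"
    using prod_list_le_exp[of es] real unfolding det tr es_def by auto
qed

text \<open>An optimality certificate for \<open>Q\<close>: the trace bound forces
  \<open>det (P * M) \<le> 1 = det (P * Q)\<close>.\<close>

lemma det_le_of_trace_le:
  assumes P: "pos_def d P" and inv: "inverse_mats d P Q" and M: "psd d M"
    and tr: "(\<Sum>j<d. (P * M) $$ (j, j)) \<le> d"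
  shows "det M \<le> det Q"
proof -
  have c: "P \<in> carrier_mat d d" "Q \<in> carrier_mat d d" "M \<in> carrier_mat d d" "P * Q = 1\<^sub>m d"
    using inv M by (auto simp: inverse_mats_def psd_def)
  have PQ: "det P * det Q = 1" using det_mult[OF c(1,2)] c(4) by simp
  \<comment> \<open>Multiplying \<open>P\<close> by the identity in
    \<open>det_pos_def_mult_psd\<close> yields the sign of \<open>det P\<close>.\<close>
  have "psd d (1\<^sub>m d)" by (auto simp: psd_def quad_form_def scalar_prod_def intro!: sum_nonneg)
  from det_pos_def_mult_psd(1)[OF P this] have "0 \<le> det P" using c by simp
  then have detP: "0 < det P" using PQ by (cases "det P = 0") auto
  have "det P * det M \<le> exp ((\<Sum>j<d. (P * M) $$ (j, j)) - d)"
    using det_pos_def_mult_psd(2)[OF P M] det_mult[OF c(1,3)] by simp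
  also have "\<dots> \<le> det P * det Q" using tr PQ by simp
  finally show ?thesis using detP by simp
qed

section \<open>Lewis weights and the Lewis form\<close>

text \<open>A crude ratio bound that holds for every \<open>c\<close>; it provides uniform bounds
  before convergence is known.\<close>

lemma le_of_square_diff_le:
  fixes a b c :: real
  assumes "(a - b)\<^sup>2 \<le> c * a * b" "0 \<le> a" "0 \<le> b" "0 \<le> c"
  shows "a \<le> (c + 2) * b"
proof (cases "a = 0")
  case False
  have "a * a + b * b \<le> ((c + 2) * b) * a" using assms(1) by (simp add: power2_eq_square algebra_simps)
  then have "a * a \<le> ((c + 2) * b) * a" using zero_le_square[of b] by linarith
  then show ?thesis using False assms(2) by simp
qed (use assms in simp)

text \<open>Polarisation. It transfers convergence of quadratic forms to convergence of matrix
  entries.\<close>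

lemma symmetric_entry_quad_form:
  assumes M: "M \<in> carrier_mat d d" and sym: "transpose_mat M = M" and jk: "j < d" "k < d"
  shows "M $$ (j, k) = (quad_form M (unit_vec d j + unit_vec d k) - quad_form M (unit_vec d j)
    - quad_form M (unit_vec d k)) / 2"
proof -
  let ?e = "unit_vec d :: nat \<Rightarrow> real vec"
  have prod: "?e a \<bullet> (M *\<^sub>v ?e b) = M $$ (a, b)" if "a < d" "b < d" for a b
    using M that by simp
  have "M $$ (k, j) = M $$ (j, k)" using M sym jk by (metis index_transpose_mat(1) carrier_matD)
  then show ?thesis
    using M jk prod
    by (simp add: quad_form_def mult_add_distrib_mat_vec[of M d d] scalar_prod_add_distrib[of _ d]
        add_scalar_prod_distrib[of _ d] del: scalar_prod_left_unit scalar_prod_right_unit)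
qed

section \<open>Existence and uniqueness of Lewis weights\<close>

context full_rank_matrix
begin

text \<open>Exact Lewis weights are solutions of slack zero, so the comparison lemma applies to them
  as well.\<close>

lemma lewis_weightsD:
  assumes "is_lewis_weights A p w"
  obtains N where "one_sided A p 0 (($) w) N" "\<And>i. i < n \<Longrightarrow> quad_form N (row A i) = (w $ i) powr (2 / p)"
proof -
  obtain N where N: "N \<in> carrier_mat d d" "inverts_mat (gram A (\<lambda>i. (w $ i) powr s)) N"
      "inverts_mat N (gram A (\<lambda>i. (w $ i) powr s))"
      "\<And>i. i < n \<Longrightarrow> quad_form N (row A i) = (w $ i) powr (2 / p)"
    and w: "\<And>i. i < n \<Longrightarrow> 0 \<le> w $ i"
    using assms by (auto simp: is_lewis_weights_def gram_def Let_def)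
  have inv: "inverse_mats d (gram A (\<lambda>i. (w $ i) powr s)) N"
    using N gram_carrier[OF A] by (auto simp: inverse_mats_def inverts_mat_def)
  have "(\<Sum>i<n. w $ i) = (\<Sum>i<n. (w $ i) powr s * quad_form N (row A i))"
    using w by (intro sum.cong refl) (auto simp: N(4) powr_add[symmetric])
  also have "\<dots> = d" by (rule trace_gram_inverse[OF A inv])
  finally have "one_sided A p 0 (($) w) N" using inv w N(4) by (simp add: one_sided_def)
  then show ?thesis using N(4) that by blast
qed

lemma lewis_weights_unique:
  assumes w: "is_lewis_weights A p w" and w': "is_lewis_weights A p w'"
  shows "w = w'"
proof -
  obtain N where N: "one_sided A p 0 (($) w) N" "\<And>i. i < n \<Longrightarrow> quad_form N (row A i) = (w $ i) powr (2 / p)"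
    using lewis_weightsD[OF w] by blast
  obtain N' where N': "one_sided A p 0 (($) w') N'" "\<And>i. i < n \<Longrightarrow> quad_form N' (row A i) = (w' $ i) powr (2 / p)"
    using lewis_weightsD[OF w'] by blast
  have "w $ i = w' $ i" if i: "i < n" for i
  proof -
    have "quad_form N (row A i) = quad_form N' (row A i)"
      using one_sided_compare(1)[OF A p _ _ N(1) N'(1) row_carrier[OF i]] by simp
    then have "((w $ i) powr (2 / p)) powr (p / 2) = ((w' $ i) powr (2 / p)) powr (p / 2)"
      using N(2) N'(2) i by simp
    then show ?thesis using w w' i p by (auto simp: powr_powr is_lewis_weights_def)
  qed
  then show ?thesis using w w' by (intro eq_vecI) (auto simp: is_lewis_weights_def)
qed

lemma one_sided_exists:
  assumes "0 < \<delta>"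
  shows "\<exists>w N. row_weights A w \<and> one_sided A p \<delta> w N"
proof -
  obtain T where T: "real n < (1 + \<delta>) ^ T" using real_arch_pow[of "1 + \<delta>" "real n"] assms by auto
  have "0 < T" using T n by (cases T) auto
  then show ?thesis
    using lewis_avg_one_sided[of T \<delta>] lewis_avg_row_weights[of T] T assms by auto
qed

text \<open>The forms of a sequence of one-sided solutions with slack tending to \<open>0\<close> are Cauchy, by
  \<open>one_sided_compare\<close>; their limit gives the Lewis weights.\<close>

lemma lewis_weights_exist: "\<exists>w. is_lewis_weights A p w"
proof -
  define \<delta> where "\<delta> m = 1 / real (Suc m)" for m
  have \<delta>: "0 < \<delta> m" "\<delta> m \<le> 1" for m by (auto simp: \<delta>_def)
  have \<delta>0: "\<delta> \<longlonglongrightarrow> 0" unfolding \<delta>_def by (rule LIMSEQ_Suc[OF lim_1_over_n])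
  obtain \<omega> N where \<omega>: "\<And>m. row_weights A (\<omega> m)" and N: "\<And>m. one_sided A p (\<delta> m) (\<omega> m) (N m)"
    using one_sided_exists[OF \<delta>(1)] by metis
  have inv: "inverse_mats d (gram A (\<lambda>i. \<omega> m i powr s)) (N m)" for m
    using N[of m] by (simp add: one_sided_def)
  have pd: "pos_def d (N m)" for m
    by (rule pos_def_inverse[OF gram_inv(1)[OF \<omega>] inv])
  then have Nm: "N m \<in> carrier_mat d d" "transpose_mat (N m) = N m" for m by (auto simp: pos_def_def)
  have q0: "0 \<le> quad_form (N m) y" if "y \<in> carrier_vec d" for m y
    using pos_def_psd[OF pd] that by (simp add: psd_def)
  have cmp: "(quad_form (N m) y - quad_form (N l) y)\<^sup>2 \<le> (\<delta> m + \<delta> l) * d * quad_form (N m) y * quad_form (N l) y"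
    if "y \<in> carrier_vec d" for m l y
    using one_sided_compare(1)[OF A p _ _ N N that] \<delta>(1) by (simp add: less_imp_le)
  \<comment> \<open>With slacks at most 1 the factor \<open>(\<delta> m + \<delta> l) * d\<close> is
    at most \<open>2 * d\<close>. All forms of the sequence are thus within a common factor of each
    other, which later keeps the limit positive at nonzero rows.\<close>
  have bound: "quad_form (N m) y \<le> (2 * real d + 2) * quad_form (N l) y" if y: "y \<in> carrier_vec d" for m l y
  proof (rule le_of_square_diff_le)
    have "(\<delta> m + \<delta> l) * d * (quad_form (N m) y * quad_form (N l) y) \<le> 2 * real d * (quad_form (N m) y * quad_form (N l) y)"
      using \<delta>(2)[of m] \<delta>(2)[of l] q0[OF y] by (intro mult_right_mono) auto
    then show "(quad_form (N m) y - quad_form (N l) y)\<^sup>2 \<le> 2 * real d * quad_form (N m) y * quad_form (N l) y"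
      using cmp[OF y, of m l] by (simp add: mult_ac)
  qed (use q0[OF y] in auto)
  have conv: "convergent (\<lambda>m. quad_form (N m) y)" if y: "y \<in> carrier_vec d" for y
  proof (rule Cauchy_convergent, rule CauchyI)
    fix e :: real assume e: "0 < e"
    define B where "B = (2 * real d + 2) * quad_form (N 0) y"
    have "(\<lambda>m. \<delta> m * (2 * real d * (B * B))) \<longlonglongrightarrow> 0 * (2 * real d * (B * B))" by (intro tendsto_mult \<delta>0 tendsto_const)
    then have "\<forall>\<^sub>F m in sequentially. \<delta> m * (2 * real d * (B * B)) < e\<^sup>2"
      using e by (intro order_tendstoD) auto
    then obtain M where M: "\<And>m. m \<ge> M \<Longrightarrow> \<delta> m * (2 * real d * (B * B)) < e\<^sup>2" by (auto simp: eventually_sequentially)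
    show "\<exists>M. \<forall>m\<ge>M. \<forall>l\<ge>M. norm (quad_form (N m) y - quad_form (N l) y) < e"
    proof (intro exI allI impI)
      fix m l assume ml: "M \<le> m" "M \<le> l"
      have mono: "\<delta> m \<le> \<delta> M" "\<delta> l \<le> \<delta> M" using ml by (auto simp: \<delta>_def frac_le)
      have "(quad_form (N m) y - quad_form (N l) y)\<^sup>2 \<le> ((\<delta> m + \<delta> l) * d) * (quad_form (N m) y * quad_form (N l) y)"
        using cmp[OF y, of m l] by (simp add: mult_ac)
      also have "\<dots> \<le> ((\<delta> m + \<delta> l) * d) * (B * B)"
        using bound[OF y, of m 0] bound[OF y, of l 0] q0[OF y] \<delta>(1)[of m] \<delta>(1)[of l] unfolding B_def
        by (intro mult_left_mono mult_mono) auto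
      also have "\<dots> \<le> ((\<delta> M + \<delta> M) * d) * (B * B)" using mono by (intro mult_right_mono add_mono) auto
      also have "\<dots> < e\<^sup>2" using M[of M] by (simp add: mult_ac algebra_simps)
      finally have "\<bar>quad_form (N m) y - quad_form (N l) y\<bar>\<^sup>2 < e\<^sup>2" by simp
      then show "norm (quad_form (N m) y - quad_form (N l) y) < e"
        using e power2_less_imp_less[of _ e] by simp
    qed
  qed
  define L where "L = mat d d (\<lambda>(j, k). lim (\<lambda>m. N m $$ (j, k)))"
  have L: "L \<in> carrier_mat d d" by (simp add: L_def)
  have entry: "(\<lambda>m. N m $$ (j, k)) \<longlonglongrightarrow> L $$ (j, k)" if "j < d" "k < d" for j k
  proof -
    have "convergent (\<lambda>m. N m $$ (j, k))"
      unfolding symmetric_entry_quad_form[OF Nm that] divide_inverse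
      by (intro convergent_mult convergent_diff conv convergent_const) auto
    then show ?thesis using that by (simp add: L_def convergent_LIMSEQ_iff)
  qed
  have quad_lim: "(\<lambda>m. quad_form (N m) y) \<longlonglongrightarrow> quad_form L y" if y: "y \<in> carrier_vec d" for y
    unfolding quad_form_def smult_mult_scalar_prod[OF Nm(1) y y] smult_mult_scalar_prod[OF L y y]
    by (intro tendsto_sum tendsto_mult tendsto_const entry) auto
  define x where "x i = quad_form L (row A i)" for i
  have xm: "(\<lambda>m. quad_form (N m) (row A i)) \<longlonglongrightarrow> x i" if "i < n" for i
    unfolding x_def using that by (intro quad_lim) simp
  have x0: "0 \<le> x i" if "i < n" for i
    using LIMSEQ_le_const[OF xm[OF that], of 0] q0 that by auto
  have xpos: "0 < x i" if i: "i < n" "row A i \<noteq> 0\<^sub>v d" for i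
  proof -
    have "quad_form (N 0) (row A i) \<le> (2 * real d + 2) * x i"
      by (rule LIMSEQ_le_const[OF tendsto_mult[OF tendsto_const xm]]) (use bound i in auto)
    moreover have "0 < quad_form (N 0) (row A i)" using pd[of 0] i by (simp add: pos_def_def)
    ultimately have "0 < (2 * real d + 2) * x i" by linarith
    then show ?thesis by (simp add: zero_less_mult_iff)
  qed
  have w0: "0 \<le> \<omega> m i" if "i < n" for m i using \<omega> that by (simp add: row_weights_def)
  have pow: "(\<lambda>m. \<omega> m i powr (2 / p)) \<longlonglongrightarrow> x i" if i: "i < n" for i
  proof -
    \<comment> \<open>The gap in the one-sided bound at row \<open>i\<close>. Weighted by
      \<open>\<omega> m j powr s\<close> and summed over all rows, the gaps total
      \<open>(1 + \<delta> m) * d - d\<close>, so they close as the slack vanishes.\<close>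
    define z where "z m = (1 + \<delta> m) * \<omega> m i powr (2 / p) - quad_form (N m) (row A i)" for m
    have z0: "0 \<le> z m" for m using N[of m] i by (simp add: z_def one_sided_def)
    have zle: "z m \<le> 2 * (\<delta> m * d) powr (2 / p)" for m
    proof -
      have "\<omega> m i powr s * z m \<le> (\<Sum>j<n. \<omega> m j powr s * ((1 + \<delta> m) * \<omega> m j powr (2 / p) - quad_form (N m) (row A j)))"
        unfolding z_def using N[of m] i by (intro member_le_sum) (auto simp: one_sided_def)
      also have "\<dots> = (\<Sum>j<n. (1 + \<delta> m) * \<omega> m j - \<omega> m j powr s * quad_form (N m) (row A j))"
      proof (intro sum.cong refl)
        fix j assume "j \<in> {..<n}"
        then have "\<omega> m j powr s * \<omega> m j powr (2 / p) = \<omega> m j"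
          using w0[of j m] by (simp add: powr_add[symmetric])
        then show "\<omega> m j powr s * ((1 + \<delta> m) * \<omega> m j powr (2 / p) - quad_form (N m) (row A j))
            = (1 + \<delta> m) * \<omega> m j - \<omega> m j powr s * quad_form (N m) (row A j)"
          by (simp add: right_diff_distrib mult.left_commute)
      qed
      also have "\<dots> = (1 + \<delta> m) * d - d"
        using \<omega>[of m] trace_gram_inverse[OF A inv[of m]]
        by (simp add: sum_subtractf sum_distrib_left[symmetric] row_weights_def)
      finally have le: "\<omega> m i powr s * z m \<le> \<delta> m * d" by (simp add: algebra_simps)
      \<comment> \<open>The bound on \<open>\<omega> m i powr s * z m\<close> is weak where the
        weight is small, but there the gap itself is small. Read as
        \<open>(z m / 2) powr (p / 2) \<le> \<omega> m i\<close>, this eliminates the weight and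
        leaves \<open>(z m / 2) powr (p / 2) \<le> \<delta> m * d\<close>.\<close>
      have "z m \<le> (1 + \<delta> m) * \<omega> m i powr (2 / p)" using q0[of "row A i" m] i by (simp add: z_def)
      also have "\<dots> \<le> 2 * \<omega> m i powr (2 / p)" using \<delta>(2)[of m] by (intro mult_right_mono) auto
      finally have "z m / 2 \<le> \<omega> m i powr (2 / p)" by simp
      then have "(z m / 2) powr (p / 2) \<le> (\<omega> m i powr (2 / p)) powr (p / 2)"
        using z0[of m] p by (intro powr_mono2) auto
      then have h: "(z m / 2) powr (p / 2) \<le> \<omega> m i" using p w0[OF i] by (simp add: powr_powr)
      have "p / 2 * s + 1 = p / 2" using p by (simp add: field_simps)
      then have "(z m / 2) powr (p / 2) = (z m / 2) powr (p / 2 * s + 1)" by (simp only:)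
      also have "\<dots> = ((z m / 2) powr (p / 2)) powr s * (z m / 2)"
        using z0[of m] by (simp only: powr_add powr_powr) simp
      also have "\<dots> \<le> \<omega> m i powr s * (z m / 2)"
        using h z0[of m] s by (intro mult_right_mono powr_mono2) auto
      also have "\<dots> \<le> \<delta> m * d"
      proof -
        have "0 \<le> \<omega> m i powr s * z m" using z0[of m] by simp
        then show ?thesis using le by simp
      qed
      finally have "((z m / 2) powr (p / 2)) powr (2 / p) \<le> (\<delta> m * d) powr (2 / p)"
        using p by (intro powr_mono2) auto
      then show ?thesis using z0[of m] p by (simp add: powr_powr)
    qed
    have "(\<lambda>m. \<delta> m * d) \<longlonglongrightarrow> 0" by (rule tendsto_mult_left_zero[OF \<delta>0])
    then have "(\<lambda>m. 2 * (\<delta> m * d) powr (2 / p)) \<longlonglongrightarrow> 2 * 0 powr (2 / p)"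
      using p \<delta>(1) by (intro tendsto_mult tendsto_const tendsto_powr') (auto simp: less_imp_le)
    then have "z \<longlonglongrightarrow> 0"
      using z0 zle by (intro tendsto_sandwich[of "\<lambda>_. 0" z _ "\<lambda>m. 2 * (\<delta> m * d) powr (2 / p)"]) auto
    then have "(\<lambda>m. (z m + quad_form (N m) (row A i)) / (1 + \<delta> m)) \<longlonglongrightarrow> (0 + x i) / (1 + 0)"
      using xm[OF i] by (intro tendsto_intros \<delta>0) auto
    moreover have "(z m + quad_form (N m) (row A i)) / (1 + \<delta> m) = \<omega> m i powr (2 / p)" for m
      using \<delta>(1)[of m] by (simp add: z_def)
    ultimately show ?thesis by simp
  qed
  define w where "w i = x i powr (p / 2)" for i
  have wlim: "(\<lambda>m. \<omega> m i) \<longlonglongrightarrow> w i" if i: "i < n" for i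
  proof -
    have "(\<lambda>m. (\<omega> m i powr (2 / p)) powr (p / 2)) \<longlonglongrightarrow> w i"
      unfolding w_def using p by (intro tendsto_powr' pow[OF i] tendsto_const) auto
    then show ?thesis using p w0[OF i] by (simp add: powr_powr)
  qed
  have wx: "w i powr (2 / p) = x i" if "i < n" for i
    using x0[OF that] p by (simp add: w_def powr_powr)
  have gram_lim: "(\<lambda>m. gram A (\<lambda>i. \<omega> m i powr s) $$ (j, k)) \<longlonglongrightarrow> gram A (\<lambda>i. w i powr s) $$ (j, k)"
    if jk: "j < d" "k < d" for j k
    unfolding gram_entry[OF A jk]
  proof (intro tendsto_sum)
    fix i assume "i \<in> {..<n}"
    then have i: "i < n" by simp
    show "(\<lambda>m. \<omega> m i powr s * A $$ (i, j) * A $$ (i, k)) \<longlonglongrightarrow> w i powr s * A $$ (i, j) * A $$ (i, k)"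
    proof (cases "row A i = 0\<^sub>v d")
      case True
      then have "row A i $ j = 0" using jk by simp
      then have "A $$ (i, j) = 0" using A i jk by simp
      then show ?thesis by simp
    next
      \<comment> \<open>A positive limit weight makes the power continuous. This matters at
        \<open>p = 2\<close>, where the exponent is 0 and \<open>0 powr 0 = 0\<close> creates a jump
        at zero.\<close>
      case False
      then have "0 < w i" using xpos[OF i] by (simp add: w_def)
      then show ?thesis by (intro tendsto_mult tendsto_powr wlim[OF i] tendsto_const) auto
    qed
  qed
  have "gram A (\<lambda>i. w i powr s) * L = 1\<^sub>m d"
  proof (rule eq_matI)
    fix j k assume "j < dim_row (1\<^sub>m d :: real mat)" "k < dim_col (1\<^sub>m d :: real mat)"
    then have jk: "j < d" "k < d" by auto
    have "(\<lambda>m. (gram A (\<lambda>i. \<omega> m i powr s) * N m) $$ (j, k)) \<longlonglongrightarrow> (gram A (\<lambda>i. w i powr s) * L) $$ (j, k)"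
      unfolding mult_mat_entry[OF gram_carrier[OF A] Nm(1) jk] mult_mat_entry[OF gram_carrier[OF A] L jk]
      by (intro tendsto_sum tendsto_mult gram_lim entry jk) auto
    moreover have "(gram A (\<lambda>i. \<omega> m i powr s) * N m) $$ (j, k) = 1\<^sub>m d $$ (j, k)" for m
      using inv[of m] by (simp add: inverse_mats_def)
    ultimately show "(gram A (\<lambda>i. w i powr s) * L) $$ (j, k) = 1\<^sub>m d $$ (j, k)"
      by (simp add: LIMSEQ_const_iff)
  qed (use gram_carrier[OF A] L in auto)
  moreover from this have "L * gram A (\<lambda>i. w i powr s) = 1\<^sub>m d"
    by (rule mat_mult_left_right_inverse[OF gram_carrier[OF A] L])
  ultimately have invL: "inverts_mat (gram A (\<lambda>i. w i powr s)) L \<and> inverts_mat L (gram A (\<lambda>i. w i powr s))"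
    using gram_carrier[OF A, of "\<lambda>i. w i powr s"] L by (auto simp: inverts_mat_def)
  have "gram A (\<lambda>i. (vec n w $ i) powr s) = gram A (\<lambda>i. w i powr s)"
    by (intro eq_matI) (use gram_carrier[OF A] in \<open>auto simp: gram_entry[OF A] carrier_matD[OF gram_carrier[OF A]]\<close>)
  then have "is_lewis_weights A p (vec n w)"
    using invL L wx unfolding is_lewis_weights_def Let_def dims gram_def[symmetric, of A, unfolded dims]
    by (auto simp: w_def x_def)
  then show ?thesis by blast
qed

end

section \<open>From the comparison of forms to approximation factors\<close>

lemma ratio_of_square_diff_le:
  fixes a b \<eta> :: real
  assumes le: "(a - b)\<^sup>2 \<le> \<eta>\<^sup>2 / (1 + \<eta>) * a * b" and "0 \<le> a" "0 \<le> b" "0 < \<eta>"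
  shows "a \<le> (1 + \<eta>) * b"
proof (rule ccontr)
  assume "\<not> a \<le> (1 + \<eta>) * b"
  then have gt: "(1 + \<eta>) * b < a" by simp
  moreover have "b \<le> (1 + \<eta>) * b" using assms by (simp add: mult_right_mono algebra_simps)
  ultimately have "b < a" by linarith
  have "0 \<le> \<eta> * a" using assms by simp
  then have "b < (1 + \<eta>) * a" using \<open>b < a\<close> by (simp add: distrib_right)
  \<comment> \<open>The quadratic
    \<open>(1 + \<eta>) * (a - b)\<^sup>2 - \<eta>\<^sup>2 * a * b\<close> vanishes exactly at the
    ratios \<open>1 + \<eta>\<close> and \<open>1 / (1 + \<eta>)\<close>; this is its
    factorisation.\<close>
  have "0 < (a - (1 + \<eta>) * b) * ((1 + \<eta>) * a - b)"
    using gt \<open>b < (1 + \<eta>) * a\<close> by simp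
  also have "\<dots> = (1 + \<eta>) * (a - b)\<^sup>2 - \<eta>\<^sup>2 * a * b"
    by (simp add: power2_eq_square algebra_simps)
  finally have "\<eta>\<^sup>2 * a * b < (1 + \<eta>) * (a - b)\<^sup>2" by simp
  moreover have "(1 + \<eta>) * (a - b)\<^sup>2 \<le> (1 + \<eta>) * (\<eta>\<^sup>2 / (1 + \<eta>) * a * b)"
    using le assms by (intro mult_left_mono) auto
  moreover have "(1 + \<eta>) * (\<eta>\<^sup>2 / (1 + \<eta>) * a * b) = \<eta>\<^sup>2 * a * b" using assms by simp
  ultimately show False by linarith
qed

text \<open>The precision for forms: weights are forms to the power \<open>p / 2\<close>, which
  takes the factor \<open>1 + \<eta>\<close> to \<open>1 + \<epsilon>\<close>. For
  \<open>2 \<le> p\<close> it is at most \<open>\<epsilon>\<close>, so the forms are accurate enough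
  too.\<close>

definition lewis_eta :: "real \<Rightarrow> real \<Rightarrow> real" where
  "lewis_eta p \<epsilon> = (1 + \<epsilon>) powr (2 / p) - 1"

text \<open>Chosen such that \<open>\<delta> d = \<eta>\<^sup>2 / (1 + \<eta>)\<close>, the value of \<open>(\<lambda> - 1)\<^sup>2 / \<lambda>\<close> at \<open>\<lambda> = 1 + \<eta>\<close>.\<close>

definition lewis_delta :: "nat \<Rightarrow> real \<Rightarrow> real \<Rightarrow> real" where
  "lewis_delta d p \<epsilon> = (lewis_eta p \<epsilon>)\<^sup>2 / ((1 + lewis_eta p \<epsilon>) * real d)"

lemma lewis_eta:
  assumes "2 \<le> p" "0 < \<epsilon>"
  shows "0 < lewis_eta p \<epsilon>" "lewis_eta p \<epsilon> \<le> \<epsilon>" "(1 + lewis_eta p \<epsilon>) powr (p / 2) = 1 + \<epsilon>"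
proof -
  show "0 < lewis_eta p \<epsilon>" using assms by (simp add: lewis_eta_def)
  have "(1 + \<epsilon>) powr (2 / p) \<le> (1 + \<epsilon>) powr 1" using assms by (intro powr_mono) auto
  then show "lewis_eta p \<epsilon> \<le> \<epsilon>" using assms by (simp add: lewis_eta_def)
  show "(1 + lewis_eta p \<epsilon>) powr (p / 2) = 1 + \<epsilon>" using assms by (simp add: lewis_eta_def powr_powr)
qed

lemma loewner_le_smult:
  assumes X: "psd d X" and Y: "psd d Y" and le: "\<And>y. y \<in> carrier_vec d \<Longrightarrow> a * quad_form X y \<le> b * quad_form Y y"
  shows "loewner_le d (a \<cdot>\<^sub>m X) (b \<cdot>\<^sub>m Y)"
proof -
  have c: "X \<in> carrier_mat d d" "Y \<in> carrier_mat d d" "X\<^sup>T = X" "Y\<^sup>T = Y" using X Y by (auto simp: psd_def)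
  have sym: "X $$ (j, k) = X $$ (k, j)" "Y $$ (j, k) = Y $$ (k, j)" if "j < d" "k < d" for j k
    using that c by (metis index_transpose_mat(1) carrier_matD)+
  have "quad_form (b \<cdot>\<^sub>m Y - a \<cdot>\<^sub>m X) y = b * quad_form Y y - a * quad_form X y" if y: "y \<in> carrier_vec d" for y
  proof -
    have "b \<cdot>\<^sub>m Y - a \<cdot>\<^sub>m X \<in> carrier_mat d d" using c by auto
    from smult_mult_scalar_prod[OF this y y] show ?thesis
      unfolding quad_form_def smult_mult_scalar_prod[OF c(1) y y] smult_mult_scalar_prod[OF c(2) y y]
        sum_distrib_left sum_subtractf[symmetric]
      using c by (auto simp: algebra_simps intro!: sum.cong)
  qed
  then show ?thesis
    unfolding loewner_le_def psd_def using c le sym by (auto intro!: eq_matI)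
qed

section \<open>The Lewis form as determinant maximiser, and its approximation\<close>

context full_rank_matrix
begin

lemma is_lewis_weights: "is_lewis_weights A p (lewis_weights A p)"
  unfolding lewis_weights_def using lewis_weights_exist lewis_weights_unique by (metis (mono_tags) theI)

text \<open>The form is the inverse of the Gram matrix \<open>P\<close> at the exact weights. For
  feasible \<open>M\<close>, Hoelder's inequality between the weights and the values
  \<open>quad_form M (row A i) powr (p / 2)\<close> bounds the trace of \<open>P * M\<close> by
  \<open>d\<close>, which certifies optimality.\<close>

lemma lewis_form_exists:
  obtains Q where "is_lewis_form A p Q" "one_sided A p 0 (($) (lewis_weights A p)) Q" "pos_def d Q"
proof -
  define w where "w = lewis_weights A p"
  obtain Q where Q: "one_sided A p 0 (($) w) Q" "\<And>i. i < n \<Longrightarrow> quad_form Q (row A i) = (w $ i) powr (2 / p)"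
    using lewis_weightsD[OF is_lewis_weights] unfolding w_def by blast
  define P where "P = gram A (\<lambda>i. (w $ i) powr s)"
  have inv: "inverse_mats d P Q" and w: "\<And>i. i < n \<Longrightarrow> 0 \<le> w $ i" "(\<Sum>i<n. w $ i) = d"
    using Q(1) by (auto simp: one_sided_def P_def)
  have wQ: "w $ i = quad_form Q (row A i) powr (p / 2)" if "i < n" for i
    using Q(2) w(1) that p by (simp add: powr_powr)
  have P: "pos_def d P"
    unfolding pos_def_def
  proof (intro conjI ballI impI)
    show c: "P \<in> carrier_mat d d" "transpose_mat P = P" using gram_symmetric[OF A] gram_carrier[OF A] by (auto simp: P_def)
    fix x :: "real vec" assume x: "x \<in> carrier_vec d" "x \<noteq> 0\<^sub>v d"
    show "0 < quad_form P x"
    \<comment> \<open>The Gram form is nonnegative and \<open>P\<close> is invertible; if the form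
      vanished at \<open>x\<close>, Cauchy-Schwarz would give
      \<open>x \<bullet> x = 0\<close>.\<close>
    proof (rule ccontr)
      assume "\<not> 0 < quad_form P x"
      then have le: "(\<Sum>i<n. (w $ i) powr s * (row A i \<bullet> x)\<^sup>2) \<le> 0" using gram_quad_form[OF A x(1)] by (simp add: P_def)
      have "(x \<bullet> x)\<^sup>2 \<le> (\<Sum>i<n. (w $ i) powr s * (row A i \<bullet> x)\<^sup>2) * quad_form Q x"
        using inv by (intro gram_inverse_Cauchy_Schwarz[OF A _ _ x(1) x(1)]) (auto simp: P_def)
      also have "\<dots> \<le> 0"
        using le one_sided_compare(2)[OF A p _ _ Q(1) Q(1) x(1)] by (simp add: mult_nonpos_nonneg)
      finally have "x \<bullet> x = 0" by simp
      then show False using x by (simp add: scalar_prod_def sum_nonneg_eq_0_iff) auto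
    qed
  qed
  have pQ: "pos_def d Q" by (rule pos_def_inverse[OF P inv])
  have "det M \<le> det Q" if M: "M \<in> lewis_feasible A p" for M
  proof (rule det_le_of_trace_le[OF P inv])
    show pM: "psd d M" using M by (simp add: lewis_feasible_def)
    then have cM: "M \<in> carrier_mat d d" and qM: "0 \<le> quad_form M (row A i)" if "i < n" for i
      using that by (auto simp: psd_def)
    have "(\<Sum>j<d. (P * M) $$ (j, j)) = (\<Sum>i<n. (w $ i) powr s * quad_form M (row A i))"
      unfolding P_def using n by (intro trace_gram_mult[OF A cM]) auto
    also have "\<dots> = (\<Sum>i<n. (w $ i) powr s * (quad_form M (row A i) powr (p / 2)) powr (1 - s))"
      using p qM by (intro sum.cong refl) (simp add: powr_powr)
    also have "\<dots> \<le> d"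
      using M w s by (intro Hoelder_powr) (auto simp: lewis_feasible_def)
    finally show "(\<Sum>j<d. (P * M) $$ (j, j)) \<le> d" .
  qed
  moreover have "Q \<in> lewis_feasible A p"
    using pos_def_psd[OF pQ] w(2) wQ by (simp add: lewis_feasible_def)
  ultimately have "is_lewis_form A p Q" using wQ by (simp add: is_lewis_form_def w_def)
  then show ?thesis using Q(1) pQ that by (simp add: w_def)
qed

text \<open>The comparison is with the exact form, a solution of slack zero. The weights are read
  off from \<open>N\<close> and not from \<open>v\<close>: the one-sided bound limits
  \<open>v i\<close> only from below, whereas \<open>N\<close> and \<open>Q\<close> are within
  \<open>1 + \<eta>\<close> of each other both ways.\<close>

lemma one_sided_lewis_approx:
  assumes \<epsilon>: "0 < \<epsilon>" and N: "one_sided A p (lewis_delta d p \<epsilon>) v N" "pos_def d N"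
  shows "\<And>i. i < n \<Longrightarrow> approx_factor (1 + \<epsilon>) (quad_form N (row A i) powr (p / 2)) (lewis_weights A p $ i)"
    and "\<exists>Q. is_lewis_form A p Q \<and> approx_form d (1 + \<epsilon>) N Q"
proof -
  define \<eta> where "\<eta> = lewis_eta p \<epsilon>"
  note \<eta> = lewis_eta[OF p \<epsilon>, folded \<eta>_def]
  obtain Q where Q: "is_lewis_form A p Q" "one_sided A p 0 (($) (lewis_weights A p)) Q" "pos_def d Q"
    using lewis_form_exists by blast
  have q: "0 \<le> quad_form N y" "0 \<le> quad_form Q y" if "y \<in> carrier_vec d" for y
    using pos_def_psd[OF N(2)] pos_def_psd[OF Q(3)] that by (auto simp: psd_def)
  have \<delta>: "0 \<le> lewis_delta d p \<epsilon>" "lewis_delta d p \<epsilon> * d = \<eta>\<^sup>2 / (1 + \<eta>)"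
    using d \<eta> by (auto simp: lewis_delta_def \<eta>_def[symmetric])
  have cmp: "quad_form N y \<le> (1 + \<eta>) * quad_form Q y" "quad_form Q y \<le> (1 + \<eta>) * quad_form N y"
    if y: "y \<in> carrier_vec d" for y
  proof -
    have h: "(quad_form N y - quad_form Q y)\<^sup>2 \<le> \<eta>\<^sup>2 / (1 + \<eta>) * quad_form N y * quad_form Q y"
      using one_sided_compare(1)[OF A p \<delta>(1) order_refl N(1) Q(2) y] by (simp only: add_0_right \<delta>(2))
    moreover have "(quad_form Q y - quad_form N y)\<^sup>2 \<le> \<eta>\<^sup>2 / (1 + \<eta>) * quad_form Q y * quad_form N y"
      using h by (simp add: power2_commute mult_ac)
    ultimately show "quad_form N y \<le> (1 + \<eta>) * quad_form Q y" "quad_form Q y \<le> (1 + \<eta>) * quad_form N y"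
      using q[OF y] \<eta>(1) by (auto intro: ratio_of_square_diff_le)
  qed
  show "approx_factor (1 + \<epsilon>) (quad_form N (row A i) powr (p / 2)) (lewis_weights A p $ i)" if i: "i < n" for i
  proof -
    have w: "lewis_weights A p $ i = quad_form Q (row A i) powr (p / 2)"
      using Q(1) i by (simp add: is_lewis_form_def)
    have pow: "((1 + \<eta>) * a) powr (p / 2) = (1 + \<epsilon>) * a powr (p / 2)" if "0 \<le> a" for a
      using that \<eta> by (simp add: powr_mult)
    have "quad_form N (row A i) powr (p / 2) \<le> ((1 + \<eta>) * quad_form Q (row A i)) powr (p / 2)"
      "quad_form Q (row A i) powr (p / 2) \<le> ((1 + \<eta>) * quad_form N (row A i)) powr (p / 2)"
      using cmp[of "row A i"] q[of "row A i"] i p by (auto intro!: powr_mono2)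
    then show ?thesis using q[of "row A i"] i \<epsilon> unfolding approx_factor_def w pow[OF q(1)[OF row_carrier[OF i]]] pow[OF q(2)[OF row_carrier[OF i]]]
      by (simp add: field_simps)
  qed
  have "1 / (1 + \<epsilon>) * quad_form N y \<le> 1 * quad_form Q y" "1 * quad_form Q y \<le> (1 + \<epsilon>) * quad_form N y"
    if y: "y \<in> carrier_vec d" for y
  proof -
    have "(1 + \<eta>) * quad_form N y \<le> (1 + \<epsilon>) * quad_form N y" "(1 + \<eta>) * quad_form Q y \<le> (1 + \<epsilon>) * quad_form Q y"
      using q[OF y] \<eta> by (auto intro!: mult_right_mono)
    then show "1 / (1 + \<epsilon>) * quad_form N y \<le> 1 * quad_form Q y" "1 * quad_form Q y \<le> (1 + \<epsilon>) * quad_form N y"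
      using cmp[OF y] \<epsilon> by (auto simp: field_simps)
  qed
  note le = loewner_le_smult[OF pos_def_psd[OF N(2)] pos_def_psd[OF Q(3)] this(1)]
    loewner_le_smult[OF pos_def_psd[OF Q(3)] pos_def_psd[OF N(2)] this(2)]
  have "1 \<cdot>\<^sub>m Q = Q" by (intro eq_matI) auto
  then have "approx_form d (1 + \<epsilon>) N Q" using le by (simp add: approx_form_def)
  then show "\<exists>Q. is_lewis_form A p Q \<and> approx_form d (1 + \<epsilon>) N Q" using Q(1) by blast
qed

end

section \<open>Cost-bounded execution\<close>

definition runs :: "com \<Rightarrow> ram_state \<Rightarrow> nat \<Rightarrow> (ram_state \<Rightarrow> bool) \<Rightarrow> bool" where
  "runs c s B R \<longleftrightarrow> (\<exists>t s'. exec c s t s' \<and> t \<le> B \<and> R s')"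

fun nwrites :: "com \<Rightarrow> name set" where
  "nwrites (NStore a k e) = {a}"
| "nwrites (Seq c1 c2) = nwrites c1 \<union> nwrites c2"
| "nwrites (Cond b c1 c2) = nwrites c1 \<union> nwrites c2"
| "nwrites (While b c) = nwrites c"
| "nwrites _ = {}"

fun rwrites :: "com \<Rightarrow> name set" where
  "rwrites (RStore a k e) = {a}"
| "rwrites (Seq c1 c2) = rwrites c1 \<union> rwrites c2"
| "rwrites (Cond b c1 c2) = rwrites c1 \<union> rwrites c2"
| "rwrites (While b c) = rwrites c"
| "rwrites _ = {}"

text \<open>A frame condition on whole arrays, decided by syntax. Loop invariants then need to
  mention only the arrays that the body writes.\<close>

definition agree :: "com \<Rightarrow> ram_state \<Rightarrow> ram_state \<Rightarrow> bool" where
  "agree c s s' \<longleftrightarrow> (\<forall>a. a \<notin> nwrites c \<longrightarrow> nmem s' a = nmem s a) \<and> (\<forall>a. a \<notin> rwrites c \<longrightarrow> rmem s' a = rmem s a)"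

lemma agreeD:
  assumes "agree c s s'"
  shows "a \<notin> nwrites c \<Longrightarrow> nmem s' a = nmem s a" "b \<notin> rwrites c \<Longrightarrow> rmem s' b = rmem s b"
  using assms by (auto simp: agree_def)

lemma mem_store [simp]:
  "nmem (nstore a k v s) b = (if b = a then (nmem s a)(k := v) else nmem s b)"
  "rmem (nstore a k v s) = rmem s"
  "rmem (rstore a k x s) b = (if b = a then (rmem s a)(k := x) else rmem s b)"
  "nmem (rstore a k x s) = nmem s"
  by (auto simp: nstore_def rstore_def)

lemma exec_agree: "exec c s t s' \<Longrightarrow> agree c s s'"
  by (induction rule: exec.induct) (auto simp: agree_def)

lemma runs_mono:
  assumes "runs c s B R" "B \<le> B'" "\<And>s'. R s' \<Longrightarrow> agree c s s' \<Longrightarrow> R' s'"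
  shows "runs c s B' R'"
proof -
  obtain t s' where "exec c s t s'" "t \<le> B" "R s'" using assms(1) by (auto simp: runs_def)
  then show ?thesis using assms(2,3) exec_agree[of c s t s'] unfolding runs_def by (meson le_trans)
qed

lemma runs_NStore:
  "R (nstore a (nval k s) (nval e s) s) \<Longrightarrow> 1 + ncost k + ncost e \<le> B \<Longrightarrow> runs (NStore a k e) s B R"
  unfolding runs_def using exec.NStore by blast

lemma runs_RStore:
  "R (rstore a (nval k s) (rval e s) s) \<Longrightarrow> 1 + ncost k + rcost e \<le> B \<Longrightarrow> runs (RStore a k e) s B R"
  unfolding runs_def using exec.RStore by blast

lemma runs_Seq:
  assumes "runs c1 s B1 R1" "\<And>s'. R1 s' \<Longrightarrow> agree c1 s s' \<Longrightarrow> runs c2 s' B2 R2" "B1 + B2 \<le> B"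
  shows "runs (Seq c1 c2) s B R2"
proof -
  obtain t1 s1 where 1: "exec c1 s t1 s1" "t1 \<le> B1" "R1 s1" using assms(1) by (auto simp: runs_def)
  then obtain t2 s2 where 2: "exec c2 s1 t2 s2" "t2 \<le> B2" "R2 s2"
    using assms(2)[OF 1(3) exec_agree[OF 1(1)]] by (auto simp: runs_def)
  have "t1 + t2 \<le> B" using 1 2 assms(3) by linarith
  then show ?thesis unfolding runs_def using exec.Seq[OF 1(1) 2(1)] 2(3) by blast
qed

lemma runs_Seq_RStore:
  assumes "runs c (rstore a (nval k s) (rval e s) s) B' R" "1 + ncost k + rcost e + B' \<le> B"
  shows "runs (Seq (RStore a k e) c) s B R"
  by (rule runs_Seq[OF runs_RStore[where R = "\<lambda>s'. s' = rstore a (nval k s) (rval e s) s"]])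
    (use assms in auto)

text \<open>The invariant is indexed by the number of finished rounds, and the induction is on the
  rounds left. Agreement is always with the state before the loop, because agreement composes over
  the rounds.\<close>

lemma runs_While:
  assumes I: "I 0 s"
    and step: "\<And>k s'. k < T \<Longrightarrow> I k s' \<Longrightarrow> agree c s s' \<Longrightarrow> bval b s' \<and> runs c s' B (I (Suc k))"
    and exit: "\<And>s'. I T s' \<Longrightarrow> agree c s s' \<Longrightarrow> \<not> bval b s'"
    and B': "T * (1 + bcost b + B) + (1 + bcost b) \<le> B'"
  shows "runs (While b c) s B' (I T)"
proof -
  have "\<exists>t s''. exec (While b c) s' t s'' \<and> t \<le> (T - k) * (1 + bcost b + B) + (1 + bcost b) \<and> I T s''"
    if "k \<le> T" "I k s'" "agree c s s'" for k s'
    using that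
  proof (induction "T - k" arbitrary: k s')
    case 0
    then have "k = T" by simp
    with 0 exit have "\<not> bval b s'" "I T s'" by auto
    then show ?case using exec.WhileFalse[of b s' c] by (intro exI[of _ "1 + bcost b"] exI[of _ s']) auto
  next
    case (Suc m)
    then have "k < T" by simp
    with step Suc obtain t1 s1 where 1: "bval b s'" "exec c s' t1 s1" "t1 \<le> B" "I (Suc k) s1"
      by (fastforce simp: runs_def)
    have "agree c s s1" using Suc(5) exec_agree[OF 1(2)] by (simp add: agree_def)
    with Suc \<open>k < T\<close> 1(4) obtain t2 s2 where 2: "exec (While b c) s1 t2 s2"
        "t2 \<le> (T - Suc k) * (1 + bcost b + B) + (1 + bcost b)" "I T s2"
      by (metis Suc_leI diff_Suc_1 diff_Suc_eq_diff_pred diff_commute)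
    have "T - k = Suc (T - Suc k)" using \<open>k < T\<close> by simp
    then have "1 + bcost b + t1 + t2 \<le> (T - k) * (1 + bcost b + B) + (1 + bcost b)" using 1(3) 2(2) by simp
    then show ?case using exec.WhileTrue[OF 1(1,2) 2(1)] 2(3) by blast
  qed
  from this[of 0 s] I have "\<exists>t s''. exec (While b c) s t s'' \<and> t \<le> T * (1 + bcost b + B) + (1 + bcost b) \<and> I T s''"
    by (simp add: agree_def)
  then show ?thesis unfolding runs_def using B' by (meson le_trans)
qed

abbreviation ncell :: "name \<Rightarrow> nexp" where "ncell a \<equiv> NCell a (NConst 0)"
abbreviation rcell :: "name \<Rightarrow> rexp" where "rcell a \<equiv> RCell a (NConst 0)"

definition For :: "name \<Rightarrow> name \<Rightarrow> com \<Rightarrow> com" where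
  "For i m c = Seq (NStore i (NConst 0) (NConst 0))
     (While (NLess (ncell i) (ncell m)) (Seq c (NStore i (NConst 0) (NAdd (ncell i) (NConst 1)))))"

lemma writes_For [simp]:
  "nwrites (For i m c) = insert i (nwrites c)" "rwrites (For i m c) = rwrites c"
  by (auto simp: For_def)

text \<open>Condition \<open>stable\<close> says that the invariant does not read the counter, whose
  value is passed to \<open>step\<close> separately. The 25 steps per round include the
  initialisation and the last failing test, which \<open>0 < N\<close> allows.\<close>

lemma runs_For:
  assumes N: "nmem s m 0 = N" "0 < N" and names: "m \<noteq> i" "m \<notin> nwrites c" "i \<notin> nwrites c"
    and init: "I 0 s" and stable: "\<And>k v s'. I k s' \<Longrightarrow> I k (nstore i 0 v s')"
    and step: "\<And>k s'. k < N \<Longrightarrow> I k s' \<Longrightarrow> nmem s' i 0 = k \<Longrightarrow> agree (For i m c) s s' \<Longrightarrow> runs c s' B (I (Suc k))"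
    and B': "N * (B + 25) \<le> B'"
  shows "runs (For i m c) s B' (I N)"
  unfolding For_def
proof (rule runs_Seq)
  show "runs (NStore i (NConst 0) (NConst 0)) s 3 (\<lambda>s'. s' = nstore i 0 0 s)"
    by (rule runs_NStore) auto
  show "3 + (N * (B + 13) + 7) \<le> B'" using B' N(2) by (cases N) (auto simp: algebra_simps)
  fix s0 assume s0: "s0 = nstore i 0 0 s"
  let ?body = "Seq c (NStore i (NConst 0) (NAdd (ncell i) (NConst 1)))"
  let ?b = "NLess (ncell i) (ncell m)"
  have "runs (While ?b ?body) s0 (N * (1 + bcost ?b + (B + 6)) + (1 + bcost ?b)) (\<lambda>s'. I N s' \<and> nmem s' i 0 = N)"
  proof (rule runs_While[where I = "\<lambda>k s'. I k s' \<and> nmem s' i 0 = k" and B = "B + 6"])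
    show "I 0 s0 \<and> nmem s0 i 0 = 0" using init stable by (simp add: s0)
    fix k s' assume k: "k < N" and I: "I k s' \<and> nmem s' i 0 = k" and ag: "agree ?body s0 s'"
    have ag': "agree (For i m c) s s'"
      using ag by (auto simp: agree_def s0)
    have m: "nmem s' m = nmem s m" using agreeD(1)[OF ag', of m] names by simp
    have "runs ?body s' (B + 6) (\<lambda>s'. I (Suc k) s' \<and> nmem s' i 0 = Suc k)"
    proof (rule runs_Seq)
      show "runs c s' B (I (Suc k))" using step k I ag' by blast
      fix s1 assume "I (Suc k) s1" "agree c s' s1"
      then show "runs (NStore i (NConst 0) (NAdd (ncell i) (NConst 1))) s1 6 (\<lambda>s'. I (Suc k) s' \<and> nmem s' i 0 = Suc k)"
        using I names(3) by (intro runs_NStore) (auto simp: stable agreeD(1))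
    qed simp
    then show "bval ?b s' \<and> runs ?body s' (B + 6) (\<lambda>s'. I (Suc k) s' \<and> nmem s' i 0 = Suc k)"
      using k I m N by simp
  next
    fix s' assume I: "I N s' \<and> nmem s' i 0 = N" and ag: "agree ?body s0 s'"
    have "nmem s' m = nmem s m" using agreeD(1)[OF ag, of m] names by (simp add: s0)
    then show "\<not> bval ?b s'" using I N by simp
  qed simp
  then show "runs (While ?b ?body) s0 (N * (B + 13) + 7) (I N)"
    by (rule runs_mono) (auto simp: algebra_simps)
qed

text \<open>Natural numbers cannot be multiplied on this machine, so the row offsets
  \<open>j * d\<close> are tabulated in the array \<open>o\<close>. As \<open>d \<le> n\<close>, one
  table serves both \<open>A\<close> and the square array \<open>Q\<close>.\<close>

definition layout :: "nat \<Rightarrow> nat \<Rightarrow> ram_state \<Rightarrow> bool" where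
  "layout n d s \<longleftrightarrow> nmem s ''n'' 0 = n \<and> nmem s ''d'' 0 = d \<and> (\<forall>j\<le>n. nmem s ''o'' j = j * d) \<and> 0 < d \<and> d \<le> n"

lemma layout_agree:
  assumes "layout n d s" "agree c s s'" "''n'' \<notin> nwrites c" "''d'' \<notin> nwrites c" "''o'' \<notin> nwrites c"
  shows "layout n d s'"
  using assms by (simp add: layout_def agreeD(1))

abbreviation ix :: "name \<Rightarrow> name \<Rightarrow> nexp" where
  "ix i j \<equiv> NAdd (NCell ''o'' (ncell i)) (ncell j)"

definition "offsets = For ''i'' ''n''
  (NStore ''o'' (NAdd (ncell ''i'') (NConst 1)) (NAdd (NCell ''o'' (ncell ''i'')) (ncell ''d'')))"

definition "dot_row = For ''j'' ''d'' (RStore ''y'' (ncell ''i'')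
  (RAdd (RCell ''y'' (ncell ''i'')) (RMul (RCell ''Q'' (ix ''i'' ''j'')) (RCell ''v'' (ncell ''j'')))))"

text \<open>The cell \<open>q\<close> collects \<open>v \<bullet> y\<close> in the same sweep: it
  enters the denominator of the rank-one update and, for a row of \<open>A\<close>, it is the score
  of that row.\<close>

definition "matvec = Seq (RStore ''q'' (NConst 0) (RConst 0)) (For ''i'' ''d''
  (Seq (RStore ''y'' (ncell ''i'') (RConst 0)) (Seq dot_row
  (RStore ''q'' (NConst 0) (RAdd (rcell ''q'') (RMul (RCell ''v'' (ncell ''i'')) (RCell ''y'' (ncell ''i''))))))))"

definition "update_row = For ''j'' ''d''
  (RStore ''Q'' (ix ''i'' ''j'') (RSub (RCell ''Q'' (ix ''i'' ''j''))
     (RDiv (RMul (rcell ''c'') (RMul (RCell ''y'' (ncell ''i'')) (RCell ''y'' (ncell ''j''))))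
           (RAdd (RConst 1) (RMul (rcell ''c'') (rcell ''q''))))))"

definition "rank_one_update = Seq matvec (For ''i'' ''d'' update_row)"

definition "load_row = For ''j'' ''d'' (RStore ''v'' (ncell ''j'') (RCell ''A'' (ix ''k'' ''j'')))"

definition "load_unit = Seq (For ''j'' ''d'' (RStore ''v'' (ncell ''j'') (RConst 0)))
  (RStore ''v'' (ncell ''k'') (RConst 1))"

definition "zero_row = For ''j'' ''d'' (RStore ''Q'' (ix ''i'' ''j'') (RConst 0))"

definition "load_identity = For ''i'' ''d'' (Seq zero_row (RStore ''Q'' (ix ''i'' ''i'') (RConst 1)))"

lemma writes_offsets [simp]: "nwrites offsets = {''i'', ''o''}" "rwrites offsets = {}"
  by (auto simp: offsets_def)

lemma writes_rows [simp]:
  "nwrites dot_row = {''j''}" "rwrites dot_row = {''y''}"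
  "nwrites update_row = {''j''}" "rwrites update_row = {''Q''}"
  "nwrites zero_row = {''j''}" "rwrites zero_row = {''Q''}"
  "nwrites load_row = {''j''}" "rwrites load_row = {''v''}"
  "nwrites load_unit = {''j''}" "rwrites load_unit = {''v''}"
  by (auto simp: dot_row_def update_row_def zero_row_def load_row_def load_unit_def)

lemma writes_matrix [simp]:
  "nwrites matvec = {''i'', ''j''}" "rwrites matvec = {''y'', ''q''}"
  "nwrites rank_one_update = {''i'', ''j''}" "rwrites rank_one_update = {''y'', ''q'', ''Q''}"
  "nwrites load_identity = {''i'', ''j''}" "rwrites load_identity = {''Q''}"
  by (auto simp: matvec_def rank_one_update_def load_identity_def)

text \<open>Row-major addressing is injective, so a store to one matrix entry leaves the others
  intact.\<close>

lemma index_eq_iff: "(b::nat) < d \<Longrightarrow> b' < d \<Longrightarrow> a * d + b = a' * d + b' \<longleftrightarrow> a = a' \<and> b = b'"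
  by (metis add.commute div_mult_self3 div_less add_cancel_right_left mod_less mod_mult_self3 less_zeroE)

lemma runs_offsets:
  assumes "nmem s ''n'' 0 = n" "nmem s ''d'' 0 = d" "nmem s ''o'' 0 = 0" "0 < d" "d \<le> n"
  shows "runs offsets s (n * 40) (layout n d)"
proof -
  have "runs offsets s (n * 40) (\<lambda>s'. \<forall>j\<le>n. nmem s' ''o'' j = j * d)"
    unfolding offsets_def
  proof (rule runs_For[where B = 15 and I = "\<lambda>k s'. \<forall>j\<le>k. nmem s' ''o'' j = j * d"], goal_cases)
    case (8 k s')
    then show ?case
      using assms agreeD(1)[OF 8(4), of "''d''"] by (intro runs_NStore) (auto simp: le_Suc_eq)
  qed (use assms in auto)
  then show ?thesis
    by (rule runs_mono) (auto simp: layout_def assms agreeD(1))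
qed

text \<open>Frame conditions see \<open>y\<close> as one array; that its other entries survive has
  to be stated here.\<close>

lemma runs_dot_row:
  assumes l: "layout n d s" and i: "nmem s ''i'' 0 = i" "i < d"
  shows "runs dot_row s (d * 60) (\<lambda>s'. (\<forall>a. a \<noteq> i \<longrightarrow> rmem s' ''y'' a = rmem s ''y'' a)
    \<and> rmem s' ''y'' i = rmem s ''y'' i + (\<Sum>j<d. rmem s ''Q'' (i * d + j) * rmem s ''v'' j))"
  unfolding dot_row_def
proof (rule runs_For[where B = 35 and I = "\<lambda>k s'. (\<forall>a. a \<noteq> i \<longrightarrow> rmem s' ''y'' a = rmem s ''y'' a)
    \<and> rmem s' ''y'' i = rmem s ''y'' i + (\<Sum>j<k. rmem s ''Q'' (i * d + j) * rmem s ''v'' j)"], goal_cases)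
  case (8 j s1)
  have "rmem s1 ''Q'' = rmem s ''Q''" "rmem s1 ''v'' = rmem s ''v''" "nmem s1 ''i'' = nmem s ''i''" "nmem s1 ''o'' = nmem s ''o''"
    using agreeD[OF 8(4)] by simp_all
  then show ?case using 8 i l by (intro runs_RStore) (auto simp: layout_def)
qed (use l in \<open>auto simp: layout_def\<close>)

lemma runs_matvec:
  assumes l: "layout n d s"
  defines "y \<equiv> \<lambda>i. \<Sum>j<d. rmem s ''Q'' (i * d + j) * rmem s ''v'' j"
  shows "runs matvec s (200 * (d * d))
    (\<lambda>s'. (\<forall>i<d. rmem s' ''y'' i = y i) \<and> rmem s' ''q'' 0 = (\<Sum>i<d. rmem s ''v'' i * y i))"
  unfolding matvec_def
proof (rule runs_Seq_RStore)
  have d: "0 < d" "d \<le> n" using l by (auto simp: layout_def)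
  show "1 + ncost (NConst 0) + rcost (RConst 0) + d * (d * 60 + 50) \<le> 200 * (d * d)"
    using d(1) by (cases d) (auto simp: algebra_simps)
  define s0 where "s0 = rstore ''q'' (nval (NConst 0) s) (rval (RConst 0) s) s"
  show "runs (For ''i'' ''d'' (Seq (RStore ''y'' (ncell ''i'') (RConst 0)) (Seq dot_row
      (RStore ''q'' (NConst 0) (RAdd (rcell ''q'') (RMul (RCell ''v'' (ncell ''i'')) (RCell ''y'' (ncell ''i''))))))))
     (rstore ''q'' (nval (NConst 0) s) (rval (RConst 0) s) s)
     (d * (d * 60 + 50)) (\<lambda>s'. (\<forall>i<d. rmem s' ''y'' i = y i) \<and> rmem s' ''q'' 0 = (\<Sum>i<d. rmem s ''v'' i * y i))"
    unfolding s0_def[symmetric]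
  proof (rule runs_For[where B = "d * 60 + 25" and
      I = "\<lambda>k s'. (\<forall>i<k. rmem s' ''y'' i = y i) \<and> rmem s' ''q'' 0 = (\<Sum>i<k. rmem s ''v'' i * y i)"], goal_cases)
    case (8 i s1)
    have fr: "rmem s1 ''Q'' = rmem s ''Q''" "rmem s1 ''v'' = rmem s ''v''"
      using agreeD[OF 8(4)] by (simp_all add: s0_def)
    have l1: "layout n d s1" by (rule layout_agree[OF _ 8(4)]) (use l in \<open>auto simp: s0_def layout_def\<close>)
    define s2 where "s2 = rstore ''y'' (nval (ncell ''i'') s1) (rval (RConst 0) s1) s1"
    have l2: "layout n d s2" "nmem s2 ''i'' 0 = i" using l1 8(3) by (auto simp: s2_def layout_def)
    show ?case
    proof (rule runs_Seq_RStore[where B' = "d * 60 + 20"], fold s2_def, rule runs_Seq[OF runs_dot_row[OF l2 8(1)], where ?B2.0 = 15], goal_cases)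
      case (1 s3)
      have "rmem s3 ''q'' = rmem s1 ''q''" "rmem s3 ''v'' = rmem s ''v''" "nmem s3 ''i'' 0 = i"
        using agreeD[OF 1(2)] fr 8(3) by (simp_all add: s2_def)
      then show ?case using 1(1) 8 fr
        by (intro runs_RStore) (auto simp: less_Suc_eq y_def s2_def)
    qed auto
  qed (use l d in \<open>auto simp: s0_def layout_def algebra_simps\<close>)
qed

section \<open>Matrix routines\<close>

definition mat_at :: "nat \<Rightarrow> real mat \<Rightarrow> ram_state \<Rightarrow> bool" where
  "mat_at d M s \<longleftrightarrow> (\<forall>i<d. \<forall>j<d. rmem s ''Q'' (i * d + j) = M $$ (i, j))"

definition vec_at :: "nat \<Rightarrow> real vec \<Rightarrow> ram_state \<Rightarrow> bool" where
  "vec_at d v s \<longleftrightarrow> (\<forall>j<d. rmem s ''v'' j = v $ j)"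

definition rank_one :: "nat \<Rightarrow> real \<Rightarrow> real mat \<Rightarrow> real vec \<Rightarrow> real mat" where
  "rank_one d c B v = mat d d (\<lambda>(i, j). B $$ (i, j) + c * (v $ i * v $ j))"

definition sherman_morrison :: "nat \<Rightarrow> real \<Rightarrow> real mat \<Rightarrow> real vec \<Rightarrow> real mat" where
  "sherman_morrison d c N v = mat d d (\<lambda>(i, j). N $$ (i, j)
     - c * ((N *\<^sub>v v) $ i * (N *\<^sub>v v) $ j) / (1 + c * quad_form N v))"

lemma quad_form_rank_one:
  assumes B: "B \<in> carrier_mat d d" and v: "v \<in> carrier_vec d" and x: "x \<in> carrier_vec d"
  shows "quad_form (rank_one d c B v) x = quad_form B x + c * (v \<bullet> x)\<^sup>2"
proof -
  have R: "rank_one d c B v \<in> carrier_mat d d" by (simp add: rank_one_def)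
  have "quad_form (rank_one d c B v) x = (\<Sum>j<d. \<Sum>k<d. B $$ (j, k) * x $ j * x $ k + c * ((v $ j * x $ j) * (v $ k * x $ k)))"
    unfolding quad_form_def smult_mult_scalar_prod[OF R x x]
    by (intro sum.cong refl) (simp add: rank_one_def algebra_simps)
  also have "\<dots> = quad_form B x + c * ((\<Sum>j<d. v $ j * x $ j) * (\<Sum>k<d. v $ k * x $ k))"
    unfolding quad_form_def smult_mult_scalar_prod[OF B x x] sum_product
    by (simp add: sum.distrib sum_distrib_left)
  also have "(\<Sum>j<d. v $ j * x $ j) = v \<bullet> x"
    using x by (simp add: scalar_prod_def atLeast0LessThan)
  finally show ?thesis by (simp add: power2_eq_square)
qed

lemma rank_one_symmetric: "transpose_mat B = B \<Longrightarrow> B \<in> carrier_mat d d \<Longrightarrow> transpose_mat (rank_one d c B v) = rank_one d c B v"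
  by (intro eq_matI) (auto simp: rank_one_def mult.commute, metis index_transpose_mat(1) carrier_matD)

text \<open>Here \<open>c\<close> may be negative, so the denominator \<open>t = 1 + c * q\<close>
  needs an argument: with \<open>y = N v\<close>, the updated form at \<open>y\<close> is
  \<open>q * t\<close>, and it is positive unless \<open>y\<close> vanishes, in which case
  \<open>t = 1\<close>.\<close>

lemma inverse_mats_sherman_morrison:
  assumes B: "pos_def d B" and B': "pos_def d (rank_one d c B v)" and inv: "inverse_mats d B N"
    and v: "v \<in> carrier_vec d"
  shows "inverse_mats d (rank_one d c B v) (sherman_morrison d c N v)"
proof -
  define y where "y = N *\<^sub>v v"
  define q where "q = quad_form N v"
  define t where "t = 1 + c * q"
  have N: "N \<in> carrier_mat d d" "B \<in> carrier_mat d d" "B * N = 1\<^sub>m d" using inv by (auto simp: inverse_mats_def)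
  have y: "y \<in> carrier_vec d" using N v by (auto simp: y_def)
  have By: "B *\<^sub>v y = v" using inverse_mats_vec(1)[OF inv v] by (simp add: y_def)
  have vy: "v \<bullet> y = q" by (simp add: q_def y_def quad_form_def)
  have "t \<noteq> 0"
  proof (cases "y = 0\<^sub>v d")
    case True
    then have "q = 0" using vy v by simp
    then show ?thesis by (simp add: t_def)
  next
    case False
    have "y \<bullet> v = q" using vy comm_scalar_prod[OF y v] by simp
    then have qB: "quad_form B y = q" by (simp add: quad_form_def By)
    have "0 < quad_form (rank_one d c B v) y" using B' False y by (simp add: pos_def_def)
    then have "0 < q + c * q\<^sup>2" by (simp add: quad_form_rank_one[OF N(2) v y] qB vy)
    then have "0 < q * t" by (simp add: t_def power2_eq_square algebra_simps)
    then show ?thesis by auto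
  qed
  let ?R = "rank_one d c B v" and ?M = "sherman_morrison d c N v"
  have c: "?R \<in> carrier_mat d d" "?M \<in> carrier_mat d d" by (auto simp: rank_one_def sherman_morrison_def)
  have Ny: "(\<Sum>k<d. v $ k * N $$ (k, j)) = y $ j" if "j < d" for j
  proof -
    have "transpose_mat N = N" using inverse_mats_symmetric[OF inv] B by (simp add: pos_def_def)
    then have "N $$ (k, j) = N $$ (j, k)" if "k < d" for k
      using N \<open>j < d\<close> that by (metis index_transpose_mat(1) carrier_matD)
    then show ?thesis using that N v
      by (auto simp: y_def scalar_prod_def atLeast0LessThan mult.commute intro!: sum.cong)
  qed
  have BNe: "(\<Sum>k<d. B $$ (i, k) * N $$ (k, j)) = (1\<^sub>m d) $$ (i, j)" if "i < d" "j < d" for i j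
    using mult_mat_entry[OF N(2,1) that] N(3) by simp
  have Bye: "(\<Sum>k<d. B $$ (i, k) * y $ k) = v $ i" if "i < d" for i
    using arg_cong[OF By, of "\<lambda>z. z $ i"] that N y by (simp add: scalar_prod_def atLeast0LessThan)
  have vye: "(\<Sum>k<d. v $ k * y $ k) = q" using vy y by (simp add: scalar_prod_def atLeast0LessThan)
  have "?R * ?M = 1\<^sub>m d"
  proof (rule eq_matI)
    fix i j assume "i < dim_row (1\<^sub>m d :: real mat)" "j < dim_col (1\<^sub>m d :: real mat)"
    then have ij: "i < d" "j < d" by auto
    have "(?R * ?M) $$ (i, j) = (\<Sum>k<d. (B $$ (i, k) + c * (v $ i * v $ k)) * (N $$ (k, j) - c * (y $ k * y $ j) / t))"
      using ij by (simp add: mult_mat_entry[OF c ij])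
        (auto simp: rank_one_def sherman_morrison_def y_def t_def q_def intro!: sum.cong)
    also have "\<dots> = (\<Sum>k<d. B $$ (i, k) * N $$ (k, j) - (c * y $ j / t) * (B $$ (i, k) * y $ k)
        + (c * v $ i) * (v $ k * N $$ (k, j)) - (c * v $ i) * (c * y $ j / t) * (v $ k * y $ k))"
      by (intro sum.cong refl) (simp add: algebra_simps)
    also have "\<dots> = (1\<^sub>m d) $$ (i, j) - (c * y $ j / t) * v $ i + (c * v $ i) * y $ j - (c * v $ i) * (c * y $ j / t) * q"
      by (simp only: sum.distrib sum_subtractf sum_distrib_left[symmetric] BNe[OF ij] Bye[OF ij(1)] Ny[OF ij(2)] vye)
    also have "\<dots> = (1\<^sub>m d) $$ (i, j) + c * v $ i * y $ j * (1 - (1 + c * q) / t)"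
      by (simp add: algebra_simps add_divide_distrib)
    also have "\<dots> = (1\<^sub>m d) $$ (i, j)" using \<open>t \<noteq> 0\<close> by (simp add: t_def)
    finally show "(?R * ?M) $$ (i, j) = (1\<^sub>m d) $$ (i, j)" .
  qed (use c in auto)
  then show ?thesis using mat_mult_left_right_inverse[OF c] c by (simp add: inverse_mats_def)
qed

lemma runs_load_row:
  assumes l: "layout n d s" and k: "nmem s ''k'' 0 = k" "k < n"
  shows "runs load_row s (d * 50) (\<lambda>s'. \<forall>j<d. rmem s' ''v'' j = rmem s ''A'' (k * d + j))"
  unfolding load_row_def
proof (rule runs_For[where B = 20 and I = "\<lambda>m s'. \<forall>j<m. rmem s' ''v'' j = rmem s ''A'' (k * d + j)"], goal_cases)
  case (8 j s1)
  have "rmem s1 ''A'' = rmem s ''A''" "nmem s1 ''k'' = nmem s ''k''" "nmem s1 ''o'' = nmem s ''o''"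
    using agreeD[OF 8(4)] by simp_all
  then show ?case using 8 k l by (intro runs_RStore) (auto simp: layout_def less_Suc_eq)
qed (use l in \<open>auto simp: layout_def\<close>)

lemma runs_load_unit:
  assumes l: "layout n d s" and k: "nmem s ''k'' 0 = k" "k < d"
  shows "runs load_unit s (d * 50) (vec_at d (unit_vec d k))"
  unfolding load_unit_def
proof (rule runs_Seq[where ?R1.0 = "\<lambda>s'. \<forall>j<d. rmem s' ''v'' j = 0" and ?B1.0 = "d * 40" and ?B2.0 = 10], goal_cases)
  case 1
  show ?case
    by (rule runs_For[where B = 15 and I = "\<lambda>m s'. \<forall>j<m. rmem s' ''v'' j = 0"])
      (use l in \<open>auto simp: layout_def less_Suc_eq intro!: runs_RStore\<close>)
next
  case (2 s1)
  have "nmem s1 ''k'' = nmem s ''k''" using agreeD[OF 2(2)] by simp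
  then show ?case using 2(1) k by (intro runs_RStore) (auto simp: vec_at_def)
qed (use l in \<open>auto simp: layout_def\<close>)

lemma runs_zero_row:
  assumes l: "layout n d s" and i: "nmem s ''i'' 0 = i" "i < d"
  shows "runs zero_row s (d * 50) (\<lambda>s'. \<forall>a<d. \<forall>b<d. rmem s' ''Q'' (a * d + b) =
    (if a = i then 0 else rmem s ''Q'' (a * d + b)))"
  unfolding zero_row_def
proof (rule runs_mono, rule runs_For[where N = d and B = 20 and B' = "d * 50" and I = "\<lambda>m s'. \<forall>a<d. \<forall>b<d. rmem s' ''Q'' (a * d + b) =
    (if a = i \<and> b < m then 0 else rmem s ''Q'' (a * d + b))"], goal_cases)
  case (8 j s1)
  have "nmem s1 ''i'' = nmem s ''i''" "nmem s1 ''o'' = nmem s ''o''"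
    using agreeD[OF 8(4)] by simp_all
  then show ?case using 8 i l by (intro runs_RStore) (auto simp: layout_def less_Suc_eq index_eq_iff)
qed (use l in \<open>auto simp: layout_def\<close>)

text \<open>Updating in place is safe: a new entry depends on its own old value and on
  \<open>c\<close>, \<open>y\<close> and \<open>q\<close>, which the loop does not write.\<close>

lemma runs_update_row:
  assumes l: "layout n d s" and i: "nmem s ''i'' 0 = i" "i < d"
  shows "runs update_row s (d * 75) (\<lambda>s'. \<forall>a<d. \<forall>b<d. rmem s' ''Q'' (a * d + b) =
    (if a = i then rmem s ''Q'' (a * d + b) - rmem s ''c'' 0 * (rmem s ''y'' a * rmem s ''y'' b) / (1 + rmem s ''c'' 0 * rmem s ''q'' 0)
     else rmem s ''Q'' (a * d + b)))"
  unfolding update_row_def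
proof (rule runs_mono, rule runs_For[where N = d and B = 50 and B' = "d * 75" and I = "\<lambda>m s'. \<forall>a<d. \<forall>b<d. rmem s' ''Q'' (a * d + b) =
    (if a = i \<and> b < m then rmem s ''Q'' (a * d + b) - rmem s ''c'' 0 * (rmem s ''y'' a * rmem s ''y'' b) / (1 + rmem s ''c'' 0 * rmem s ''q'' 0)
     else rmem s ''Q'' (a * d + b))"], goal_cases)
  case (8 j s1)
  have "nmem s1 ''i'' = nmem s ''i''" "nmem s1 ''o'' = nmem s ''o''"
    "rmem s1 ''c'' = rmem s ''c''" "rmem s1 ''y'' = rmem s ''y''" "rmem s1 ''q'' = rmem s ''q''"
    using agreeD[OF 8(4)] by simp_all
  then show ?case using 8 i l by (intro runs_RStore) (auto simp: layout_def less_Suc_eq index_eq_iff)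
qed (use l in \<open>auto simp: layout_def\<close>)

lemma runs_load_identity:
  assumes l: "layout n d s"
  shows "runs load_identity s (120 * (d * d)) (mat_at d (1\<^sub>m d))"
  unfolding load_identity_def
proof (rule runs_mono, rule runs_For[where N = d and B = "d * 50 + 20" and B' = "d * (d * 50 + 45)" and I = "\<lambda>m s'. \<forall>a<m. \<forall>b<d. rmem s' ''Q'' (a * d + b) =
    (if a = b then 1 else 0)"], goal_cases)
  case (8 i s1)
  have l1: "layout n d s1" by (rule layout_agree[OF l 8(4)]) auto
  show ?case
  proof (rule runs_Seq[OF runs_zero_row[OF l1 8(3,1)], where ?B2.0 = 15], goal_cases)
    case (1 s2)
    have "nmem s2 ''i'' = nmem s1 ''i''" "nmem s2 ''o'' = nmem s1 ''o''"
      using agreeD[OF 1(2)] by simp_all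
    then show ?case using 1(1) 8 l1
      by (intro runs_RStore) (auto simp: layout_def less_Suc_eq index_eq_iff)
  qed auto
next
  case 10
  show ?case using l by (cases d) (auto simp: layout_def algebra_simps)
qed (use l in \<open>auto simp: layout_def mat_at_def\<close>)

lemma scalar_prod_mult_at:
  assumes "mat_at d N s" "vec_at d v s" "N \<in> carrier_mat d d" "v \<in> carrier_vec d"
  shows "i < d \<Longrightarrow> (\<Sum>j<d. rmem s ''Q'' (i * d + j) * rmem s ''v'' j) = (N *\<^sub>v v) $ i"
    and "(\<Sum>i<d. rmem s ''v'' i * (N *\<^sub>v v) $ i) = quad_form N v"
  using assms by (auto simp: mat_at_def vec_at_def scalar_prod_def quad_form_def atLeast0LessThan intro!: sum.cong)

lemma runs_matvec_at:
  assumes l: "layout n d s" and N: "mat_at d N s" "N \<in> carrier_mat d d" and v: "vec_at d v s" "v \<in> carrier_vec d"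
  shows "runs matvec s (200 * (d * d)) (\<lambda>s'. (\<forall>i<d. rmem s' ''y'' i = (N *\<^sub>v v) $ i) \<and> rmem s' ''q'' 0 = quad_form N v)"
  using scalar_prod_mult_at[OF N(1) v(1) N(2) v(2)]
  by (intro runs_mono[OF runs_matvec[OF l]]) auto

lemma runs_rank_one_update:
  assumes l: "layout n d s" and N: "mat_at d N s" "N \<in> carrier_mat d d" and v: "vec_at d v s" "v \<in> carrier_vec d"
    and c: "rmem s ''c'' 0 = c"
  shows "runs rank_one_update s (400 * (d * d)) (mat_at d (sherman_morrison d c N v))"
  unfolding rank_one_update_def
proof (rule runs_Seq[OF runs_matvec_at[OF l N v], where ?B2.0 = "d * (d * 75 + 25)"], goal_cases)
  case (1 s1)
  have "rmem s1 ''Q'' = rmem s ''Q''" "rmem s1 ''c'' = rmem s ''c''" using agreeD[OF 1(2)] by simp_all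
  note s1 = this 1(1)
  have l1: "layout n d s1" by (rule layout_agree[OF l 1(2)]) auto
  let ?new = "\<lambda>a b. N $$ (a, b) - c * ((N *\<^sub>v v) $ a * (N *\<^sub>v v) $ b) / (1 + c * quad_form N v)"
  show ?case
  proof (rule runs_mono, rule runs_For[where N = d and B = "d * 75" and B' = "d * (d * 75 + 25)" and I = "\<lambda>m s'. \<forall>a<d. \<forall>b<d. rmem s' ''Q'' (a * d + b) =
    (if a < m then ?new a b else N $$ (a, b))"], goal_cases)
    case (8 i s2)
    have l2: "layout n d s2" by (rule layout_agree[OF l1 8(4)]) auto
    have "rmem s2 ''c'' = rmem s1 ''c''" "rmem s2 ''y'' = rmem s1 ''y''" "rmem s2 ''q'' = rmem s1 ''q''"
      using agreeD[OF 8(4)] by simp_all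
    then show ?case
      using 8 s1 c by (intro runs_mono[OF runs_update_row[OF l2 8(3,1)]]) (auto simp: less_Suc_eq)
  qed (use l1 s1 N in \<open>auto simp: layout_def mat_at_def sherman_morrison_def\<close>)
next
  case 2
  show ?case using l by (cases d) (auto simp: layout_def algebra_simps)
qed

section \<open>Inversion of the Gram matrix by rank-one updates\<close>

abbreviation "weight_exp \<equiv> RSub (RConst 1) (RDiv (RConst 2) (rcell ''p''))"

definition "add_row = Seq load_row
  (Seq (RStore ''c'' (NConst 0) (RPow (RCell ''w'' (ncell ''k'')) weight_exp)) rank_one_update)"

definition "drop_unit = Seq load_unit (Seq (RStore ''c'' (NConst 0) (RConst (-1))) rank_one_update)"

definition "invert_gram = Seq load_identity (Seq (For ''k'' ''n'' add_row) (For ''k'' ''d'' drop_unit))"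

lemma writes_invert_gram [simp]:
  "nwrites add_row = {''i'', ''j''}" "rwrites add_row = {''v'', ''c'', ''y'', ''q'', ''Q''}"
  "nwrites drop_unit = {''i'', ''j''}" "rwrites drop_unit = {''v'', ''c'', ''y'', ''q'', ''Q''}"
  "nwrites invert_gram = {''i'', ''j'', ''k''}" "rwrites invert_gram = {''v'', ''c'', ''y'', ''q'', ''Q''}"
  by (auto simp: add_row_def drop_unit_def invert_gram_def)

lemma runs_add_row:
  assumes l: "layout n d s" and k: "nmem s ''k'' 0 = k" "k < n" and N: "mat_at d N s" "N \<in> carrier_mat d d"
    and v: "\<forall>j<d. rmem s ''A'' (k * d + j) = v $ j" "v \<in> carrier_vec d"
    and w: "0 \<le> rmem s ''w'' k" "rmem s ''p'' 0 = p"
  shows "runs add_row s (500 * (d * d)) (mat_at d (sherman_morrison d (rmem s ''w'' k powr (1 - 2 / p)) N v))"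
  unfolding add_row_def
proof (rule runs_Seq[OF runs_load_row[OF l k], where ?B2.0 = "400 * (d * d) + 20"], goal_cases)
  case (1 s1)
  have s1: "nmem s1 ''k'' 0 = k" "rmem s1 ''w'' = rmem s ''w''" "rmem s1 ''p'' = rmem s ''p''" "rmem s1 ''Q'' = rmem s ''Q''"
    using agreeD[OF 1(2)] k by simp_all
  have l1: "layout n d s1" by (rule layout_agree[OF l 1(2)]) auto
  \<comment> \<open>On base zero \<open>RPow\<close> yields 0, as \<open>powr\<close> does, so a
    nonnegative weight suffices.\<close>
  show ?case
    by (rule runs_Seq_RStore[where B' = "400 * (d * d)"], rule runs_rank_one_update)
      (use l1 s1 1(1) v N w in \<open>auto simp: layout_def mat_at_def vec_at_def order_le_less\<close>)
next
  case 2
  show ?case using l by (cases d) (auto simp: layout_def algebra_simps)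
qed

lemma runs_drop_unit:
  assumes l: "layout n d s" and k: "nmem s ''k'' 0 = k" "k < d" and N: "mat_at d N s" "N \<in> carrier_mat d d"
  shows "runs drop_unit s (500 * (d * d)) (mat_at d (sherman_morrison d (-1) N (unit_vec d k)))"
  unfolding drop_unit_def
proof (rule runs_Seq[OF runs_load_unit[OF l k], where ?B2.0 = "400 * (d * d) + 20"], goal_cases)
  case (1 s1)
  have s1: "rmem s1 ''Q'' = rmem s ''Q''" using agreeD[OF 1(2)] by simp_all
  have l1: "layout n d s1" by (rule layout_agree[OF l 1(2)]) auto
  show ?case
    by (rule runs_Seq_RStore[where B' = "400 * (d * d)"], rule runs_rank_one_update)
      (use l1 s1 1(1) N in \<open>auto simp: layout_def mat_at_def vec_at_def\<close>)
next
  case 2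
  show ?case using l by (cases d) (auto simp: layout_def algebra_simps)
qed

text \<open>The inversion starts at the identity, adds the rows, and then removes the identity again one
  unit vector at a time, so that every intermediate matrix is positive definite.\<close>

primrec partial_gram :: "real mat \<Rightarrow> (nat \<Rightarrow> real) \<Rightarrow> nat \<Rightarrow> real mat" where
  "partial_gram A u 0 = 1\<^sub>m (dim_col A)"
| "partial_gram A u (Suc k) = rank_one (dim_col A) (u k) (partial_gram A u k) (row A k)"

text \<open>The second phase of the inversion: at \<open>k = 0\<close> all of the identity is still
  present, at \<open>k = d\<close> the plain Gram matrix remains.\<close>

definition padded_gram :: "real mat \<Rightarrow> (nat \<Rightarrow> real) \<Rightarrow> nat \<Rightarrow> real mat" where
  "padded_gram A u k = mat (dim_col A) (dim_col A)
     (\<lambda>(i, j). gram A u $$ (i, j) + (if i = j \<and> k \<le> i then 1 else 0))"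

lemma partial_gram_carrier [simp]: "A \<in> carrier_mat n d \<Longrightarrow> partial_gram A u k \<in> carrier_mat d d"
  by (cases k) (auto simp: rank_one_def)

lemma partial_gram_entry:
  assumes A: "A \<in> carrier_mat n d" and "i < d" "j < d" "k \<le> n"
  shows "partial_gram A u k $$ (i, j) = (if i = j then 1 else 0) + (\<Sum>l<k. u l * A $$ (l, i) * A $$ (l, j))"
  using assms(2-) by (induction k) (use A in \<open>auto simp: rank_one_def\<close>)

lemma padded_gram_0:
  assumes A: "A \<in> carrier_mat n d"
  shows "padded_gram A u 0 = partial_gram A u n"
  using A by (intro eq_matI) (auto simp: padded_gram_def partial_gram_entry[OF A] gram_entry[OF A] carrier_matD[OF partial_gram_carrier[OF A]])

lemma padded_gram_Suc:
  assumes A: "A \<in> carrier_mat n d" and "k < d"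
  shows "padded_gram A u (Suc k) = rank_one d (-1) (padded_gram A u k) (unit_vec d k)"
  using assms by (intro eq_matI) (auto simp: padded_gram_def rank_one_def)

lemma padded_gram_d:
  assumes A: "A \<in> carrier_mat n d"
  shows "padded_gram A u d = gram A u"
  using A by (intro eq_matI) (auto simp: padded_gram_def)

lemma pos_def_partial_gram:
  assumes A: "A \<in> carrier_mat n d" and u: "\<And>i. i < n \<Longrightarrow> 0 \<le> u i" and "k \<le> n"
  shows "pos_def d (partial_gram A u k)"
  using assms(3)
proof (induction k)
  case 0
  have "0 < quad_form (1\<^sub>m d) x" if "x \<in> carrier_vec d" "x \<noteq> 0\<^sub>v d" for x :: "real vec"
  proof -
    have "x \<bullet> x \<noteq> 0" using that by (auto simp: scalar_prod_def sum_nonneg_eq_0_iff vec_eq_iff)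
    moreover have "0 \<le> x \<bullet> x" by (auto simp: scalar_prod_def intro!: sum_nonneg)
    ultimately show ?thesis using that by (simp add: quad_form_def)
  qed
  then show ?case using A by (simp add: pos_def_def)
next
  case (Suc k)
  then have pd: "pos_def d (partial_gram A u k)" by simp
  have r: "row A k \<in> carrier_vec d" using A by auto
  have "0 < quad_form (partial_gram A u k) x + u k * (row A k \<bullet> x)\<^sup>2" if "x \<in> carrier_vec d" "x \<noteq> 0\<^sub>v d" for x
    using pd that u Suc.prems by (intro add_pos_nonneg) (auto simp: pos_def_def)
  then show ?case
    using pd A quad_form_rank_one[OF partial_gram_carrier[OF A] r] rank_one_symmetric[of "partial_gram A u k" d]
      partial_gram_carrier[OF A, of u "Suc k"]
    by (simp add: pos_def_def)
qed

text \<open>Every padded matrix dominates the Gram matrix. This is why the identity is removed only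
  after all rows have been added.\<close>

lemma pos_def_padded_gram:
  assumes A: "A \<in> carrier_mat n d" and pd: "pos_def d (gram A u)" and "k \<le> d"
  shows "pos_def d (padded_gram A u k)"
proof -
  have c: "padded_gram A u k \<in> carrier_mat d d" "gram A u \<in> carrier_mat d d" using A by (auto simp: padded_gram_def)
  have sym: "gram A u $$ (i, j) = gram A u $$ (j, i)" if "i < d" "j < d" for i j
    using gram_symmetric[OF A, of u] that c by (metis index_transpose_mat(1) carrier_matD)
  have "quad_form (gram A u) x \<le> quad_form (padded_gram A u k) x" if x: "x \<in> carrier_vec d" for x
  proof -
    have "0 \<le> (\<Sum>i<d. \<Sum>j<d. (if i = j \<and> k \<le> i then 1 else 0) * x $ i * x $ j)"
      by (intro sum_nonneg) auto
    then show ?thesis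
      unfolding quad_form_def smult_mult_scalar_prod[OF c(1) x x] smult_mult_scalar_prod[OF c(2) x x]
      using A by (simp add: padded_gram_def algebra_simps sum.distrib)
  qed
  moreover have "transpose_mat (padded_gram A u k) = padded_gram A u k"
    using A sym by (intro eq_matI) (auto simp: padded_gram_def)
  ultimately show ?thesis using pd c(1) by (force simp: pos_def_def)
qed

definition input_at :: "real mat \<Rightarrow> real \<Rightarrow> ram_state \<Rightarrow> bool" where
  "input_at A p s \<longleftrightarrow> layout (dim_row A) (dim_col A) s \<and> rmem s ''p'' 0 = p \<and>
     (\<forall>i<dim_row A. \<forall>j<dim_col A. rmem s ''A'' (i * dim_col A + j) = A $$ (i, j))"

lemma input_at_agree:
  assumes "input_at A p s" "agree c s s'" "{''n'', ''d'', ''o''} \<inter> nwrites c = {}" "{''p'', ''A''} \<inter> rwrites c = {}"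
  shows "input_at A p s'"
  using assms layout_agree[OF _ assms(2)] by (auto simp: input_at_def agreeD(2)[OF assms(2)])

context full_rank_matrix
begin

lemma runs_invert_gram:
  assumes \<sigma>: "input_at A p \<sigma>" and w: "row_weights A w" "\<forall>i<n. rmem \<sigma> ''w'' i = w i"
  shows "runs invert_gram \<sigma> (2000 * (n * (d * d))) (mat_at d (gram_inv A p w))"
  unfolding invert_gram_def
proof (rule runs_Seq[OF runs_load_identity[of n d \<sigma>], where ?B2.0 = "n * (500 * (d * d) + 25) + d * (500 * (d * d) + 25)"], goal_cases)
  case 1
  show ?case using \<sigma> by (simp add: input_at_def)
next
  case (2 s1)
  define u where "u = (\<lambda>i. w i powr s)"
  have s1: "input_at A p s1" by (rule input_at_agree[OF \<sigma> 2(2)]) auto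
  have w1: "\<forall>i<n. rmem s1 ''w'' i = w i" using w(2) agreeD[OF 2(2)] by simp
  \<comment> \<open>The invariants claim only that \<open>Q\<close> holds some inverse of the
    current matrix; uniqueness of inverses identifies the last one with
    \<open>gram_inv\<close>.\<close>
  let ?I = "\<lambda>k s'. \<exists>N. inverse_mats d (partial_gram A u k) N \<and> mat_at d N s'"
  let ?J = "\<lambda>k s'. \<exists>N. inverse_mats d (padded_gram A u k) N \<and> mat_at d N s'"
  have pd: "pos_def d (partial_gram A u k)" if "k \<le> n" for k
    using that by (intro pos_def_partial_gram[OF A]) (auto simp: u_def)
  have pd': "pos_def d (padded_gram A u k)" if "k \<le> d" for k
    using that gram_inv(1)[OF w(1)] by (intro pos_def_padded_gram[OF A]) (auto simp: u_def)
  show ?case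
  proof (rule runs_Seq[where ?R1.0 = "?I n" and ?B1.0 = "n * (500 * (d * d) + 25)" and ?B2.0 = "d * (500 * (d * d) + 25)"], goal_cases)
    case 1
    show ?case
    proof (rule runs_For[where B = "500 * (d * d)" and I = ?I], goal_cases)
      case 1
      show ?case using s1 by (simp add: input_at_def layout_def)
    next
      case 6
      have "inverse_mats d (1\<^sub>m d) (1\<^sub>m d)" by (simp add: inverse_mats_def)
      then show ?case using 2(1) by auto
    next
      case (8 k s2)
      then obtain N where N: "inverse_mats d (partial_gram A u k) N" "mat_at d N s2" by blast
      have s2: "input_at A p s2" by (rule input_at_agree[OF s1 8(4)]) auto
      have w2: "\<forall>i<n. rmem s2 ''w'' i = w i" using w1 agreeD[OF 8(4)] by simp
      have "inverse_mats d (partial_gram A u (Suc k)) (sherman_morrison d (u k) N (row A k))"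
        using inverse_mats_sherman_morrison[OF pd[of k] _ N(1), of "u k" "row A k"] pd[of "Suc k"] 8(1) by simp
      moreover have "runs add_row s2 (500 * (d * d)) (mat_at d (sherman_morrison d (u k) N (row A k)))"
        using runs_add_row[of n d s2 k N "row A k" p] s2 N w2 8 w(1)
        by (auto simp: input_at_def inverse_mats_def row_weights_def u_def)
      ultimately show ?case by (auto elim: runs_mono)
    qed (use n in \<open>auto simp: mat_at_def\<close>)
  next
    case (2 s2)
    have s2: "input_at A p s2" by (rule input_at_agree[OF s1 2(2)]) auto
    have "runs (For ''k'' ''d'' drop_unit) s2 (d * (500 * (d * d) + 25)) (?J d)"
    proof (rule runs_For[where B = "500 * (d * d)" and I = ?J], goal_cases)
      case 1
      show ?case using s2 by (simp add: input_at_def layout_def)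
    next
      case 6
      show ?case using 2(1) by (simp add: padded_gram_0[OF A])
    next
      case (8 k s3)
      then obtain N where N: "inverse_mats d (padded_gram A u k) N" "mat_at d N s3" by blast
      have s3: "input_at A p s3" by (rule input_at_agree[OF s2 8(4)]) auto
      have "inverse_mats d (padded_gram A u (Suc k)) (sherman_morrison d (-1) N (unit_vec d k))"
        using inverse_mats_sherman_morrison[OF pd'[of k] _ N(1), of "-1" "unit_vec d k"] pd'[of "Suc k"] 8(1) padded_gram_Suc[OF A 8(1), of u] by simp
      moreover have "runs drop_unit s3 (500 * (d * d)) (mat_at d (sherman_morrison d (-1) N (unit_vec d k)))"
        using runs_drop_unit[of n d s3 k N] s3 N 8 by (auto simp: input_at_def inverse_mats_def)
      ultimately show ?case by (auto elim: runs_mono)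
    qed (use d in \<open>auto simp: mat_at_def\<close>)
    then show ?case
    proof (rule runs_mono)
      fix s' assume "?J d s'"
      then show "mat_at d (gram_inv A p w) s'"
        using inverse_mats_unique[OF gram_inv(2)[OF w(1)]] by (auto simp: padded_gram_d[OF A] u_def)
    qed simp
  qed simp
next
  case 3
  define X where "X = n * (d * d)"
  \<comment> \<open>Because \<open>d \<le> n\<close>, removing the \<open>d\<close> unit vectors
    costs no more than adding the \<open>n\<close> rows.\<close>
  have h: "d * (d * d) \<le> X" "d * d \<le> X" "n \<le> X"
    using d_le_n n d by (auto simp: X_def)
  have "120 * (d * d) + (n * (500 * (d * d) + 25) + d * (500 * (d * d) + 25))
      = 120 * (d * d) + 500 * X + 25 * n + 500 * (d * (d * d)) + 25 * d"
    by (simp add: X_def algebra_simps)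
  also have "\<dots> \<le> 2000 * X" using h d_le_n by linarith
  finally show ?case by (simp add: X_def)
qed

end

section \<open>The algorithm\<close>

definition "row_quad = Seq load_row matvec"

text \<open>The sum \<open>S\<close> is increased before \<open>w\<close> changes, so after
  \<open>k\<close> rounds it covers the iterates below \<open>k\<close>, as in
  \<open>lewis_avg\<close>. Overwriting \<open>w\<close> row by row is safe since the inverse in
  \<open>Q\<close> is already complete.\<close>

definition "iter_row = Seq row_quad
  (Seq (RStore ''S'' (ncell ''k'') (RAdd (RCell ''S'' (ncell ''k'')) (RCell ''w'' (ncell ''k''))))
       (RStore ''w'' (ncell ''k'') (RMul (RPow (RCell ''w'' (ncell ''k'')) weight_exp) (rcell ''q''))))"

text \<open>The running power \<open>g\<close> of \<open>1 + \<delta>\<close> decides when to stop,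
  in place of a logarithm. The counter \<open>T\<close> is a real cell because its only use is as
  the divisor of the average.\<close>

definition "iter_weights = Seq invert_gram (Seq (For ''k'' ''n'' iter_row)
  (Seq (RStore ''T'' (NConst 0) (RAdd (rcell ''T'') (RConst 1)))
       (RStore ''g'' (NConst 0) (RMul (rcell ''g'') (RAdd (RConst 1) (rcell ''dl''))))))"

definition "init_weights = Seq offsets
  (Seq (For ''k'' ''n'' (RStore ''w'' (ncell ''k'') (RDiv (ROfNat (ncell ''d'')) (ROfNat (ncell ''n'')))))
  (Seq (RStore ''eta'' (NConst 0) (RSub (RPow (RAdd (RConst 1) (rcell ''eps'')) (RDiv (RConst 2) (rcell ''p''))) (RConst 1)))
  (Seq (RStore ''dl'' (NConst 0) (RDiv (RMul (rcell ''eta'') (rcell ''eta''))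
          (RMul (RAdd (RConst 1) (rcell ''eta'')) (ROfNat (ncell ''d'')))))
       (RStore ''g'' (NConst 0) (RConst 1)))))"

definition "average_weights = For ''k'' ''n'' (RStore ''w'' (ncell ''k'') (RDiv (RCell ''S'' (ncell ''k'')) (rcell ''T'')))"

text \<open>The averaged weight is replaced by a power of the form, the quantity that
  \<open>one_sided_lewis_approx\<close> controls.\<close>

definition "output_row = Seq row_quad
  (RStore ''w'' (ncell ''k'') (RPow (rcell ''q'') (RDiv (rcell ''p'') (RConst 2))))"

definition "lewis_prog = Seq init_weights
  (Seq (While (BNot (RLess (ROfNat (ncell ''n'')) (rcell ''g''))) iter_weights)
  (Seq average_weights (Seq invert_gram (For ''k'' ''n'' output_row))))"

lemma writes_lewis [simp]:
  "nwrites row_quad = {''i'', ''j''}" "rwrites row_quad = {''v'', ''y'', ''q''}"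
  "nwrites iter_row = {''i'', ''j''}" "rwrites iter_row = {''v'', ''y'', ''q'', ''S'', ''w''}"
  "nwrites iter_weights = {''i'', ''j'', ''k''}"
  "rwrites iter_weights = {''v'', ''y'', ''q'', ''S'', ''w'', ''c'', ''Q'', ''T'', ''g''}"
  "nwrites init_weights = {''i'', ''o'', ''k''}" "rwrites init_weights = {''w'', ''eta'', ''dl'', ''g''}"
  "nwrites average_weights = {''k''}" "rwrites average_weights = {''w''}"
  "nwrites output_row = {''i'', ''j''}" "rwrites output_row = {''v'', ''y'', ''q'', ''w''}"
  by (auto simp: row_quad_def iter_row_def iter_weights_def init_weights_def average_weights_def output_row_def)

context full_rank_matrix
begin

lemma layout_input: "input_at A p \<sigma> \<Longrightarrow> layout n d \<sigma>"
  by (simp add: input_at_def)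

lemma runs_row_quad:
  assumes \<sigma>: "input_at A p \<sigma>" and k: "nmem \<sigma> ''k'' 0 = k" "k < n" and N: "mat_at d N \<sigma>" "N \<in> carrier_mat d d"
  shows "runs row_quad \<sigma> (250 * (d * d)) (\<lambda>s'. rmem s' ''q'' 0 = quad_form N (row A k))"
  unfolding row_quad_def
proof (rule runs_Seq[OF runs_load_row[OF layout_input[OF \<sigma>] k], where ?B2.0 = "200 * (d * d)"], goal_cases)
  case (1 s1)
  have s1: "rmem s1 ''Q'' = rmem \<sigma> ''Q''" using agreeD[OF 1(2)] by simp
  have l1: "layout n d s1" by (rule layout_agree[OF layout_input[OF \<sigma>] 1(2)]) auto
  have "vec_at d (row A k) s1" using 1(1) \<sigma> k by (auto simp: vec_at_def input_at_def)
  then have "runs matvec s1 (200 * (d * d)) (\<lambda>s'. (\<forall>i<d. rmem s' ''y'' i = (N *\<^sub>v row A k) $ i) \<and> rmem s' ''q'' 0 = quad_form N (row A k))"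
    using N s1 k by (intro runs_matvec_at[OF l1]) (auto simp: mat_at_def)
  then show ?case by (rule runs_mono) auto
next
  case 2
  show ?case using d by (cases d) (auto simp: algebra_simps)
qed

lemma runs_iter_row:
  assumes \<sigma>: "input_at A p \<sigma>" and k: "nmem \<sigma> ''k'' 0 = k" "k < n" and N: "mat_at d N \<sigma>" "N \<in> carrier_mat d d"
    and w: "0 \<le> rmem \<sigma> ''w'' k"
  shows "runs iter_row \<sigma> (300 * (d * d)) (\<lambda>s'.
     rmem s' ''w'' = (rmem \<sigma> ''w'')(k := rmem \<sigma> ''w'' k powr s * quad_form N (row A k)) \<and>
     rmem s' ''S'' = (rmem \<sigma> ''S'')(k := rmem \<sigma> ''S'' k + rmem \<sigma> ''w'' k))"
  unfolding iter_row_def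
proof (rule runs_Seq[OF runs_row_quad[OF \<sigma> k N], where ?B2.0 = 40], goal_cases)
  case (1 s1)
  have "rmem s1 ''w'' = rmem \<sigma> ''w''" "rmem s1 ''S'' = rmem \<sigma> ''S''" "rmem s1 ''p'' 0 = p" "nmem s1 ''k'' 0 = k"
    using agreeD[OF 1(2)] \<sigma> k by (auto simp: input_at_def)
  then show ?case using 1(1) w
    by (intro runs_Seq_RStore[where B' = 25] runs_RStore) (auto simp: order_le_less)
next
  case 2
  show ?case using d by (cases d) (auto simp: algebra_simps)
qed

definition iter_inv :: "real \<Rightarrow> nat \<Rightarrow> ram_state \<Rightarrow> bool" where
  "iter_inv \<delta> k \<sigma> \<longleftrightarrow> input_at A p \<sigma> \<and> rmem \<sigma> ''dl'' 0 = \<delta> \<and> rmem \<sigma> ''T'' 0 = real k \<and> rmem \<sigma> ''g'' 0 = (1 + \<delta>) ^ k \<and>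
     (\<forall>i<n. rmem \<sigma> ''w'' i = lewis_iter A p k i \<and> rmem \<sigma> ''S'' i = (\<Sum>l<k. lewis_iter A p l i))"

lemma size_bounds: "d * d \<le> n * (d * d)" "n \<le> n * (d * d)" "1 \<le> n * (d * d)" "1 \<le> d * d"
  using n d by auto

lemma runs_iter_weights:
  assumes \<sigma>: "iter_inv \<delta> k \<sigma>"
  shows "runs iter_weights \<sigma> (2500 * (n * (d * d))) (iter_inv \<delta> (Suc k))"
proof -
  have in\<sigma>: "input_at A p \<sigma>" using \<sigma> by (simp add: iter_inv_def)
  let ?w = "lewis_iter A p k"
  let ?N = "gram_inv A p ?w"
  have w: "row_weights A ?w" by (rule lewis_iter_row_weights)
  have N: "?N \<in> carrier_mat d d" using gram_inv(3)[OF w] by (simp add: pos_def_def)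
  have "runs iter_weights \<sigma> (2500 * (n * (d * d))) (\<lambda>s'.
      (\<forall>i<n. rmem s' ''w'' i = lewis_iter A p (Suc k) i \<and> rmem s' ''S'' i = (\<Sum>l<Suc k. lewis_iter A p l i)) \<and>
      rmem s' ''T'' 0 = real (Suc k) \<and> rmem s' ''g'' 0 = (1 + \<delta>) ^ Suc k)"
    unfolding iter_weights_def
  proof (rule runs_Seq[OF runs_invert_gram[OF in\<sigma> w], where ?B2.0 = "n * (300 * (d * d) + 25) + 40"], goal_cases)
    case 1
    show ?case using \<sigma> by (simp add: iter_inv_def)
  next
    case (2 s1)
    have in1: "input_at A p s1" by (rule input_at_agree[OF in\<sigma> 2(2)]) auto
    have s1: "\<forall>i<n. rmem s1 ''w'' i = ?w i \<and> rmem s1 ''S'' i = (\<Sum>l<k. lewis_iter A p l i)"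
      "rmem s1 ''T'' 0 = real k" "rmem s1 ''g'' 0 = (1 + \<delta>) ^ k" "rmem s1 ''dl'' 0 = \<delta>"
      using agreeD[OF 2(2)] \<sigma> by (auto simp: iter_inv_def)
    let ?I = "\<lambda>m s'. \<forall>i<n. rmem s' ''w'' i = (if i < m then lewis_iter A p (Suc k) i else ?w i) \<and>
      rmem s' ''S'' i = (\<Sum>l<(if i < m then Suc k else k). lewis_iter A p l i)"
    have loop: "runs (For ''k'' ''n'' iter_row) s1 (n * (300 * (d * d) + 25)) (?I n)"
    proof (rule runs_For[where B = "300 * (d * d)" and I = ?I], goal_cases)
      case 1
      show ?case using in1 by (simp add: input_at_def layout_def)
    next
      case (8 m s2)
      have in2: "input_at A p s2" by (rule input_at_agree[OF in1 8(4)]) auto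
      have N2: "mat_at d ?N s2" using 2(1) agreeD[OF 8(4)] by (simp add: mat_at_def)
      have "0 \<le> rmem s2 ''w'' m" using 8(1,2) w by (simp add: row_weights_def)
      from runs_iter_row[OF in2 8(3,1) N2 N this] show ?case
        by (rule runs_mono) (use 8(1,2) in \<open>auto simp: less_Suc_eq\<close>)
    qed (use n s1 in auto)
    show ?case
    proof (rule runs_Seq[OF loop, where ?B2.0 = 40], goal_cases)
      case (1 s2)
      have "rmem s2 ''T'' = rmem s1 ''T''" "rmem s2 ''g'' = rmem s1 ''g''" "rmem s2 ''dl'' = rmem s1 ''dl''"
        using agreeD[OF 1(2)] by simp_all
      then show ?case using 1(1) s1
        by (intro runs_Seq_RStore[where B' = 20] runs_RStore) auto
    qed simp
  next
    case 3
    have "n * (300 * (d * d) + 25) = 300 * (n * (d * d)) + 25 * n" by (simp add: algebra_simps)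
    then show ?case using size_bounds by linarith
  qed
  then show ?thesis
    by (rule runs_mono) (use \<sigma> input_at_agree[OF in\<sigma>] in \<open>auto simp: iter_inv_def agreeD\<close>)
qed

lemma runs_init_weights:
  assumes \<epsilon>: "0 < \<epsilon>"
  shows "runs init_weights (input_state A p \<epsilon>) (200 * (n * (d * d))) (iter_inv (lewis_delta d p \<epsilon>) 0)"
proof -
  let ?s = "input_state A p \<epsilon>"
  have s: "nmem ?s ''n'' 0 = n" "nmem ?s ''d'' 0 = d" "nmem ?s ''o'' 0 = 0" "rmem ?s ''p'' 0 = p" "rmem ?s ''eps'' 0 = \<epsilon>"
    "rmem ?s ''S'' = (\<lambda>_. 0)" "rmem ?s ''T'' 0 = 0"
    by (auto simp: input_state_def)
  have sA: "rmem ?s ''A'' (i * d + j) = A $$ (i, j)" if "i < n" "j < d" for i j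
  proof -
    have "i * d + j < Suc i * d" using that by simp
    also have "\<dots> \<le> n * d" using that by (intro mult_le_mono1) simp
    finally show ?thesis using that by (simp add: input_state_def)
  qed
  have "runs init_weights ?s (200 * (n * (d * d))) (\<lambda>s'. layout n d s' \<and> (\<forall>i<n. rmem s' ''w'' i = real d / real n)
      \<and> rmem s' ''dl'' 0 = lewis_delta d p \<epsilon> \<and> rmem s' ''g'' 0 = 1)"
    unfolding init_weights_def
  proof (rule runs_Seq[OF runs_offsets[OF s(1-3) d d_le_n], where ?B2.0 = "n * 40 + 80"], goal_cases)
    case (1 s1)
    have s1: "rmem s1 ''p'' 0 = p" "rmem s1 ''eps'' 0 = \<epsilon>" using agreeD[OF 1(2)] s by auto
    let ?I = "\<lambda>m s'. \<forall>i<m. rmem s' ''w'' i = real d / real n"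
    have loop: "runs (For ''k'' ''n'' (RStore ''w'' (ncell ''k'') (RDiv (ROfNat (ncell ''d'')) (ROfNat (ncell ''n''))))) s1
        (n * 40) (?I n)"
    proof (rule runs_For[where B = 15 and I = ?I], goal_cases)
      case (8 m s2)
      have "layout n d s2" by (rule layout_agree[OF 1(1) 8(4)]) auto
      then show ?case using 8 by (intro runs_RStore) (auto simp: layout_def less_Suc_eq)
    qed (use 1 n in \<open>auto simp: layout_def\<close>)
    show ?case
    proof (rule runs_Seq[OF loop, where ?B2.0 = 80], goal_cases)
      case (1 s2)
      have l2: "layout n d s2" by (rule layout_agree[OF \<open>layout n d s1\<close> 1(2)]) auto
      have "rmem s2 ''p'' = rmem s1 ''p''" "rmem s2 ''eps'' = rmem s1 ''eps''" using agreeD[OF 1(2)] by auto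
      then show ?case using 1(1) s1 l2 \<epsilon>
        by (intro runs_Seq_RStore[where B' = 60] runs_Seq_RStore[where B' = 20] runs_RStore)
          (auto simp: layout_def lewis_delta_def lewis_eta_def power2_eq_square)
    qed simp
  next
    case 2
    show ?case using size_bounds by linarith
  qed
  then show ?thesis
  proof (rule runs_mono)
    fix s' assume s': "layout n d s' \<and> (\<forall>i<n. rmem s' ''w'' i = real d / real n)
      \<and> rmem s' ''dl'' 0 = lewis_delta d p \<epsilon> \<and> rmem s' ''g'' 0 = 1" and ag: "agree init_weights ?s s'"
    have "rmem s' ''A'' = rmem ?s ''A''" "rmem s' ''p'' = rmem ?s ''p''" "rmem s' ''S'' = rmem ?s ''S''" "rmem s' ''T'' = rmem ?s ''T''"
      using agreeD[OF ag] by simp_all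
    then show "iter_inv (lewis_delta d p \<epsilon>) 0 s'" using s' s sA by (simp add: iter_inv_def input_at_def)
  qed simp
qed

lemma lewis_delta_pos: "0 < \<epsilon> \<Longrightarrow> 0 < lewis_delta d p \<epsilon>"
  using lewis_eta(1)[OF p, of \<epsilon>] d unfolding lewis_delta_def by (intro divide_pos_pos mult_pos_pos) auto

text \<open>After \<open>k\<close> rounds \<open>g\<close> is \<open>(1 + \<delta>) ^ k\<close>, so
  the loop ends after exactly \<open>T\<close> rounds. That the power exceeds \<open>n\<close> gives
  the one-sided bound; minimality of \<open>T\<close> limits the cost.\<close>

lemma runs_lewis_prog:
  assumes \<epsilon>: "0 < \<epsilon>"
  defines "\<delta> \<equiv> lewis_delta d p \<epsilon>"
  defines "T \<equiv> LEAST T. real n < (1 + \<delta>) ^ T"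
  shows "0 < T" "real n < (1 + \<delta>) ^ T" "(1 + \<delta>) ^ (T - 1) \<le> real n"
    and "runs lewis_prog (input_state A p \<epsilon>) (6000 * (T * (n * (d * d)))) (\<lambda>s'.
      mat_at d (gram_inv A p (lewis_avg A p T)) s' \<and>
      (\<forall>i<n. rmem s' ''w'' i = quad_form (gram_inv A p (lewis_avg A p T)) (row A i) powr (p / 2)))"
proof -
  have \<delta>: "0 < \<delta>" unfolding \<delta>_def by (rule lewis_delta_pos[OF \<epsilon>])
  have "\<exists>T. real n < (1 + \<delta>) ^ T" using real_arch_pow[of "1 + \<delta>" "real n"] \<delta> by simp
  then show T: "real n < (1 + \<delta>) ^ T" unfolding T_def by (rule LeastI_ex)
  have below: "(1 + \<delta>) ^ k \<le> real n" if "k < T" for k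
  proof -
    have "\<not> real n < (1 + \<delta>) ^ k" using that unfolding T_def by (rule not_less_Least)
    then show ?thesis by simp
  qed
  \<comment> \<open>The power 0 is 1, which does not exceed \<open>n\<close>; hence the average
    never divides by zero.\<close>
  show T0: "0 < T" using T n by (cases T) auto
  show "(1 + \<delta>) ^ (T - 1) \<le> real n" using below[of "T - 1"] T0 by simp
  let ?v = "lewis_avg A p T"
  let ?N = "gram_inv A p ?v"
  have v: "row_weights A ?v" by (rule lewis_avg_row_weights[OF T0])
  have N: "?N \<in> carrier_mat d d" "\<And>i. i < n \<Longrightarrow> 0 \<le> quad_form ?N (row A i)"
    using gram_inv(3)[OF v] pos_def_psd[OF gram_inv(3)[OF v]] by (auto simp: pos_def_def psd_def)
  let ?b = "BNot (RLess (ROfNat (ncell ''n'')) (rcell ''g''))"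
  let ?X = "n * (d * d)"
  show "runs lewis_prog (input_state A p \<epsilon>) (6000 * (T * ?X)) (\<lambda>s'.
      mat_at d ?N s' \<and> (\<forall>i<n. rmem s' ''w'' i = quad_form ?N (row A i) powr (p / 2)))"
    unfolding lewis_prog_def
  proof (rule runs_Seq[OF runs_init_weights[OF \<epsilon>, folded \<delta>_def], where ?B2.0 = "T * (2500 * ?X + 10) + 10 + (n * 40 + (2000 * ?X + n * (300 * (d * d) + 25)))"], goal_cases)
    case (1 s0)
    have loop: "runs (While ?b iter_weights) s0 (T * (2500 * ?X + 10) + 10) (iter_inv \<delta> T)"
    proof (rule runs_While[where I = "iter_inv \<delta>" and B = "2500 * ?X"], goal_cases)
      case (2 k s1)
      have "bval ?b s1" using 2(2) below[OF 2(1)] by (simp add: iter_inv_def input_at_def layout_def)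
      then show ?case using runs_iter_weights[OF 2(2)] by simp
    next
      case (3 s1)
      then show ?case using T by (simp add: iter_inv_def input_at_def layout_def)
    next
      case 4
      show ?case by (simp add: algebra_simps)
    qed (use 1 in auto)
    show ?case
    proof (rule runs_Seq[OF loop, where ?B2.0 = "n * 40 + (2000 * ?X + n * (300 * (d * d) + 25))"], goal_cases)
      case (1 s1)
      have in1: "input_at A p s1" using 1 by (simp add: iter_inv_def)
      let ?I = "\<lambda>m s'. \<forall>i<m. rmem s' ''w'' i = ?v i"
      have avg: "runs average_weights s1 (n * 40) (?I n)"
        unfolding average_weights_def
      proof (rule runs_For[where B = 15 and I = ?I], goal_cases)
        case 1
        show ?case using in1 by (simp add: input_at_def layout_def)
      next
        case (8 m s2)
        have "rmem s2 ''S'' = rmem s1 ''S''" "rmem s2 ''T'' = rmem s1 ''T''" using agreeD[OF 8(4)] by simp_all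
        then show ?case using 8 1(1) by (intro runs_RStore) (auto simp: iter_inv_def less_Suc_eq lewis_avg_def)
      qed (use n in auto)
      show ?case
      proof (rule runs_Seq[OF avg, where ?B2.0 = "2000 * ?X + n * (300 * (d * d) + 25)"], goal_cases)
        case (1 s2)
        have in2: "input_at A p s2" by (rule input_at_agree[OF in1 1(2)]) auto
        show ?case
        proof (rule runs_Seq[OF runs_invert_gram[OF in2 v 1(1)], where ?B2.0 = "n * (300 * (d * d) + 25)"], goal_cases)
          case (1 s3)
          have in3: "input_at A p s3" by (rule input_at_agree[OF in2 1(2)]) auto
          let ?I = "\<lambda>m s'. \<forall>i<m. rmem s' ''w'' i = quad_form ?N (row A i) powr (p / 2)"
          have "runs (For ''k'' ''n'' output_row) s3 (n * (300 * (d * d) + 25)) (?I n)"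
          proof (rule runs_For[where B = "300 * (d * d)" and I = ?I], goal_cases)
            case 1
            show ?case using in3 by (simp add: input_at_def layout_def)
          next
            case (8 m s4)
            have in4: "input_at A p s4" by (rule input_at_agree[OF in3 8(4)]) auto
            have N4: "mat_at d ?N s4" using 1(1) agreeD[OF 8(4)] by (simp add: mat_at_def)
            show ?case
              unfolding output_row_def
            proof (rule runs_Seq[OF runs_row_quad[OF in4 8(3,1) N4 N(1)], where ?B2.0 = 20], goal_cases)
              case (1 s5)
              have "rmem s5 ''w'' = rmem s4 ''w''" "rmem s5 ''p'' 0 = p" "nmem s5 ''k'' 0 = m"
                using agreeD[OF 1(2)] in4 8(3) by (auto simp: input_at_def)
              then show ?case using 1(1) 8(1,2) N(2)[OF 8(1)]
                by (intro runs_RStore) (auto simp: less_Suc_eq order_le_less)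
            next
              case 2
              show ?case using size_bounds by linarith
            qed
          qed (use n in auto)
          then show ?case
            by (rule runs_mono) (use 1(1) in \<open>auto simp: mat_at_def agreeD\<close>)
        qed simp
      qed simp
    qed simp
  next
    case 2
    \<comment> \<open>Each term of the cost is bounded by a multiple of \<open>T * ?X\<close>; the
      multiples add up to 5085.\<close>
    have "1 * ?X \<le> T * ?X" using T0 by (intro mult_le_mono1) simp
    moreover have "T * 1 \<le> T * ?X" using size_bounds by (intro mult_le_mono2) simp
    moreover have "T * (2500 * ?X + 10) = 2500 * (T * ?X) + 10 * T" by (simp add: algebra_simps)
    moreover have "n * (300 * (d * d) + 25) = 300 * ?X + 25 * n" by (simp add: algebra_simps)
    ultimately show ?case using size_bounds by linarith
  qed
qed

text \<open>From \<open>\<delta> / (1 + \<delta>) \<le> ln (1 + \<delta>)\<close> it follows that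
  \<open>T - 1\<close> is at most \<open>(1 + 1 / \<delta>) * ln n\<close>, where
  \<open>1 / \<delta>\<close> is \<open>d\<close> times the second summand of the constant; its
  first summand covers large \<open>\<delta>\<close>. The factor 2 pays for the last round, since
  \<open>1 \<le> ln n\<close> for \<open>3 \<le> n\<close>.\<close>

lemma lewis_iterations_bound:
  assumes \<epsilon>: "0 < \<epsilon>" and n3: "3 \<le> n"
    and T: "(1 + lewis_delta d p \<epsilon>) ^ (T - 1) \<le> real n"
  shows "real T \<le> 2 * (1 + (1 + lewis_eta p \<epsilon>) / (lewis_eta p \<epsilon>)\<^sup>2) * d * ln n"
proof -
  define \<delta> where "\<delta> = lewis_delta d p \<epsilon>"
  define F where "F = 1 + (1 + lewis_eta p \<epsilon>) / (lewis_eta p \<epsilon>)\<^sup>2"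
  have \<delta>: "0 < \<delta>" unfolding \<delta>_def by (rule lewis_delta_pos[OF \<epsilon>])
  have \<eta>: "0 < lewis_eta p \<epsilon>" by (rule lewis_eta(1)[OF p \<epsilon>])
  have F: "1 \<le> F" using \<eta> by (simp add: F_def)
  have "exp 1 \<le> (3::real)" by (rule exp_le)
  then have ln1: "1 \<le> ln (real n)" using n3 by (subst ln_ge_iff) auto
  have "ln (1 / (1 + \<delta>)) \<le> 1 / (1 + \<delta>) - 1" using \<delta> by (intro ln_le_minus_one) simp
  then have "\<delta> / (1 + \<delta>) \<le> ln (1 + \<delta>)" using \<delta> by (simp add: ln_div field_simps)
  then have "\<delta> \<le> ln (1 + \<delta>) * (1 + \<delta>)" using \<delta> by (simp add: pos_divide_le_eq)
  moreover have "1 / \<delta> = d * ((1 + lewis_eta p \<epsilon>) / (lewis_eta p \<epsilon>)\<^sup>2)"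
    by (simp add: \<delta>_def lewis_delta_def)
  moreover have "1 + \<delta> \<le> \<delta> * (d * F)"
  proof -
    have "\<delta> * (d * F) = \<delta> * d + \<delta> * (1 / \<delta>)"
      unfolding calculation(2) F_def by (simp add: algebra_simps)
    also have "\<dots> = \<delta> * d + 1" using \<delta> by simp
    also have "\<delta> * 1 \<le> \<delta> * d" using \<delta> d by (intro mult_left_mono) auto
    ultimately show ?thesis by simp
  qed
  moreover from this have "ln (1 + \<delta>) * (1 + \<delta>) \<le> ln (1 + \<delta>) * (\<delta> * (d * F))"
    using \<delta> by (intro mult_left_mono) auto
  ultimately have "\<delta> * 1 \<le> \<delta> * (ln (1 + \<delta>) * (d * F))" by (simp add: mult.left_commute)
  then have "1 \<le> ln (1 + \<delta>) * (d * F)" using \<delta> by (simp only: mult_le_cancel_left_pos)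
  have "real (T - 1) * ln (1 + \<delta>) = ln ((1 + \<delta>) ^ (T - 1))" using \<delta> by (simp add: ln_realpow)
  also have "\<dots> \<le> ln n" using T \<delta> n3 by (simp add: \<delta>_def)
  finally have "real (T - 1) * ln (1 + \<delta>) * (d * F) \<le> ln n * (d * F)" using F by (intro mult_right_mono) auto
  moreover have "real (T - 1) * 1 \<le> real (T - 1) * (ln (1 + \<delta>) * (d * F))"
    using \<open>1 \<le> ln (1 + \<delta>) * (d * F)\<close> by (intro mult_left_mono) auto
  ultimately have "real (T - 1) \<le> ln n * (d * F)" by (simp add: mult.assoc)
  moreover have "1 * (1 * 1) \<le> ln n * (d * F)" using ln1 F d by (intro mult_mono) auto
  ultimately have "real T \<le> 2 * (ln n * (d * F))" by linarith
  then show ?thesis by (simp only: F_def[symmetric] mult_ac)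
qed

end

text \<open>This needs \<open>exp 1 < 3\<close> strictly: \<open>5 / 6 \<le> exp (- 1 / 6)\<close>
  gives \<open>exp 1 \<le> (6 / 5) ^ 6\<close>, which is below 3.\<close>

lemma ln_ln_3_pos: "0 < ln (ln (3::real))"
proof -
  have "5 / 6 \<le> exp (- (1 / 6) :: real)" using exp_ge_add_one_self[of "- (1 / 6) :: real"] by simp
  then have "(5 / 6) ^ 6 \<le> exp (- (1 / 6) :: real) ^ 6" by (intro power_mono) auto
  also have "\<dots> = exp (- 1)" by (simp add: exp_of_nat_mult[symmetric])
  finally have "exp 1 * (5 / 6) ^ 6 \<le> exp 1 * exp (- 1 :: real)" by (intro mult_left_mono) auto
  also have "\<dots> = 1" by (simp add: exp_add[symmetric])
  finally have "exp 1 < (3::real)" by (simp add: power_divide)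
  then have "ln (exp 1) < ln (3::real)" by (subst ln_less_cancel_iff) auto
  then show ?thesis by simp
qed

theorem theorem4p4:
  shows "\<exists>(f :: real \<Rightarrow> real \<Rightarrow> real) (C :: nat).
    (\<exists>(prog :: com) (K :: real). \<forall>(n :: nat) (d :: nat) (A :: real mat) (p :: real) (\<epsilon> :: real).
       A \<in> carrier_mat n d \<and> 0 < d \<and> vec_space.rank n A = d \<and> 2 \<le> p \<and> 0 < \<epsilon> \<longrightarrow>
       (\<exists>t s. exec prog (input_state A p \<epsilon>) t s \<and>
          (\<forall>i<n. approx_factor (1 + \<epsilon>) (output_weights n s $ i) (lewis_weights A p $ i)) \<and>
          (3 \<le> n \<longrightarrow>
             real t \<le> K * (f p \<epsilon> * real n * ln (real n) * ln (ln (real n)) * real d ^ C)))) \<and>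
    (\<exists>(prog :: com) (K :: real). \<forall>(n :: nat) (d :: nat) (A :: real mat) (p :: real) (\<epsilon> :: real).
       A \<in> carrier_mat n d \<and> 0 < d \<and> vec_space.rank n A = d \<and> 2 \<le> p \<and> 0 < \<epsilon> \<longrightarrow>
       (\<exists>t s. exec prog (input_state A p \<epsilon>) t s \<and>
          (\<exists>Q. is_lewis_form A p Q \<and> approx_form d (1 + \<epsilon>) (output_form d s) Q) \<and>
          (3 \<le> n \<longrightarrow>
             real t \<le> K * (f p \<epsilon> * real n * ln (real n) * ln (ln (real n)) * real d ^ C))))"
proof -
  define f where "f p \<epsilon> = 1 + (1 + lewis_eta p \<epsilon>) / (lewis_eta p \<epsilon>)\<^sup>2" for p \<epsilon>
  \<comment> \<open>The time \<open>6000 * T * n * d\<^sup>2\<close> with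
    \<open>T \<le> 2 * f p \<epsilon> * d * ln n\<close> gives 12000 and the exponent 3 of
    \<open>d\<close>. Dividing by \<open>ln (ln 3)\<close> makes room for the factor
    \<open>ln (ln n)\<close>, as the quotient is at least 1 for \<open>3 \<le> n\<close>.\<close>
  define K where "K = 12000 / ln (ln (3::real))"
  \<comment> \<open>One program serves both halves: it leaves the weights in \<open>w\<close> and
    the form in \<open>Q\<close>.\<close>
  have main: "\<exists>t s. exec lewis_prog (input_state A p \<epsilon>) t s \<and>
      (\<forall>i<n. approx_factor (1 + \<epsilon>) (output_weights n s $ i) (lewis_weights A p $ i)) \<and>
      (\<exists>Q. is_lewis_form A p Q \<and> approx_form d (1 + \<epsilon>) (output_form d s) Q) \<and>
      (3 \<le> n \<longrightarrow> real t \<le> K * (f p \<epsilon> * real n * ln (real n) * ln (ln (real n)) * real d ^ 3))"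
    if as: "A \<in> carrier_mat n d" "0 < d" "vec_space.rank n A = d" "2 \<le> p" "0 < \<epsilon>" for n d A p \<epsilon>
  proof -
    interpret full_rank_matrix A n d p by unfold_locales (use as in auto)
    define \<delta> where "\<delta> = lewis_delta d p \<epsilon>"
    define T where "T = (LEAST T. real n < (1 + \<delta>) ^ T)"
    note prog = runs_lewis_prog[OF as(5), folded \<delta>_def, folded T_def]
    define N where "N = gram_inv A p (lewis_avg A p T)"
    obtain t s' where t: "exec lewis_prog (input_state A p \<epsilon>) t s'" "t \<le> 6000 * (T * (n * (d * d)))"
      and s': "mat_at d N s'" "\<forall>i<n. rmem s' ''w'' i = quad_form N (row A i) powr (p / 2)"
      using prog(4) by (auto simp: runs_def N_def)
    have \<delta>: "0 < \<delta>" unfolding \<delta>_def by (rule lewis_delta_pos[OF as(5)])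
    have pdN: "pos_def d N" unfolding N_def by (rule gram_inv(3)[OF lewis_avg_row_weights[OF prog(1)]])
    have os: "one_sided A p \<delta> (lewis_avg A p T) N"
      unfolding N_def using prog(1,2) \<delta> by (intro lewis_avg_one_sided) auto
    note approx = one_sided_lewis_approx[OF as(5) os[unfolded \<delta>_def] pdN]
    have "output_form d s' = N"
      using s'(1) pdN by (intro eq_matI) (auto simp: output_form_def mat_at_def pos_def_def)
    moreover have "real t \<le> K * (f p \<epsilon> * real n * ln (real n) * ln (ln (real n)) * real d ^ 3)" if n3: "3 \<le> n"
    proof -
      have L: "ln (ln 3) \<le> ln (ln (real n))" "0 < ln (real n)"
        using n3 ln_ln_3_pos by auto
      have fpos: "0 \<le> f p \<epsilon>" using lewis_eta(1)[OF p as(5)] by (simp add: f_def)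
      have "real t \<le> 6000 * (real T * (real n * (real d * real d)))"
        using t(2) by (metis of_nat_le_iff of_nat_mult of_nat_numeral)
      also have "\<dots> \<le> 6000 * ((2 * f p \<epsilon> * d * ln n) * (real n * (real d * real d)))"
        using lewis_iterations_bound[OF as(5) n3, of T] prog(3)
        by (intro mult_left_mono mult_right_mono) (auto simp: f_def \<delta>_def)
      also have "\<dots> = 12000 * (f p \<epsilon> * real n * ln n * real d ^ 3) * 1" by (simp add: power3_eq_cube)
      also have "\<dots> \<le> 12000 * (f p \<epsilon> * real n * ln n * real d ^ 3) * (ln (ln (real n)) / ln (ln 3))"
        using L fpos ln_ln_3_pos by (intro mult_left_mono mult_nonneg_nonneg) auto
      finally show ?thesis by (simp add: K_def mult_ac)
    qed
    ultimately show ?thesis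
      using t(1) approx s'(2) by (intro exI[of _ t] exI[of _ s']) (auto simp: output_weights_def)
  qed
  show ?thesis
  proof (rule exI[of _ f], rule exI[of _ 3], rule conjI, goal_cases)
    case 1
    show ?case
    proof (rule exI[of _ lewis_prog], rule exI[of _ K], intro allI impI, goal_cases)
      case (1 n d A p \<epsilon>)
      then show ?case using main[of A n d p \<epsilon>] by blast
    qed
  next
    case 2
    show ?case
    proof (rule exI[of _ lewis_prog], rule exI[of _ K], intro allI impI, goal_cases)
      case (1 n d A p \<epsilon>)
      then show ?case using main[of A n d p \<epsilon>] by blast
    qed
  qed
qed

end
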